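(* Let $\lambda>0$. For $x>0$, $t>0$ the process $\mathcal{L}^{1/3}(t)$ has density $$\frac{\Pr\{\mathcal{L}^{1/3}(t)\in dx\}}{dx}=\frac{2\lambda}{\sqrt\pi}\int_0^t ds\int_0^\infty dw\;e^{-w}w^{-\frac16}\,\mathrm{Ai}\left(-x\sqrt[3]{\frac{2^2w}{3(t-s)^2}}\right)\mathrm{Ai}\left(\frac{2\lambda x}{\sqrt[3]{3s}}\right)\frac{3}{\sqrt[3]{3s}}\sqrt[3]{\frac{2^2}{3(t-s)^2}}\left[\frac{x}{2s}+\frac{x}{t-s}\right].$$
   Context: For $0<\alpha<1$, $H^\alpha(t)$, $t>0$, is the stable subordinator with $\mathbb{E}e^{-\mu H^\alpha(t)}=e^{-t\mu^\alpha}$, $\mu>0$. Let $H_1^{2/3}$ and $H_2^{1/3}$ be independent stable subordinators of orders $\frac23$ and $\frac13$, $\mathcal{H}^{1/3}(t)=H_1^{2/3}(t)+(2\lambda)^3H_2^{1/3}(t)$, and $\mathcal{L}^{1/3}(t)=\inf\{s>0:\mathcal{H}^{1/3}(s)\ge t\}$, $t>0$. $\mathrm{Ai}$ denotes the Airy function. *)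

theory Defs
  imports "HOL-Probability.Probability"
begin

text \<open>
  The Airy function on the real line, by its standard integral representation. The integral over
  \<open>[0,\<infinity>)\<close> converges only conditionally, so it is written as a limit of integrals
  over bounded intervals.
\<close>

definition Airy_Ai :: "real \<Rightarrow> real" where
  "Airy_Ai x = 1 / pi * Lim at_top (\<lambda>b. integral {0..b} (\<lambda>u. cos (u ^ 3 / 3 + x * u)))"

context prob_space
begin

text \<open>
  Processes are indexed by \<open>real\<close>, and only times \<open>t \<ge> 0\<close> matter.
  Left limits of the paths need no separate clause, because the paths are nondecreasing.
\<close>

definition subordinator :: "(real \<Rightarrow> 'a \<Rightarrow> real) \<Rightarrow> bool" where
  "subordinator H \<longleftrightarrow>
     (\<forall>t\<ge>0. random_variable borel (H t)) \<and>
     (\<forall>\<omega>\<in>space M. H 0 \<omega> = 0 \<and> mono_on {0..} (\<lambda>t. H t \<omega>) \<and>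
        (\<forall>t\<ge>0. continuous (at_right t) (\<lambda>s. H s \<omega>))) \<and>
     (\<forall>(n::nat) \<tau>. 0 \<le> \<tau> 0 \<and> (\<forall>i<n. \<tau> i \<le> \<tau> (Suc i)) \<longrightarrow>
        indep_vars (\<lambda>_. borel) (\<lambda>i \<omega>. H (\<tau> (Suc i)) \<omega> - H (\<tau> i) \<omega>) {..<n}) \<and>
     (\<forall>s\<ge>0. \<forall>t\<ge>0. distr M borel (\<lambda>\<omega>. H (s + t) \<omega> - H s \<omega>) = distr M borel (H t))"

definition stable_subordinator :: "real \<Rightarrow> (real \<Rightarrow> 'a \<Rightarrow> real) \<Rightarrow> bool" where
  "stable_subordinator \<alpha> H \<longleftrightarrow>
     0 < \<alpha> \<and> \<alpha> < 1 \<and> subordinator H \<and>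
     (\<forall>t>0. \<forall>\<mu>>0. expectation (\<lambda>\<omega>. exp (- \<mu> * H t \<omega>)) = exp (- t * \<mu> powr \<alpha>))"

text \<open>Independence of the two processes as a whole, i.e. of the families of all coordinates.\<close>

definition indep_processes :: "(real \<Rightarrow> 'a \<Rightarrow> real) \<Rightarrow> (real \<Rightarrow> 'a \<Rightarrow> real) \<Rightarrow> bool" where
  "indep_processes X Y \<longleftrightarrow>
     indep_var (\<Pi>\<^sub>M t\<in>{0..}. borel) (\<lambda>\<omega>. \<lambda>t\<in>{0..}. X t \<omega>)
               (\<Pi>\<^sub>M t\<in>{0..}. borel) (\<lambda>\<omega>. \<lambda>t\<in>{0..}. Y t \<omega>)"

end

definition sum_process ::
  "real \<Rightarrow> (real \<Rightarrow> 'a \<Rightarrow> real) \<Rightarrow> (real \<Rightarrow> 'a \<Rightarrow> real) \<Rightarrow> real \<Rightarrow> 'a \<Rightarrow> real" where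
  "sum_process lam H1 H2 t \<omega> = H1 t \<omega> + (2 * lam) ^ 3 * H2 t \<omega>"

text \<open>
  On the null event that the path never reaches level \<open>t\<close> the set is empty and its
  \<open>Inf\<close> is an arbitrary real instead of \<open>\<infinity>\<close>.
\<close>

definition inverse_process :: "(real \<Rightarrow> 'a \<Rightarrow> real) \<Rightarrow> real \<Rightarrow> 'a \<Rightarrow> real" where
  "inverse_process K t \<omega> = Inf {s. s > 0 \<and> K s \<omega> \<ge> t}"

definition density_integrand :: "real \<Rightarrow> real \<Rightarrow> real \<Rightarrow> real \<Rightarrow> real \<Rightarrow> real" where
  "density_integrand lam t x s w =
     exp (- w) * w powr (- 1 / 6)
     * Airy_Ai (- x * root 3 (2\<^sup>2 * w / (3 * (t - s)\<^sup>2)))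
     * Airy_Ai (2 * lam * x / root 3 (3 * s))
     * (3 / root 3 (3 * s)) * root 3 (2\<^sup>2 / (3 * (t - s)\<^sup>2))
     * (x / (2 * s) + x / (t - s))"

text \<open>
  The order of integration matters: near \<open>s = t\<close> the inner integral is small only by
  cancellation, and the integrand is not absolutely integrable in \<open>(s, w)\<close> jointly.
\<close>

definition inverse_density :: "real \<Rightarrow> real \<Rightarrow> real \<Rightarrow> real" where
  "inverse_density lam t x =
     2 * lam / sqrt pi *
     (LBINT s:{0<..<t}. (LBINT w:{0<..}. density_integrand lam t x s w))"

end

theory Submission
  imports Defs "HOL-Complex_Analysis.Complex_Analysis" "HOL-Real_Asymp.Real_Asymp"
begin

text \<open>
  Since the paths of \<open>K = H\<^sub>1 + (2 lam)\<^sup>3 H\<^sub>2\<close> are nondecreasing and right continuous, the events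
  \<open>L(t) \<le> x\<close> and \<open>K(x) \<ge> t\<close> agree almost surely, so the density of \<open>L(t)\<close> must have the integral
  \<open>P(K(a) < t) - P(K(b) < t)\<close> over \<open>[a, b]\<close>. With \<open>c = 2 lam\<close> and \<open>\<Psi>(\<mu>) = \<mu>\<^bsup>2/3\<^esup> + c \<mu>\<^bsup>1/3\<^esup>\<close> the Laplace transform
  in \<open>t\<close> of that difference is \<open>(exp (- a \<Psi>) - exp (- b \<Psi>)) / \<mu>\<close>, hence the density has the transform
  \<open>(\<mu>\<^bsup>-1/3\<^esup> + c \<mu>\<^bsup>-2/3\<^esup>) exp (- x \<Psi>)\<close>, which is the transform of
  \<open>l\<^sub>2(x, \<cdot>) * h\<^sub>1(c x, \<cdot>) + c l\<^sub>1(c x, \<cdot>) * h\<^sub>2(x, \<cdot>)\<close>. Here \<open>h\<^sub>a(x, \<cdot>)\<close> is the stable density of order \<open>a/3\<close> and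
  \<open>l\<^sub>a\<close> the density of the inverse stable subordinator, with \<open>h\<^sub>a(x, t) = a x / (3 t) l\<^sub>a(x, t)\<close>.

  Both are represented by one family of absolutely convergent integrals, bounded and jointly continuous
  away from \<open>x = 0\<close>; this is what makes the integral over \<open>s\<close> converge. Uniqueness of Laplace
  transforms gives the identity for every \<open>t\<close>, and also the nonnegativity of the density. Turning the
  contour expresses \<open>l\<^sub>1\<close> and \<open>l\<^sub>2\<close> by the Airy function, in the case of \<open>l\<^sub>2\<close> by averaging over \<open>w\<close> with
  \<open>\<integral> w\<^bsup>-1/2\<^esup> exp (- w - A\<^sup>2 / w) dw = sqrt pi exp (- 2 A)\<close>.
\<close>

subsection \<open>Stable kernels as integrals over a ray\<close>

text \<open>Orders in thirds make z with \<mu> = z^3 the natural variable: the fractional powers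
  become z and z^2, the branch cut disappears, and the imaginary axis turns into the two rays arg z
  = pi/6 and arg z = -pi/6. On these rays exp(T z^3) only oscillates, so all decay comes from exp(-x
  z^a). Estimates are therefore uniform in T but need x bounded away from 0. This is why
  probabilities are compared on intervals [a, b] with a > 0; the mass near 0 is recovered at the end
  by a monotone limit. The Airy formulas belong to the ray arg z = pi/3, where z^3 = -r^3 and the
  decay comes from T instead, while exp(-x z^2) even grows like exp(x r^2 / 2). No single ray serves
  both purposes. The integral over w is therefore evaluated for each fixed s, its value is
  recognised as a kernel on the first ray, and only that kernel is integrated over s.\<close>

lemma tendsto_integral_Icc_at_top:
  fixes f :: "real \<Rightarrow> 'a::euclidean_space"
  assumes int: "set_integrable lborel {0<..} f" and cont: "continuous_on {0..} f"
  shows "((\<lambda>b. integral {0..b} f) \<longlongrightarrow> (LBINT v:{0<..}. f v)) at_top"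
proof -
  have "((\<lambda>b. LINT x|lborel. indicator {..b} x *\<^sub>R (indicator {0<..} x *\<^sub>R f x))
          \<longlongrightarrow> (LBINT v:{0<..}. f v)) at_top"
    unfolding set_lebesgue_integral_def
    by (rule tendsto_integral_at_top) (use int in \<open>auto simp: set_integrable_def\<close>)
  moreover have "eventually (\<lambda>b. (LINT x|lborel. indicator {..b} x *\<^sub>R (indicator {0<..} x *\<^sub>R f x))
      = integral {0..b} f) at_top"
    using eventually_ge_at_top[of "0::real"]
  proof eventually_elim
    case (elim b)
    have c: "continuous_on {0..b} f"
      using cont by (rule continuous_on_subset) auto
    have "(LINT x|lborel. indicator {..b} x *\<^sub>R (indicator {0<..} x *\<^sub>R f x)) = (LBINT x:{0<..b}. f x)"
      unfolding set_lebesgue_integral_def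
      by (intro Bochner_Integration.integral_cong) (auto split: split_indicator)
    also have "\<dots> = (LBINT x:{0..b}. f x)"
      unfolding set_lebesgue_integral_def
    proof (rule integral_cong_AE)
      have "set_borel_measurable borel {0<..b} f" "set_borel_measurable borel {0..b} f"
        using c by (auto intro!: set_measurable_continuous_on continuous_on_subset[OF c])
      then show "(\<lambda>x. indicat_real {0<..b} x *\<^sub>R f x) \<in> borel_measurable lborel"
        "(\<lambda>x. indicat_real {0..b} x *\<^sub>R f x) \<in> borel_measurable lborel"
        by (auto simp: set_borel_measurable_def)
      show "AE x in lborel. indicat_real {0<..b} x *\<^sub>R f x = indicat_real {0..b} x *\<^sub>R f x"
        using AE_lborel_singleton[of 0] by eventually_elim (auto split: split_indicator)
    qed
    also have "\<dots> = integral {0..b} f"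
      by (intro set_borel_integral_eq_integral(2) borel_integrable_atLeastAtMost' c)
    finally show ?case .
  qed
  ultimately show ?thesis
    by (rule Lim_transform_eventually)
qed

lemma integral_Ioi_FTC:
  fixes f F :: "real \<Rightarrow> 'a::euclidean_space"
  assumes int: "set_integrable lborel {0<..} f" and cont: "continuous_on {0..} f"
    and F: "\<And>x. x \<ge> 0 \<Longrightarrow> (F has_vector_derivative f x) (at x within {0..})"
    and lim: "(F \<longlongrightarrow> L) at_top"
  shows "(LBINT v:{0<..}. f v) = L - F 0"
proof -
  have "((\<lambda>b. integral {0..b} f) \<longlongrightarrow> L - F 0) at_top"
  proof (rule Lim_transform_eventually)
    show "((\<lambda>b. F b - F 0) \<longlongrightarrow> L - F 0) at_top"
      by (intro tendsto_intros lim)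
    show "\<forall>\<^sub>F b in at_top. F b - F 0 = integral {0..b} f"
      using eventually_ge_at_top[of "0::real"]
    proof eventually_elim
      case (elim b)
      have "(f has_integral (F b - F 0)) {0..b}"
        using elim
        by (intro fundamental_theorem_of_calculus) (auto intro: has_vector_derivative_within_subset[OF F])
      then show ?case by (simp add: integral_unique)
    qed
  qed
  with tendsto_integral_Icc_at_top[OF int cont] show ?thesis
    by (intro tendsto_unique) auto
qed

lemma set_integrable_Ioi_exp_bound:
  fixes f :: "real \<Rightarrow> 'a::euclidean_space"
  assumes cont: "continuous_on {0<..} f" and b: "b > 0"
    and bound: "\<And>v. v > 0 \<Longrightarrow> norm (f v) \<le> C * exp (- (b * v))"
  shows "set_integrable lborel {0<..} f"
proof (rule set_integrable_bound)
  show "set_integrable lborel {0<..} (\<lambda>v. C * exp (- (v * b)))"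
    using b by (intro set_integrable_mult_right integrable_I0i_exp_mscale)
  show "set_borel_measurable lborel {0<..} f"
    using set_measurable_continuous_on[OF _ cont] by (simp add: set_borel_measurable_def)
  show "AE x in lborel. x \<in> {0<..} \<longrightarrow> norm (f x) \<le> norm (C * exp (- (x * b)))"
    by (auto simp: mult.commute intro!: order_trans[OF bound] abs_ge_self)
qed

text \<open>Compactness of the initial segment turns a limit at infinity into a bound on the whole
  half-line. The constants of the exponential majorants below arise in this way.\<close>

lemma bounded_if_eventually_le_at_top:
  fixes f :: "real \<Rightarrow> real"
  assumes "continuous_on {0..} f" "eventually (\<lambda>x. f x \<le> B) at_top"
  obtains C where "\<And>x. x \<ge> 0 \<Longrightarrow> f x \<le> C"
proof -
  obtain R where R: "\<And>x. x \<ge> R \<Longrightarrow> f x \<le> B"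
    using assms(2) unfolding eventually_at_top_linorder by auto
  have "compact (f ` {0..max 0 R})"
    by (intro compact_continuous_image continuous_on_subset[OF assms(1)]) auto
  then have "bdd_above (f ` {0..max 0 R})"
    by (intro bounded_imp_bdd_above compact_imp_bounded)
  then obtain C where C: "\<And>x. 0 \<le> x \<Longrightarrow> x \<le> max 0 R \<Longrightarrow> f x \<le> C"
    unfolding bdd_above_def by force
  show ?thesis
    by (rule that[of "max B C"]) (use R C in \<open>force simp: le_max_iff_disj\<close>)
qed

text \<open>With \<open>\<zeta> = cis (pi / 6) v\<close>, where \<open>\<zeta>\<^sup>3 = \<i> v\<^sup>3\<close>, this is the Bromwich integrand after the substitution
  \<open>\<mu> = \<zeta>\<^sup>3\<close>. The index \<open>a\<close> is three times the stability order. For \<open>m = 2\<close> the kernel is the density in \<open>T\<close> of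
  the stable subordinator at time \<open>x\<close>; for \<open>m = a - 1\<close> it is the density in \<open>x\<close> of its inverse at time \<open>T\<close>.\<close>

definition stable_integrand :: "nat \<Rightarrow> nat \<Rightarrow> real \<Rightarrow> real \<Rightarrow> real \<Rightarrow> complex" where
  "stable_integrand m a x T v =
     cis (pi / 6) * (cis (pi / 6) * v) ^ m * exp (T * (\<i> * v ^ 3) - x * (cis (pi / 6) * v) ^ a)"

text \<open>The two conjugate rays of the Bromwich contour add up to 2i times an imaginary part,
  which changes 1/(2 pi i) into 1/pi. The 3 comes from d\<mu> = 3 z^2 dz; accordingly z^m dz carries
  the factor \<mu>^((m-2)/3) in the Laplace transform.\<close>

definition stable_kernel :: "nat \<Rightarrow> nat \<Rightarrow> real \<Rightarrow> real \<Rightarrow> real" where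
  "stable_kernel m a x T = 3 / pi * Im (LBINT v:{0<..}. stable_integrand m a x T v)"

text \<open>On the ray arg z = pi/6 the power z^a has argument at most pi/3, so Re (z^a) is at least
  |z|^a / 2. This is the only source of decay of \<open>stable_integrand\<close>.\<close>

lemma cos_index: "a = 1 \<or> a = 2 \<Longrightarrow> cos (real a * (pi / 6)) \<ge> 1 / 2"
proof (elim disjE)
  assume "a = 1"
  have "1 \<le> sqrt (3::real)" by simp
  then show ?thesis using \<open>a = 1\<close> by (simp add: cos_30)
qed (auto simp: cos_60)

text \<open>The factor exp(T i v^3) has modulus one, so T, of either sign, drops out of the
  estimate.\<close>

lemma norm_stable_integrand:
  assumes "a = 1 \<or> a = 2" "x \<ge> 0" "v \<ge> 0"
  shows "norm (stable_integrand m a x T v) \<le> v ^ m * exp (- (x / 2 * v ^ a))"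
proof -
  have "Re ((cis (pi / 6) * v) ^ a) = v ^ a * cos (real a * (pi / 6))"
    by (simp add: power_mult_distrib Complex.DeMoivre flip: of_real_power)
  moreover have "x * (v ^ a * cos (real a * (pi / 6))) \<ge> x * (v ^ a * (1 / 2))"
    using assms cos_index[OF assms(1)] by (intro mult_left_mono) auto
  ultimately have "Re (T * (\<i> * v ^ 3) - x * (cis (pi / 6) * v) ^ a) \<le> - (x / 2 * v ^ a)"
    by (simp del: of_real_power add: of_real_power[symmetric])
  then show ?thesis
    unfolding stable_integrand_def using assms
    by (simp add: norm_mult norm_power mult_left_mono)
qed

lemma power_exp_majorant:
  fixes b :: real
  assumes "a = 1 \<or> a = (2::nat)" "b > 0"
  obtains C where "\<And>v. v \<ge> 0 \<Longrightarrow> v ^ m * exp (- (b * v ^ a)) \<le> C * exp (- (b / 2 * v))"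
proof -
  have "eventually (\<lambda>v. v ^ m * exp (- (b * v ^ a)) * exp (b / 2 * v) \<le> 1) at_top"
    using assms(1)
  proof
    assume [simp]: "a = 1"
    have "((\<lambda>v. v ^ m * exp (- (b * v ^ a)) * exp (b / 2 * v)) \<longlongrightarrow> 0) at_top"
      using \<open>b > 0\<close> by simp real_asymp
    from order_tendstoD(2)[OF this, of 1] show ?thesis by (auto elim: eventually_mono)
  next
    assume [simp]: "a = 2"
    have "((\<lambda>v. v ^ m * exp (- (b * v ^ a)) * exp (b / 2 * v)) \<longlongrightarrow> 0) at_top"
      using \<open>b > 0\<close> by simp real_asymp
    from order_tendstoD(2)[OF this, of 1] show ?thesis by (auto elim: eventually_mono)
  qed
  then obtain C where "\<And>v. v \<ge> 0 \<Longrightarrow> v ^ m * exp (- (b * v ^ a)) * exp (b / 2 * v) \<le> C"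
    by (rule bounded_if_eventually_le_at_top[rotated]) (auto intro!: continuous_intros)
  then show ?thesis
    by (intro that[of C]) (simp add: exp_minus field_simps)
qed

text \<open>The rate \<open>x0 / 4\<close> is the \<open>x0 / 2\<close> of the cosine bound, halved
  once more to absorb the power of v. Since \<open>C\<close> does not depend on x or T, the same
  majorant serves for boundedness, for dominated convergence and for exchanging integrals.\<close>

lemma stable_integrand_majorant:
  assumes "a = 1 \<or> a = 2" "x0 > 0"
  obtains C where "\<And>x T v. x \<ge> x0 \<Longrightarrow> v \<ge> 0 \<Longrightarrow>
    norm (stable_integrand m a x T v) \<le> C * exp (- (x0 / 4 * v))"
proof -
  obtain C where C: "\<And>v. v \<ge> 0 \<Longrightarrow> v ^ m * exp (- (x0 / 2 * v ^ a)) \<le> C * exp (- (x0 / 2 / 2 * v))"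
    using power_exp_majorant[of a "x0 / 2"] assms by (metis half_gt_zero_iff)
  show ?thesis
  proof (rule that[of C])
    fix x T v :: real
    assume *: "x \<ge> x0" "v \<ge> 0"
    have "norm (stable_integrand m a x T v) \<le> v ^ m * exp (- (x / 2 * v ^ a))"
      using * assms by (intro norm_stable_integrand) auto
    also have "\<dots> \<le> v ^ m * exp (- (x0 / 2 * v ^ a))"
      using * by (intro mult_left_mono) (auto intro: mult_right_mono)
    also have "\<dots> \<le> C * exp (- (x0 / 4 * v))"
      using C[of v] * by simp
    finally show "norm (stable_integrand m a x T v) \<le> C * exp (- (x0 / 4 * v))" .
  qed
qed

lemma continuous_stable_integrand [continuous_intros]: "continuous_on A (stable_integrand m a x T)"
  unfolding stable_integrand_def by (intro continuous_intros)

lemma integrable_stable_integrand: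
  assumes "a = 1 \<or> a = 2" "x > 0"
  shows "set_integrable lborel {0<..} (stable_integrand m a x T)"
proof -
  obtain C where "\<And>y T v. y \<ge> x \<Longrightarrow> v \<ge> 0 \<Longrightarrow>
    norm (stable_integrand m a y T v) \<le> C * exp (- (x / 4 * v))"
    using stable_integrand_majorant[OF assms] by metis
  then show ?thesis
    using assms by (intro set_integrable_Ioi_exp_bound[where b = "x / 4" and C = C]) 
      (auto intro!: continuous_intros)
qed

lemma stable_kernel_bound:
  assumes "a = 1 \<or> a = 2" "x0 > 0"
  obtains C where "\<And>x T. x \<ge> x0 \<Longrightarrow> \<bar>stable_kernel m a x T\<bar> \<le> C"
proof -
  obtain C where C: "\<And>x T v. x \<ge> x0 \<Longrightarrow> v \<ge> 0 \<Longrightarrow>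
    norm (stable_integrand m a x T v) \<le> C * exp (- (x0 / 4 * v))"
    using stable_integrand_majorant[OF assms] by metis
  show ?thesis
  proof (rule that[of "3 / pi * (LBINT v:{0<..}. C * exp (- (v * (x0 / 4))))"])
    fix x T assume x: "x \<ge> x0"
    have "norm (LBINT v:{0<..}. stable_integrand m a x T v)
        \<le> (LBINT v:{0<..}. norm (stable_integrand m a x T v))"
      using assms x by (intro set_integral_norm_bound integrable_stable_integrand) auto
    also have "\<dots> \<le> (LBINT v:{0<..}. C * exp (- (v * (x0 / 4))))"
      using assms C x
      by (intro set_integral_mono set_integrable_mult_right integrable_I0i_exp_mscale)
         (auto intro!: set_integrable_norm integrable_stable_integrand simp: mult.commute)
    finally have "\<bar>Im (LBINT v:{0<..}. stable_integrand m a x T v)\<bar>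
        \<le> (LBINT v:{0<..}. C * exp (- (v * (x0 / 4))))"
      using abs_Im_le_cmod order_trans by blast
    then show "\<bar>stable_kernel m a x T\<bar> \<le> 3 / pi * (LBINT v:{0<..}. C * exp (- (v * (x0 / 4))))"
      unfolding stable_kernel_def abs_mult by (intro mult_mono) auto
  qed
qed

lemma tendsto_stable_kernel:
  assumes a: "a = 1 \<or> a = 2" and "x > 0" "X \<longlonglongrightarrow> x" "Y \<longlonglongrightarrow> T"
  shows "(\<lambda>n. stable_kernel m a (X n) (Y n)) \<longlonglongrightarrow> stable_kernel m a x T"
proof -
  obtain C where C: "\<And>y T v. y \<ge> x / 2 \<Longrightarrow> v \<ge> 0 \<Longrightarrow>
    norm (stable_integrand m a y T v) \<le> C * exp (- (x / 2 / 4 * v))"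
    using stable_integrand_majorant[OF a, of "x / 2"] \<open>x > 0\<close> by (metis half_gt_zero_iff)
  \<comment> \<open>Only a tail of \<open>X\<close> stays above \<open>x / 2\<close>, where the
    majorant applies; hence the shift by \<open>N\<close>.\<close>
  have "eventually (\<lambda>n. X n > x / 2) sequentially"
    using assms by (intro order_tendstoD(1)[OF \<open>X \<longlonglongrightarrow> x\<close>]) auto
  then obtain N where N: "\<And>n. n \<ge> N \<Longrightarrow> X n > x / 2"
    unfolding eventually_sequentially by auto
  have "(\<lambda>n. LBINT v:{0<..}. stable_integrand m a (X (n + N)) (Y (n + N)) v)
     \<longlonglongrightarrow> (LBINT v:{0<..}. stable_integrand m a x T v)"
    unfolding set_lebesgue_integral_def
  proof (rule integral_dominated_convergence)
    have meas: "(\<lambda>v. indicat_real {0<..} v *\<^sub>R stable_integrand m a x T v) \<in> borel_measurable lborel" for x T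
      using set_measurable_continuous_on[OF _ continuous_stable_integrand, of "{0<..}"]
      by (simp add: set_borel_measurable_def)
    then show "(\<lambda>v. indicat_real {0<..} v *\<^sub>R stable_integrand m a x T v) \<in> borel_measurable lborel"
      "\<And>n. (\<lambda>v. indicat_real {0<..} v *\<^sub>R stable_integrand m a (X (n + N)) (Y (n + N)) v) \<in> borel_measurable lborel"
      by auto
    have "set_integrable lborel {0<..} (\<lambda>v. C * exp (- (v * (x / 2 / 4))))"
      using \<open>x > 0\<close> by (intro set_integrable_mult_right integrable_I0i_exp_mscale) auto
    then show "integrable lborel (\<lambda>v. indicat_real {0<..} v *\<^sub>R (C * exp (- (x / 2 / 4 * v))))"
      by (simp add: set_integrable_def mult.commute)
    show "AE v in lborel. (\<lambda>n. indicat_real {0<..} v *\<^sub>R stable_integrand m a (X (n + N)) (Y (n + N)) v)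
       \<longlonglongrightarrow> indicat_real {0<..} v *\<^sub>R stable_integrand m a x T v"
    proof (rule AE_I2)
      fix v
      show "(\<lambda>n. indicat_real {0<..} v *\<^sub>R stable_integrand m a (X (n + N)) (Y (n + N)) v)
       \<longlonglongrightarrow> indicat_real {0<..} v *\<^sub>R stable_integrand m a x T v"
        unfolding stable_integrand_def
        by (intro tendsto_intros LIMSEQ_ignore_initial_segment assms)
    qed
    show "AE v in lborel. norm (indicat_real {0<..} v *\<^sub>R stable_integrand m a (X (n + N)) (Y (n + N)) v)
        \<le> indicat_real {0<..} v *\<^sub>R (C * exp (- (x / 2 / 4 * v)))" for n
      using C[of "X (n + N)"] N[of "n + N"] by (intro AE_I2) (auto split: split_indicator)
  qed
  then have "(\<lambda>n. LBINT v:{0<..}. stable_integrand m a (X n) (Y n) v)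
     \<longlonglongrightarrow> (LBINT v:{0<..}. stable_integrand m a x T v)"
    by (rule LIMSEQ_offset)
  then show ?thesis
    unfolding stable_kernel_def by (intro tendsto_intros)
qed

lemma measurable_stable_kernel [measurable (raw)]:
  assumes [measurable]: "f \<in> borel_measurable N" "g \<in> borel_measurable N"
  shows "(\<lambda>z. stable_kernel m a (f z) (g z)) \<in> borel_measurable N"
  unfolding stable_kernel_def set_lebesgue_integral_def stable_integrand_def
  by measurable

text \<open>Integrate the derivative of exp(T i v^3 - x (k v)^a) over the half-line, with k =
  cis(pi/6). Because i = k^3, the cubic term contributes the integrand with m = 2 and the other term
  the one with m = a - 1.\<close>

lemma stable_kernel_by_parts:
  assumes a: "a = 1 \<or> a = 2" and "x > 0" "T > 0"
  shows "stable_kernel 2 a x T = real a * x / (3 * T) * stable_kernel (a - 1) a x T"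
proof -
  define k where "k = cis (pi / 6)"
  have k3: "k ^ 3 = \<i>"
    by (simp add: k_def Complex.DeMoivre)
  define F where "F = (\<lambda>v::real. exp (T * (\<i> * v ^ 3) - x * (k * v) ^ a))"
  have F': "(F has_vector_derivative
      (3 * T * stable_integrand 2 a x T v - x * a * stable_integrand (a - 1) a x T v)) (at v within A)" for v A
  proof -
    have "((\<lambda>z. exp (T * (\<i> * z ^ 3) - x * (k * z) ^ a)) has_field_derivative
       (exp (T * (\<i> * v ^ 3) - x * (k * v) ^ a) * (T * (\<i> * (3 * v ^ 2)) - x * (a * (k * v) ^ (a - 1) * k)))) (at (of_real v))"
      by (auto intro!: derivative_eq_intros)
    from has_vector_derivative_real_field[OF this] show ?thesis
      unfolding F_def stable_integrand_def k_def[symmetric]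
      by (simp add: algebra_simps power_mult_distrib k3[symmetric] power3_eq_cube power2_eq_square)
  qed
  have "(LBINT v:{0<..}. 3 * T * stable_integrand 2 a x T v - x * a * stable_integrand (a - 1) a x T v) = 0 - F 0"
  proof (rule integral_Ioi_FTC)
    obtain C where C: "\<And>y T v. y \<ge> x \<Longrightarrow> v \<ge> 0 \<Longrightarrow>
        norm (stable_integrand 0 a y T v) \<le> C * exp (- (x / 4 * v))"
      using stable_integrand_majorant[OF a \<open>x > 0\<close>] by metis
    show "(F \<longlongrightarrow> 0) at_top"
    proof (rule Lim_null_comparison)
      show "eventually (\<lambda>v. norm (F v) \<le> C * exp (- (x / 4 * v))) at_top"
        using eventually_ge_at_top[of "0::real"]
      proof eventually_elim
        case (elim v)
        then show ?case
          using C[of x v T] by (simp add: F_def stable_integrand_def k_def norm_mult)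
      qed
      show "((\<lambda>v. C * exp (- (x / 4 * v))) \<longlongrightarrow> 0) at_top"
        using \<open>x > 0\<close> by real_asymp
    qed
    show "set_integrable lborel {0<..}
        (\<lambda>v. 3 * T * stable_integrand 2 a x T v - x * a * stable_integrand (a - 1) a x T v)"
      by (intro set_integral_diff set_integrable_mult_right integrable_stable_integrand assms)
  qed (intro F' continuous_intros)+
  moreover have "F 0 = 1"
    using a by (auto simp: F_def)
  moreover have "(LBINT v:{0<..}. 3 * T * stable_integrand 2 a x T v - x * a * stable_integrand (a - 1) a x T v)
      = 3 * T * (LBINT v:{0<..}. stable_integrand 2 a x T v) - x * a * (LBINT v:{0<..}. stable_integrand (a - 1) a x T v)"
    using integrable_stable_integrand[OF a \<open>x > 0\<close>, of 2 T] integrable_stable_integrand[OF a \<open>x > 0\<close>, of "a - 1" T]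
    by simp
  ultimately have "of_real (3 * T) * (LBINT v:{0<..}. stable_integrand 2 a x T v)
     - of_real (x * a) * (LBINT v:{0<..}. stable_integrand (a - 1) a x T v) = - 1"
    by simp
  \<comment> \<open>The boundary term at v = 0 is the real number -1, so it vanishes in the
    imaginary part.\<close>
  from arg_cong[OF this, of Im] have "3 * T * Im (LBINT v:{0<..}. stable_integrand 2 a x T v)
     = x * a * Im (LBINT v:{0<..}. stable_integrand (a - 1) a x T v)"
    by (simp del: of_real_mult)
  then show ?thesis
    using \<open>T > 0\<close> by (simp add: stable_kernel_def field_simps)
qed

subsection \<open>Laplace transform of the kernels\<close>

lemma set_Fubini:
  fixes F :: "real \<Rightarrow> real \<Rightarrow> 'a::{banach, second_countable_topology}"
  assumes meas [measurable]: "(\<lambda>p. F (fst p) (snd p)) \<in> borel_measurable (lborel \<Otimes>\<^sub>M lborel)"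
    and S [measurable]: "S \<in> sets borel" and V [measurable]: "V \<in> sets borel"
    and int1: "\<And>v. v \<in> V \<Longrightarrow> set_integrable lborel S (\<lambda>s. F s v)"
    and int2: "set_integrable lborel V (\<lambda>v. LBINT s:S. norm (F s v))"
  shows "set_integrable lborel S (\<lambda>s. LBINT v:V. F s v)"
    and "(LBINT s:S. LBINT v:V. F s v) = (LBINT v:V. LBINT s:S. F s v)"
proof -
  define G where "G = (\<lambda>v s. indicat_real S s *\<^sub>R indicat_real V v *\<^sub>R F s v)"
  have eq: "(\<lambda>s. indicat_real S s *\<^sub>R (LBINT v:V. F s v)) = (\<lambda>s. LBINT v. G v s)"
    "(\<lambda>v. indicat_real V v *\<^sub>R (LBINT s:S. F s v)) = (\<lambda>v. LBINT s. G v s)"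
    "(\<lambda>v. indicat_real V v *\<^sub>R (LBINT s:S. norm (F s v))) = (\<lambda>v. LBINT s. norm (G v s))"
    unfolding G_def set_lebesgue_integral_def
    by (auto simp: fun_eq_iff split: split_indicator)
  have [measurable]: "(\<lambda>p. F (snd p) (fst p)) \<in> borel_measurable (lborel \<Otimes>\<^sub>M lborel)"
    using measurable_compose[OF measurable_pair_swap' meas] by (simp add: case_prod_unfold)
  have int: "integrable (lborel \<Otimes>\<^sub>M lborel) (\<lambda>p. G (fst p) (snd p))"
  proof (rule lborel_pair.Fubini_integrable)
    show "(\<lambda>p. G (fst p) (snd p)) \<in> borel_measurable (lborel \<Otimes>\<^sub>M lborel)"
      unfolding G_def by measurable
    show "integrable lborel (\<lambda>v. LBINT s. norm (G (fst (v, s)) (snd (v, s))))"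
      using int2 unfolding set_integrable_def eq by simp
    show "AE v in lborel. integrable lborel (\<lambda>s. G (fst (v, s)) (snd (v, s)))"
      using int1 unfolding set_integrable_def G_def by (auto split: split_indicator)
  qed
  have int': "integrable (lborel \<Otimes>\<^sub>M lborel) (\<lambda>p. G (snd p) (fst p))"
    using lborel_pair.integrable_product_swap[OF int] by (simp add: case_prod_unfold)
  show "set_integrable lborel S (\<lambda>s. LBINT v:V. F s v)"
    using lborel_pair.integrable_fst'[OF int'] unfolding set_integrable_def eq by simp
  have "(LBINT s:S. LBINT v:V. F s v) = (LBINT s. LBINT v. G v s)"
    unfolding eq(1)[symmetric] by (simp only: set_lebesgue_integral_def)
  also have "\<dots> = (LBINT v. LBINT s. G v s)"
    using int by (intro lborel_pair.Fubini_integral) (simp add: case_prod_unfold)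
  also have "\<dots> = (LBINT v:V. LBINT s:S. F s v)"
    unfolding eq(2)[symmetric] by (simp only: set_lebesgue_integral_def)
  finally show "(LBINT s:S. LBINT v:V. F s v) = (LBINT v:V. LBINT s:S. F s v)" .
qed

lemma set_Fubini_product_bound:
  fixes F :: "real \<Rightarrow> real \<Rightarrow> 'a::{banach, second_countable_topology}"
  assumes meas [measurable]: "(\<lambda>p. F (fst p) (snd p)) \<in> borel_measurable (lborel \<Otimes>\<^sub>M lborel)"
    and S [measurable]: "S \<in> sets borel" and V [measurable]: "V \<in> sets borel"
    and A: "set_integrable lborel S A" and B: "set_integrable lborel V B"
    and bound: "\<And>s v. s \<in> S \<Longrightarrow> v \<in> V \<Longrightarrow> norm (F s v) \<le> A s * (B v :: real)"
  shows "set_integrable lborel S (\<lambda>s. LBINT v:V. F s v)"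
    and "(LBINT s:S. LBINT v:V. F s v) = (LBINT v:V. LBINT s:S. F s v)"
proof -
  have [measurable]: "(\<lambda>s. F s v) \<in> borel_measurable lborel" for v
    using measurable_compose[OF measurable_Pair2' meas, of v] by simp
  have swap [measurable]: "(\<lambda>p. F (snd p) (fst p)) \<in> borel_measurable (lborel \<Otimes>\<^sub>M lborel)"
    using measurable_compose[OF measurable_pair_swap' meas] by (simp add: case_prod_unfold)
  have int1: "set_integrable lborel S (\<lambda>s. F s v)" if "v \<in> V" for v
  proof (rule set_integrable_bound[OF set_integrable_mult_left[OF A, of "B v"]])
    show "set_borel_measurable lborel S (\<lambda>s. F s v)"
      unfolding set_borel_measurable_def by measurable
    show "AE s in lborel. s \<in> S \<longrightarrow> norm (F s v) \<le> norm (A s * B v)"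
      using bound that by (intro AE_I2) (auto intro: order_trans[OF bound])
  qed
  have int2: "set_integrable lborel V (\<lambda>v. LBINT s:S. norm (F s v))"
  proof (rule set_integrable_bound[OF set_integrable_mult_right[OF B, of "LBINT s:S. A s"]])
    have "(\<lambda>v. LBINT s. indicat_real S s *\<^sub>R norm (F s v)) \<in> borel_measurable lborel"
      using swap by measurable
    then show "set_borel_measurable lborel V (\<lambda>v. LBINT s:S. norm (F s v))"
      unfolding set_borel_measurable_def set_lebesgue_integral_def by measurable
    show "AE v in lborel. v \<in> V \<longrightarrow> norm (LBINT s:S. norm (F s v)) \<le> norm ((LBINT s:S. A s) * B v)"
    proof (intro AE_I2 impI)
      fix v assume v: "v \<in> V"
      have "(LBINT s:S. norm (F s v)) \<le> (LBINT s:S. A s * B v)"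
        using v int1 by (intro set_integral_mono set_integrable_norm set_integrable_mult_left A bound) auto
      moreover have "0 \<le> (LBINT s:S. norm (F s v))"
        unfolding set_lebesgue_integral_def by (intro integral_nonneg_AE) auto
      ultimately show "norm (LBINT s:S. norm (F s v)) \<le> norm ((LBINT s:S. A s) * B v)"
        by simp
    qed
  qed
  note set_Fubini[OF meas S V int1 int2]
  then show "set_integrable lborel S (\<lambda>s. LBINT v:V. F s v)"
    "(LBINT s:S. LBINT v:V. F s v) = (LBINT v:V. LBINT s:S. F s v)"
    by auto
qed

lemma cis_pi_six_cube: "cis (pi / 6) ^ 3 = \<i>"
  by (simp add: Complex.DeMoivre)

lemma norm_diff_imaginary_ge: "r \<le> norm (complex_of_real r - \<i> * complex_of_real v ^ 3)"
  using complex_Re_le_cmod[of "complex_of_real r - \<i> * complex_of_real v ^ 3"] by (simp flip: of_real_power)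

text \<open>With z = k v, k = cis(pi/6), the integrand becomes -z^m exp(-x z^a) / (z^3 - z0^3) dz on
  the ray arg z = pi/6. The conjugate ray carries the conjugate integral, so the two together see 2i
  times the imaginary part. Closed by a vertical segment they enclose the simple pole z0, whose
  residue is z0^m exp(-x z0^a) / (3 z0^2).\<close>

lemma pole_sector_integral:
  assumes a: "a = 1 \<or> a = 2" and "x > 0" and z0: "z0 > (0::real)"
  shows "Im (LBINT v:{0<..}. stable_integrand m a x 0 v / (of_real (z0 ^ 3) - \<i> * of_real (v ^ 3)))
    = pi * (z0 ^ m * exp (- (x * z0 ^ a)) / (3 * z0 ^ 2))"
proof -
  define k where "k = cis (pi / 6)"
  define h where "h = (\<lambda>v::real. stable_integrand m a x 0 v / (of_real (z0 ^ 3) - \<i> * of_real (v ^ 3)))"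
  have den: "z0 ^ 3 \<le> norm (complex_of_real z0 ^ 3 - \<i> * complex_of_real v ^ 3)" for v
    using norm_diff_imaginary_ge[of "z0 ^ 3" v] by simp
  then have den0: "complex_of_real z0 ^ 3 - \<i> * complex_of_real v ^ 3 \<noteq> 0" for v
    using z0 by (metis norm_zero not_le zero_less_power)
  have hcont: "continuous_on A h" for A
    unfolding h_def by (intro continuous_intros) (use den0 in auto)
  obtain C where C: "\<And>y T v. y \<ge> x \<Longrightarrow> v \<ge> 0 \<Longrightarrow>
        norm (stable_integrand m a y T v) \<le> C * exp (- (x / 4 * v))"
    using stable_integrand_majorant[OF a \<open>x > 0\<close>] by metis
  have hint: "set_integrable lborel {0<..} h"
  proof (rule set_integrable_Ioi_exp_bound[where b = "x / 4" and C = "C / z0 ^ 3"])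
    fix v :: real assume "v > 0"
    have le: "norm (stable_integrand m a x 0 v) \<le> C * exp (- (x / 4 * v))"
      using C[of x v 0] \<open>v > 0\<close> by simp
    have "norm (h v) \<le> C * exp (- (x / 4 * v)) / z0 ^ 3"
      unfolding h_def norm_divide
      using den[of v] z0 le order_trans[OF norm_ge_zero le] by (intro frac_le) auto
    then show "norm (h v) \<le> C / z0 ^ 3 * exp (- (x / 4 * v))" by simp
  qed (use hcont \<open>x > 0\<close> in auto)
  \<comment> \<open>Dividing z^3 - z0^3 by z - z0 leaves the quadratic factor kept in
    \<open>f\<close>. Its zeros have real part -z0/2, so \<open>f\<close> is holomorphic on Re z >
    -z0/2 and Cauchy's formula applies to f z / (z - z0).\<close>
  define f where "f = (\<lambda>z::complex. z ^ m * exp (- (x * z ^ a)) / (z ^ 2 + z * z0 + z0 ^ 2))"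
  define g where "g = (\<lambda>z::complex. f z / (z - z0))"
  have nz: "z ^ 2 + z * z0 + z0 ^ 2 \<noteq> 0" if "Re z > - (z0 / 2)" for z :: complex
  proof
    assume eq: "z ^ 2 + z * z0 + z0 ^ 2 = 0"
    then have "Im (z ^ 2 + z * z0 + z0 ^ 2) = 0" "Re (z ^ 2 + z * z0 + z0 ^ 2) = 0" by simp_all
    then have 1: "Im z * (2 * Re z + z0) = 0" and 2: "Re z ^ 2 - Im z ^ 2 + Re z * z0 + z0 ^ 2 = 0"
      by (simp_all add: power2_eq_square algebra_simps)
    from 1 that have "Im z = 0" by auto
    with 2 have "(Re z + z0 / 2) ^ 2 + 3 / 4 * z0 ^ 2 = 0"
      by (simp add: power2_eq_square algebra_simps)
    moreover have "z0 ^ 2 > 0" using z0 by simp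
    ultimately show False
      using zero_le_power2[of "Re z + z0 / 2"] by linarith
  qed
  have g_eq: "g z = z ^ m * exp (- (x * z ^ a)) / (z ^ 3 - z0 ^ 3)" if "Re z > - (z0 / 2)" for z :: complex
  proof -
    have "z ^ 3 - z0 ^ 3 = (z ^ 2 + z * z0 + z0 ^ 2) * (z - z0)"
      by (simp add: power3_eq_cube power2_eq_square algebra_simps)
    then show ?thesis by (simp add: g_def f_def)
  qed
  have g_ray: "g (v * k) * k = - h v" if "v \<ge> 0" for v :: real
  proof -
    define D where "D = complex_of_real (z0 ^ 3) - \<i> * of_real (v ^ 3)"
    have "Re (v * k) \<ge> 0" using that by (simp add: k_def cos_30)
    then have "g (v * k) = (v * k) ^ m * exp (- (x * (v * k) ^ a)) / ((v * k) ^ 3 - z0 ^ 3)"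
      using z0 by (intro g_eq) simp
    also have "(v * k) ^ 3 - z0 ^ 3 = - D"
      by (simp add: D_def power_mult_distrib k_def cis_pi_six_cube)
    finally show ?thesis
      unfolding h_def stable_integrand_def k_def[symmetric] D_def[symmetric] by (simp add: mult_ac)
  qed
  \<comment> \<open>The sign comes from \<open>g_ray\<close>: along the ray, g z dz equals -h v
    dv.\<close>
  define W where "W = (\<lambda>R. - integral {0..R} h)"
  have ray: "(g has_contour_integral W R) (linepath 0 (R * k))" if "R > 0" for R
  proof -
    have "h integrable_on {0..R}"
      by (intro integrable_continuous_real hcont)
    then have "(h has_integral (- W R)) {0..R}"
      unfolding W_def by (simp add: integrable_integral)
    from has_integral_stretch_real[OF this, of R] that
    have "((\<lambda>t. h (R * t)) has_integral (1 / R) *\<^sub>R (- W R)) {0..1}"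
      by simp
    from has_integral_cmul[OF this, of "- R"] that
    have "((\<lambda>t. - (R *\<^sub>R h (R * t))) has_integral W R) {0..1}"
      by (simp add: scaleR_conv_of_real)
    then show ?thesis
      unfolding has_contour_integral_linepath
    proof (rule has_integral_eq[rotated])
      fix t :: real assume t: "t \<in> {0..1}"
      have "g (linepath 0 (R * k) t) * (R * k - 0) = R * (g ((R * t) * k) * k)"
        by (simp add: linepath_def scaleR_conv_of_real mult_ac)
      also have "g ((R * t) * k) * k = - h (R * t)"
        using g_ray[of "R * t"] t that by simp
      finally show "- (R *\<^sub>R h (R * t)) = g (linepath 0 (R * k) t) * (R * k - 0)"
        by (simp add: scaleR_conv_of_real)
    qed
  qed
  \<comment> \<open>\<open>g\<close> has real coefficients and so commutes with conjugation.\<close>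
  have ray': "(g has_contour_integral cnj (W R)) (linepath 0 (R * cnj k))" if "R > 0" for R
  proof -
    have gc: "g (cnj z) = cnj (g z)" for z
      by (simp add: g_def f_def exp_cnj)
    show ?thesis
      using ray[OF that] unfolding has_contour_integral_linepath
      by (subst has_integral_cnj[symmetric]) (simp add: o_def linepath_def gc[symmetric])
  qed
  have Wlim: "(W \<longlongrightarrow> - (LBINT v:{0<..}. h v)) at_top"
    unfolding W_def by (intro tendsto_minus tendsto_integral_Icc_at_top hint hcont)
  define V where "V = (\<lambda>R::real. contour_integral (linepath (R * cnj k) (R * k)) g)"
  define S where "S = {z::complex. Re z > - (z0 / 2)}"
  have S: "convex S" "open S"
    unfolding S_def by (auto simp: convex_halfspace_Re_gt open_halfspace_Re_gt)
  have holf: "f holomorphic_on S"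
    unfolding f_def S_def by (intro holomorphic_intros) (use nz in auto)
  have Re_k: "Re k = sqrt 3 / 2" and Im_k: "Im k = 1 / 2"
    by (simp_all add: k_def cos_30 sin_30)
  have cauchy: "cnj (W R) + V R - W R = 2 * pi * \<i> * f z0" 
    and vert: "(g has_contour_integral V R) (linepath (R * cnj k) (R * k))" if R: "R > 2 * z0" for R
  proof -
    have R0: "R > 0" using R z0 by simp
    \<comment> \<open>\<open>b\<close> is the barycentric weight of z0 at each of the two outer
      corners: R k + R cnj k = sqrt 3 * R. It is below 1/2 because R > 2 * z0, so z0 is interior to
      the triangle.\<close>
    define b where "b = z0 / (sqrt 3 * R)"
    have b: "0 < b" "b * 2 < 1"
    proof -
      show "0 < b" using z0 R0 by (simp add: b_def)
      have "1 * R \<le> sqrt 3 * R" using R0 by (intro mult_right_mono) auto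
      with R have "2 * z0 < sqrt 3 * R" by linarith
      with R0 show "b * 2 < 1" by (simp add: b_def divide_less_eq mult.commute)
    qed
    have int: "complex_of_real z0 \<in> interior (convex hull {0, R * cnj k, R * k})"
    proof -
      have "k / cnj k = cis (pi / 3)"
        unfolding k_def by (simp add: cis_cnj cis_divide)
      moreover have "cis (pi / 3) \<notin> \<real>"
        by (simp add: complex_is_Real_iff sin_60)
      ultimately have "\<not> collinear {0, R * cnj k, R * k}"
        using R0 by (simp add: collinear_iff_Reals)
      then have "interior (convex hull {0, R * cnj k, R * k}) = {v. \<exists>x y z. 0 < x \<and> 0 < y \<and> 0 < z \<and>
          x + y + z = 1 \<and> x *\<^sub>R 0 + y *\<^sub>R (R * cnj k) + z *\<^sub>R (R * k) = v}"
        by (rule interior_convex_hull_3_minimal) simp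
      moreover have "(1 - 2 * b) *\<^sub>R 0 + b *\<^sub>R (R * cnj k) + b *\<^sub>R (R * k) = z0"
        using R0 by (simp add: complex_eq_iff Re_k Im_k b_def)
      moreover have "0 < 1 - 2 * b" "(1 - 2 * b) + b + b = 1"
        using b by simp_all
      ultimately show ?thesis
        using b by blast
    qed
    have wn: "winding_number (linepath 0 (R * cnj k) +++ linepath (R * cnj k) (R * k) +++ linepath (R * k) 0) z0 = 1"
      unfolding winding_number_triangle[OF int] using R0 z0 by (simp add: Re_k Im_k algebra_simps)
    have hull: "convex hull {0, R * cnj k, R * k} \<subseteq> S"
    proof (rule hull_minimal)
      have "R * sqrt 3 > 0" using R0 by simp
      then show "{0, R * cnj k, R * k} \<subseteq> S"
        using z0 by (simp add: S_def Re_k)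
    qed (rule S)
    have "{0, R * cnj k, R * k} \<subseteq> S"
      by (rule order_trans[OF hull_subset hull])
    then have segs: "closed_segment 0 (R * cnj k) \<subseteq> S" "closed_segment (R * cnj k) (R * k) \<subseteq> S"
      "closed_segment (R * k) 0 \<subseteq> S"
      using \<open>convex S\<close> by (simp_all add: closed_segment_subset)
    have path: "path_image (linepath 0 (R * cnj k) +++ linepath (R * cnj k) (R * k) +++ linepath (R * k) 0) \<subseteq> S - {of_real z0}"
    proof -
      have "of_real z0 \<notin> closed_segment 0 (R * cnj k) \<union> closed_segment (R * cnj k) (R * k) \<union> closed_segment (R * k) 0"
        using int unfolding interior_of_triangle[OF DIM_complex] by (simp only: Diff_iff not_False_eq_True)
      moreover have "closed_segment 0 (R * cnj k) \<union> closed_segment (R * cnj k) (R * k) \<union> closed_segment (R * k) 0 \<subseteq> S"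
        by (intro Un_least segs)
      moreover have "path_image (linepath 0 (R * cnj k) +++ linepath (R * cnj k) (R * k) +++ linepath (R * k) 0)
          = closed_segment 0 (R * cnj k) \<union> closed_segment (R * cnj k) (R * k) \<union> closed_segment (R * k) 0"
        by (simp only: path_image_join pathstart_join pathfinish_linepath pathstart_linepath path_image_linepath Un_assoc)
      ultimately show ?thesis
        by (simp only: subset_Diff_insert Diff_empty) simp
    qed
    let ?\<gamma> = "linepath 0 (R * cnj k) +++ linepath (R * cnj k) (R * k) +++ linepath (R * k) 0"
    have "((\<lambda>w. f w / (w - z0)) has_contour_integral (2 * pi * \<i> * winding_number ?\<gamma> z0 * f z0)) ?\<gamma>"
      by (intro Cauchy_integral_formula_convex_simple[OF \<open>convex S\<close> holf] path)
         (use S z0 in \<open>auto simp: interior_open S_def\<close>)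
    then have tri: "(g has_contour_integral (2 * pi * \<i> * f z0))
       (linepath 0 (R * cnj k) +++ linepath (R * cnj k) (R * k) +++ linepath (R * k) 0)"
      unfolding wn by (simp add: g_def)
    show vert: "(g has_contour_integral V R) (linepath (R * cnj k) (R * k))"
      using has_contour_integral_integrable[OF tri] unfolding V_def
      by (intro has_contour_integral_integral) (auto simp: contour_integrable_join)
    have "(g has_contour_integral (cnj (W R) + (V R + - W R)))
       (linepath 0 (R * cnj k) +++ linepath (R * cnj k) (R * k) +++ linepath (R * k) 0)"
      by (intro has_contour_integral_join vert ray' R0) 
         (use has_contour_integral_reversepath[OF _ ray[OF R0]] in auto)
    from has_contour_integral_unique[OF this tri] show "cnj (W R) + V R - W R = 2 * pi * \<i> * f z0"
      by (simp add: algebra_simps)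
  qed
  have Vlim: "(V \<longlongrightarrow> 0) at_top"
  proof (rule Lim_null_comparison)
    \<comment> \<open>On the segment R/2 <= Re z and |z| <= R, and Re (z^a) >= R^a / 2: for a = 2
      this is 3/4 - 1/4 = 1/2. The threshold 2 * z0 + 2 forces |z| >= z0 + 1, hence |z^3 - z0^3| >=
      1. The last factor R is the length of the segment.\<close>
    show "eventually (\<lambda>R. norm (V R) \<le> R ^ m * exp (- (x / 2 * R ^ a)) * R) at_top"
      using eventually_gt_at_top[of "2 * z0 + 2"]
    proof eventually_elim
      case (elim R)
      have R0: "R > 0" using elim z0 by simp
      have "norm (V R) \<le> R ^ m * exp (- (x / 2 * R ^ a)) * norm (R * k - R * cnj k)"
      proof (rule has_contour_integral_bound_linepath[OF vert])
        fix z assume "z \<in> closed_segment (R * cnj k) (R * k)"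
        then obtain u where u: "0 \<le> u" "u \<le> 1" and z: "z = (1 - u) *\<^sub>R (R * cnj k) + u *\<^sub>R (R * k)"
          by (auto simp: in_segment)
        have Rez: "Re z = R * (sqrt 3 / 2)" 
          unfolding z by (simp add: Re_k algebra_simps)
        have "Im z = R * (u - 1 / 2)"
          unfolding z by (simp add: Im_k algebra_simps)
        moreover have "\<bar>R * (u - 1 / 2)\<bar> \<le> R * (1 / 2)"
          using u R0 unfolding abs_mult by (intro mult_mono) (auto simp: abs_if)
        ultimately have Imz: "\<bar>Im z\<bar> \<le> R / 2" by simp
        then have "Im z ^ 2 \<le> (R / 2) ^ 2"
          by (simp add: abs_le_square_iff[symmetric])
        then have Im2: "Im z ^ 2 \<le> R ^ 2 / 4" by (simp add: power_divide)
        have Re2: "Re z ^ 2 = 3 / 4 * R ^ 2" by (simp add: Rez power_mult_distrib power_divide)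
        have norm_le: "norm z \<le> R"
          unfolding cmod_def using Im2 Re2 R0 by (intro real_le_lsqrt) auto
        have "1 \<le> sqrt (3::real)" by simp
        then have Re_ge: "Re z \<ge> R / 2"
          unfolding Rez using R0 by (simp add: mult_left_mono)
        have "Re (z ^ a) \<ge> R ^ a / 2"
          using a Re_ge Re2 Im2 by (auto simp: Re_power2)
        then have e: "norm (exp (- (x * z ^ a))) \<le> exp (- (x / 2 * R ^ a))"
          using \<open>x > 0\<close> mult_left_mono[of "R ^ a / 2" "Re (z ^ a)" x] by simp
        have "z0 + 1 \<le> norm z"
          using Re_ge elim complex_Re_le_cmod[of z] by linarith
        then have "(z0 + 1) ^ 3 \<le> norm z ^ 3"
          using z0 by (intro power_mono) auto
        moreover have "(z0 + 1) ^ 3 = z0 ^ 3 + 3 * z0 ^ 2 + 3 * z0 + 1"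
          by (simp add: power3_eq_cube power2_eq_square algebra_simps)
        ultimately have "1 \<le> norm z ^ 3 - z0 ^ 3"
          using z0 zero_le_power2[of z0] by linarith
        then have "1 \<le> norm (z ^ 3) - norm (complex_of_real z0 ^ 3)"
          using z0 by (simp add: norm_power)
        then have d: "1 \<le> norm (z ^ 3 - z0 ^ 3)"
          using norm_triangle_ineq2[of "z ^ 3" "complex_of_real z0 ^ 3"] by simp
        have "g z = z ^ m * exp (- (x * z ^ a)) / (z ^ 3 - z0 ^ 3)"
          using Re_ge R0 z0 by (intro g_eq) linarith
        then have "norm (g z) = norm z ^ m * norm (exp (- (x * z ^ a))) / norm (z ^ 3 - z0 ^ 3)"
          by (simp add: norm_divide norm_mult norm_power)
        also have "\<dots> \<le> R ^ m * exp (- (x / 2 * R ^ a)) / 1"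
          using d e norm_le R0 by (intro frac_le mult_mono power_mono) auto
        finally show "norm (g z) \<le> R ^ m * exp (- (x / 2 * R ^ a))" by simp
      qed (use elim R0 in auto)
      also have "R * k - R * cnj k = \<i> * R"
        by (simp add: complex_eq_iff Re_k Im_k)
      finally show ?case using R0 by (simp add: norm_mult)
    qed
    show "((\<lambda>R. R ^ m * exp (- (x / 2 * R ^ a)) * R) \<longlongrightarrow> 0) at_top"
      using a
    proof
      assume "a = 1" then show ?thesis using \<open>x > 0\<close> by simp real_asymp
    next
      assume "a = 2" then show ?thesis using \<open>x > 0\<close> by simp real_asymp
    qed
  qed
  have "((\<lambda>R. cnj (W R) + V R - W R) \<longlongrightarrow> cnj (- (LBINT v:{0<..}. h v)) + 0 - (- (LBINT v:{0<..}. h v))) at_top"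
    by (intro tendsto_intros Wlim Vlim)
  moreover have "((\<lambda>R. cnj (W R) + V R - W R) \<longlongrightarrow> 2 * pi * \<i> * f z0) at_top"
    by (rule tendsto_eventually, rule eventually_mono[OF eventually_gt_at_top[of "2 * z0"] cauchy])
  ultimately have "cnj (- (LBINT v:{0<..}. h v)) + 0 - (- (LBINT v:{0<..}. h v)) = 2 * pi * \<i> * f z0"
    by (rule tendsto_unique[rotated]) simp
  from arg_cong[OF this, of Im] have "Im (LBINT v:{0<..}. h v) = pi * Re (f z0)"
    by simp
  also have "f z0 = of_real (z0 ^ m * exp (- (x * z0 ^ a)) / (3 * z0 ^ 2))"
  proof -
    have "complex_of_real z0 ^ 2 + z0 * z0 + z0 ^ 2 = of_real (3 * z0 ^ 2)"
      by (simp add: power2_eq_square)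
    moreover have "exp (- (of_real x * of_real z0 ^ a)) = complex_of_real (exp (- (x * z0 ^ a)))"
      by (simp add: exp_of_real[symmetric])
    ultimately show ?thesis by (simp add: f_def)
  qed
  finally show ?thesis by (simp add: h_def)
qed

text \<open>After the exchange of integrals the T-integral is elementary, 1 / (\<mu> - i v^3), and
  the remaining v-integral is a residue at the cube root z0 of \<mu>. For m = 2 the prefactor is 1,
  as for a stable density; for m = a - 1 it is \<mu>^(a/3 - 1), as for the inverse process.\<close>

lemma stable_kernel_laplace:
  assumes a: "a = 1 \<or> a = 2" and "x > 0" and "\<mu> > 0"
  shows "set_integrable lborel {0<..} (\<lambda>T. exp (- (\<mu> * T)) * stable_kernel m a x T)"
    and "(LBINT T:{0<..}. exp (- (\<mu> * T)) * stable_kernel m a x T)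
      = \<mu> powr ((real m - 2) / 3) * exp (- (x * \<mu> powr (real a / 3)))"
proof -
  define F where "F = (\<lambda>T v. exp (- (\<mu> * T)) *\<^sub>R stable_integrand m a x T v)"
  obtain C where C: "\<And>y T v. y \<ge> x \<Longrightarrow> v \<ge> 0 \<Longrightarrow>
        norm (stable_integrand m a y T v) \<le> C * exp (- (x / 4 * v))"
    using stable_integrand_majorant[OF a \<open>x > 0\<close>] by metis
  have meas: "(\<lambda>p. F (fst p) (snd p)) \<in> borel_measurable (lborel \<Otimes>\<^sub>M lborel)"
    unfolding F_def stable_integrand_def by measurable
  have A: "set_integrable lborel {0<..} (\<lambda>T. exp (- (T * \<mu>)))"
    using \<open>\<mu> > 0\<close> by (rule integrable_I0i_exp_mscale)
  have B: "set_integrable lborel {0<..} (\<lambda>v. C * exp (- (v * (x / 4))))"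
    using \<open>x > 0\<close> by (intro set_integrable_mult_right integrable_I0i_exp_mscale) auto
  have bound: "norm (F T v) \<le> exp (- (T * \<mu>)) * (C * exp (- (v * (x / 4))))"
    if "T \<in> {0<..}" "v \<in> {0<..}" for T v
    unfolding F_def using C[of x v T] that by (simp add: mult.commute)
  note fub = set_Fubini_product_bound[OF meas _ _ A B bound]
  have inner: "(LBINT v:{0<..}. F T v) = exp (- (\<mu> * T)) *\<^sub>R (LBINT v:{0<..}. stable_integrand m a x T v)" for T
    unfolding F_def by simp
  have Im_int: "Im (LBINT v:S. f v) = (LBINT v:S. Im (f v))" if "set_integrable lborel S f" for f and S :: "real set"
    using that unfolding set_lebesgue_integral_def set_integrable_def by (simp flip: integral_Im)
  have K: "exp (- (\<mu> * T)) * stable_kernel m a x T = 3 / pi * Im (LBINT v:{0<..}. F T v)" for T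
    unfolding inner stable_kernel_def by simp
  have "set_integrable lborel {0<..} (\<lambda>T. LBINT v:{0<..}. F T v)"
    by (rule fub(1)) auto
  then have I: "set_integrable lborel {0<..} (\<lambda>T. Im (LBINT v:{0<..}. F T v))"
    unfolding set_integrable_def by (auto dest: integrable_Im)
  then show "set_integrable lborel {0<..} (\<lambda>T. exp (- (\<mu> * T)) * stable_kernel m a x T)"
    unfolding K by simp
  define z0 where "z0 = \<mu> powr (1 / 3)"
  have z0: "z0 > 0" "z0 ^ 3 = \<mu>" 
    using \<open>\<mu> > 0\<close> by (auto simp: z0_def powr_power)
  have "(LBINT T:{0<..}. exp (- (\<mu> * T)) * stable_kernel m a x T)
      = 3 / pi * Im (LBINT T:{0<..}. LBINT v:{0<..}. F T v)"
    unfolding K using fub(1) by (subst Im_int) auto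
  also have "(LBINT T:{0<..}. LBINT v:{0<..}. F T v) = (LBINT v:{0<..}. LBINT T:{0<..}. F T v)"
    by (rule fub(2)) auto
  also have "\<dots> = (LBINT v:{0<..}. stable_integrand m a x 0 v / (of_real (z0 ^ 3) - \<i> * of_real (v ^ 3)))"
  proof (rule set_lebesgue_integral_cong)
    have "(LBINT T:{0<..}. F T v) = stable_integrand m a x 0 v / (of_real (z0 ^ 3) - \<i> * of_real (v ^ 3))" for v
    proof -
      define w where "w = complex_of_real \<mu> - \<i> * v ^ 3"
      have "Re w = \<mu>" by (simp add: w_def flip: of_real_power)
      then have "w \<noteq> 0" using \<open>\<mu> > 0\<close> by auto
      have Fw: "F T v = stable_integrand m a x 0 v * exp (- (w * T))" for T
      proof -
        have "stable_integrand m a x T v = stable_integrand m a x 0 v * exp (T * (\<i> * v ^ 3))"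
          unfolding stable_integrand_def by (simp add: mult.assoc flip: exp_add)
        moreover have "complex_of_real (exp (- (\<mu> * T))) = exp (- (of_real \<mu> * of_real T))"
          by (simp add: exp_of_real[symmetric])
        ultimately have "F T v = stable_integrand m a x 0 v * (exp (T * (\<i> * v ^ 3)) * exp (- (of_real \<mu> * of_real T)))"
          unfolding F_def by (simp add: scaleR_conv_of_real mult_ac)
        also have "exp (T * (\<i> * v ^ 3)) * exp (- (of_real \<mu> * of_real T)) = exp (- (w * T))"
          unfolding w_def exp_add[symmetric] by (simp add: algebra_simps)
        finally show ?thesis .
      qed
      have "set_integrable lborel {0<..} (\<lambda>T. exp (- (w * complex_of_real T)))"
          by (rule set_integrable_Ioi_exp_bound[where b = \<mu> and C = 1])
             (auto intro!: continuous_intros simp: \<open>Re w = \<mu>\<close> \<open>\<mu> > 0\<close>)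
      moreover have "((\<lambda>T. - exp (- (w * of_real T)) / w) has_vector_derivative exp (- (w * complex_of_real T))) (at T within {0..})" for T
        proof -
          have "((\<lambda>z. - exp (- (w * z)) / w) has_field_derivative exp (- (w * T))) (at (of_real T))"
            using \<open>w \<noteq> 0\<close> by (auto intro!: derivative_eq_intros)
          from has_vector_derivative_real_field[OF this] show ?thesis .
        qed
      moreover have "((\<lambda>T. - exp (- (w * of_real T)) / w) \<longlongrightarrow> 0) at_top"
        proof (rule Lim_null_comparison)
          show "\<forall>\<^sub>F T in at_top. norm (- exp (- (w * of_real T)) / w) \<le> exp (- (\<mu> * T)) / norm w"
            by (intro always_eventually) (simp add: norm_divide \<open>Re w = \<mu>\<close>)
          show "((\<lambda>T. exp (- (\<mu> * T)) / norm w) \<longlongrightarrow> 0) at_top"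
            by (intro tendsto_divide_zero) (use \<open>\<mu> > 0\<close> in real_asymp)
        qed
      moreover have "continuous_on {0..} (\<lambda>T. exp (- (w * complex_of_real T)))"
        by (auto intro!: continuous_intros)
      ultimately have "(LBINT T:{0<..}. exp (- (w * complex_of_real T))) = 0 - - exp (- (w * of_real 0)) / w"
        by (intro integral_Ioi_FTC)
      then show ?thesis
        unfolding Fw by (simp add: w_def flip: z0(2))
    qed
    then show "\<forall>v. v \<in> {0<..} \<longrightarrow> (LBINT T:{0<..}. F T v) = stable_integrand m a x 0 v / (of_real (z0 ^ 3) - \<i> * of_real (v ^ 3))"
      by simp
  qed auto
  also have "Im \<dots> = pi * (z0 ^ m * exp (- (x * z0 ^ a)) / (3 * z0 ^ 2))"
    by (rule pole_sector_integral[OF a \<open>x > 0\<close> z0(1)])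
  also have "3 / pi * \<dots> = z0 ^ m / z0 ^ 2 * exp (- (x * z0 ^ a))"
    by simp
  also have "z0 ^ m / z0 ^ 2 = \<mu> powr ((real m - 2) / 3)"
    using \<open>\<mu> > 0\<close> by (simp add: z0_def powr_power flip: powr_diff) (simp add: diff_divide_distrib)
  also have "z0 ^ a = \<mu> powr (real a / 3)"
    using \<open>\<mu> > 0\<close> by (simp add: z0_def powr_power)
  finally show "(LBINT T:{0<..}. exp (- (\<mu> * T)) * stable_kernel m a x T)
      = \<mu> powr ((real m - 2) / 3) * exp (- (x * \<mu> powr (real a / 3)))" .
qed

subsection \<open>Turning the ray of integration\<close>

text \<open>The coefficients \<beta> and \<gamma> may be positive: after rotation the lower order
  terms can grow, and the cubic term alone gives convergence.\<close>

lemma cubic_exp_integrable: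
  fixes f :: "real \<Rightarrow> complex"
  assumes "m \<le> 1" "\<tau> > 0" and cont: "continuous_on {0<..} f"
    and bound: "\<And>r. r > 0 \<Longrightarrow> norm (f r) \<le> r ^ m * exp (- \<tau> * r ^ 3 + \<beta> * r ^ 2 + \<gamma> * r)"
  shows "set_integrable lborel {0<..} f"
proof -
  have "((\<lambda>r. r ^ m * exp (- \<tau> * r ^ 3 + \<beta> * r ^ 2 + \<gamma> * r) * exp r) \<longlongrightarrow> 0) at_top"
  proof (cases "m = 0")
    case True
    then show ?thesis using \<open>\<tau> > 0\<close> by simp real_asymp
  next
    case False
    then have "m = 1" using \<open>m \<le> 1\<close> by simp
    then show ?thesis using \<open>\<tau> > 0\<close> by simp real_asymp
  qed
  then have "eventually (\<lambda>r. r ^ m * exp (- \<tau> * r ^ 3 + \<beta> * r ^ 2 + \<gamma> * r) * exp r < 1) at_top"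
    by (rule order_tendstoD) simp
  then have "eventually (\<lambda>r. r ^ m * exp (- \<tau> * r ^ 3 + \<beta> * r ^ 2 + \<gamma> * r) * exp r \<le> 1) at_top"
    by (rule eventually_mono) simp
  then obtain K where K: "\<And>r. r \<ge> 0 \<Longrightarrow> r ^ m * exp (- \<tau> * r ^ 3 + \<beta> * r ^ 2 + \<gamma> * r) * exp r \<le> K"
    by (rule bounded_if_eventually_le_at_top[rotated]) (auto intro!: continuous_intros)
  show ?thesis
  proof (rule set_integrable_Ioi_exp_bound[OF cont, of 1 K])
    fix r :: real assume "r > 0"
    have "r ^ m * exp (- \<tau> * r ^ 3 + \<beta> * r ^ 2 + \<gamma> * r) * exp r * exp (- r) \<le> K * exp (- r)"
      using K[of r] \<open>r > 0\<close> by (intro mult_right_mono) auto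
    then show "norm (f r) \<le> K * exp (- (1 * r))"
      using bound[OF \<open>r > 0\<close>] by (simp add: mult.assoc flip: exp_add)
  qed simp
qed

text \<open>In the sector \<open>0 \<le> arg z \<le> pi / 6\<close> the real part of \<open>\<i> z\<^sup>3\<close> is nonpositive. There is no decay on the
  real axis itself, so instead of an arc the contour is closed by the vertical segment from \<open>R\<close> to
  \<open>R + \<i> R / sqrt 3\<close>, on which a primitive varies only by \<open>O(1 / R)\<close>.\<close>

lemma rotate_cubic_phase:
  fixes B C :: complex and \<tau> :: real
  assumes m: "m \<le> 1" and \<tau>: "\<tau> > 0" and B: "Re B \<le> 0" and C: "Re C \<le> 0"
  defines "E \<equiv> \<lambda>z::complex. z ^ m * exp (\<tau> * (\<i> * z ^ 3) + B * z ^ 2 + C * z)"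
  shows "((\<lambda>b. integral {0..b} (\<lambda>v. E (of_real v)))
      \<longlongrightarrow> (LBINT r:{0<..}. cis (pi / 6) * E (cis (pi / 6) * of_real r))) at_top" (is ?th1)
    and "set_integrable lborel {0<..} (\<lambda>r. cis (pi / 6) * E (cis (pi / 6) * of_real r))" (is ?th2)
proof -
  define k where "k = cis (pi / 6)"
  have k3: "k ^ 3 = \<i>" by (simp add: k_def Complex.DeMoivre)
  have contE: "continuous_on A (\<lambda>r. E (w * of_real r))" for A w
    unfolding E_def by (intro continuous_intros)
  have bound: "norm (k * E (k * r)) \<le> r ^ m * exp (- \<tau> * r ^ 3 + norm B * r ^ 2 + norm C * r)" if "r > 0" for r :: real
  proof -
    have "\<tau> * (\<i> * (k * r) ^ 3) = - of_real (\<tau> * r ^ 3)"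
      by (simp add: power_mult_distrib k3)
    then have "norm (k * E (k * r)) = r ^ m * exp (- (\<tau> * r ^ 3) + Re (B * (k * r) ^ 2) + Re (C * (k * r)))"
      using that unfolding E_def norm_mult norm_power norm_exp_eq_Re by (simp add: k_def)
    also have "Re (B * (k * r) ^ 2) \<le> norm B * r ^ 2"
      using complex_Re_le_cmod[of "B * (k * r) ^ 2"] by (simp add: norm_mult norm_power k_def)
    also have "Re (C * (k * r)) \<le> norm C * r"
      using complex_Re_le_cmod[of "C * (k * r)"] that by (simp add: norm_mult k_def)
    finally show ?thesis using that by (simp add: mult_left_mono)
  qed
  have int: "set_integrable lborel {0<..} (\<lambda>r. k * E (k * of_real r))"
    by (rule cubic_exp_integrable[OF m \<tau> _ bound]) (auto intro!: continuous_intros contE)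
  then show ?th2 by (simp add: k_def)
  \<comment> \<open>\<open>E\<close> is entire, so each path integral is a difference of values of
    one primitive \<open>P\<close>, and comparing the two rays means comparing \<open>P\<close> at
    their end points.\<close>
  have "E holomorphic_on UNIV" unfolding E_def by (intro holomorphic_intros)
  then obtain P where P: "\<And>z. (P has_field_derivative E z) (at z)"
    using holomorphic_convex_primitive'[of UNIV E] by auto
  have ray: "integral {0..b} (\<lambda>r. w * E (w * of_real r)) = P (w * b) - P 0" if "b \<ge> 0" for b :: real and w
  proof (rule integral_unique)
    have "((\<lambda>r. P (w * of_real r)) has_vector_derivative w * E (w * of_real r)) (at r within {0..b})" for r
    proof -
      have "((\<lambda>z. P (w * z)) has_field_derivative E (w * of_real r) * w) (at (of_real r))"
        by (rule DERIV_chain2[OF P]) (auto intro!: derivative_eq_intros)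
      from has_vector_derivative_real_field[OF this] show ?thesis by (simp add: mult.commute)
    qed
    then have "((\<lambda>r. w * E (w * of_real r)) has_integral P (w * of_real b) - P (w * of_real 0)) {0..b}"
      using that by (intro fundamental_theorem_of_calculus)
    then show "((\<lambda>r. w * E (w * of_real r)) has_integral P (w * b) - P 0) {0..b}" by simp
  qed
  define L where "L = (LBINT r:{0<..}. k * E (k * of_real r))"
  have "((\<lambda>b. integral {0..b} (\<lambda>r. k * E (k * of_real r))) \<longlongrightarrow> L) at_top"
    unfolding L_def by (intro tendsto_integral_Icc_at_top int continuous_intros contE)
  then have "((\<lambda>b. P (k * of_real b) - P 0) \<longlongrightarrow> L) at_top"
    by (rule Lim_transform_eventually) 
       (rule eventually_mono[OF eventually_ge_at_top[of "0::real"]], rule ray)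
  moreover have "filterlim (\<lambda>R::real. 2 / sqrt 3 * R) at_top at_top"
    by real_asymp
  ultimately have lim1: "((\<lambda>R. P (k * of_real (2 / sqrt 3 * R)) - P 0) \<longlongrightarrow> L) at_top"
    by (rule filterlim_compose)
  \<comment> \<open>The point of the ray arg z = pi/6 above R has modulus 2 R / sqrt 3 and height R
    / sqrt 3.\<close>
  have corner: "k * of_real (2 / sqrt 3 * R) = of_real R + \<i> * of_real (R / sqrt 3)" for R :: real
    by (simp add: complex_eq_iff k_def cos_30 sin_30)
  \<comment> \<open>\<open>K R\<close> is the decay rate in y at R + i y. The cubic term gives
    -\<tau> (3 R^2 - y^2) y <= -\<tau> R^2 y as y^2 <= R^2 / 3; the quadratic and linear terms cost
    at most 3 |B| R y and |C| y.\<close>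
  define K where "K = (\<lambda>R. \<tau> * R ^ 2 - 3 * norm B * R - norm C)"
  have vert: "norm (P (of_real R + \<i> * of_real (R / sqrt 3)) - P (of_real R)) \<le> 2 * R / K R"
    if R: "R \<ge> 1" and K: "K R > 0" for R
  proof -
    define Y where "Y = R / sqrt 3"
    have Y: "0 < Y" "Y \<le> R" "Y ^ 2 = R ^ 2 / 3"
      using R by (auto simp: Y_def power_divide divide_le_eq)
    \<comment> \<open>A real primitive of the majorant 2 R exp(-K R y) of the integrand; its total
      increase is at most 2 R / K R, which is O(1 / R).\<close>
    define \<phi> where "\<phi> = (\<lambda>y. - (2 * R / K R) * exp (- K R * y))"
    have "norm (P (of_real R + \<i> * of_real Y) - P (of_real R + \<i> * of_real 0)) \<le> \<phi> Y - \<phi> 0"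
    proof (rule differentiable_bound_general[where f' = "\<lambda>y. \<i> * E (of_real R + \<i> * of_real y)"
          and \<phi>' = "\<lambda>y. 2 * R * exp (- K R * y)"])
      have dP: "((\<lambda>y. P (of_real R + \<i> * of_real y)) has_vector_derivative \<i> * E (of_real R + \<i> * of_real y)) (at y)" for y
      proof -
        have "((\<lambda>z. P (of_real R + \<i> * z)) has_field_derivative E (of_real R + \<i> * of_real y) * \<i>) (at (of_real y))"
          by (rule DERIV_chain2[OF P]) (auto intro!: derivative_eq_intros)
        from has_vector_derivative_real_field[OF this] show ?thesis by (simp add: mult.commute)
      qed
      then show "((\<lambda>y. P (of_real R + \<i> * of_real y)) has_vector_derivative \<i> * E (of_real R + \<i> * of_real y)) (at y)" for y .
      show "continuous_on {0..Y} (\<lambda>y. P (of_real R + \<i> * of_real y))"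
        using dP by (intro continuous_at_imp_continuous_on) (auto intro: has_vector_derivative_continuous)
      show "continuous_on {0..Y} \<phi>" unfolding \<phi>_def by (intro continuous_intros)
      show "(\<phi> has_vector_derivative 2 * R * exp (- K R * y)) (at y)" for y
        unfolding \<phi>_def has_real_derivative_iff_has_vector_derivative[symmetric]
        using K by (auto intro!: derivative_eq_intros)
      fix y assume y: "0 < y" "y < Y"
      have "y ^ 2 \<le> Y ^ 2" using y by (intro power_mono) auto
      then have y2: "y ^ 2 \<le> R ^ 2 / 3" using Y by simp
      have yR: "y \<le> R" using y Y by simp
      have n: "norm (of_real R + \<i> * of_real y) ^ m \<le> 2 * R"
      proof -
        have "norm (of_real R + \<i> * of_real y) \<le> norm (of_real R :: complex) + norm (\<i> * of_real y)"
          by (rule norm_triangle_ineq)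
        also have "\<dots> \<le> 2 * R" using R y yR by (simp add: norm_mult)
        finally show ?thesis using m R by (cases m) auto
      qed
      have e1: "Re (\<tau> * (\<i> * (of_real R + \<i> * of_real y) ^ 3)) \<le> - \<tau> * R ^ 2 * y"
      proof -
        have "Re (\<tau> * (\<i> * (of_real R + \<i> * of_real y) ^ 3)) = - \<tau> * (3 * R ^ 2 - y ^ 2) * y"
          by (simp add: power3_eq_cube power2_eq_square algebra_simps)
        also have "R ^ 2 \<le> 3 * R ^ 2 - y ^ 2"
          using y2 zero_le_power2[of R] by linarith
        then have "- \<tau> * (3 * R ^ 2 - y ^ 2) * y \<le> - \<tau> * R ^ 2 * y"
          using \<tau> y by (intro mult_right_mono mult_left_mono_neg) auto
        finally show ?thesis .
      qed
      \<comment> \<open>The part R^2 of (R + i y)^2 is too large to be bounded by its norm. It is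
        disposed of by Re B <= 0, and what remains carries a factor y.\<close>
      have e2: "Re (B * (of_real R + \<i> * of_real y) ^ 2) \<le> 3 * norm B * R * y"
      proof -
        have "(of_real R + \<i> * of_real y) ^ 2 = of_real (R ^ 2) + of_real y * (2 * \<i> * of_real R - of_real y)"
          by (simp add: power2_eq_square algebra_simps)
        then have "Re (B * (of_real R + \<i> * of_real y) ^ 2)
            = Re B * R ^ 2 + Re (B * (of_real y * (2 * \<i> * of_real R - of_real y)))"
          by (simp add: distrib_left del: of_real_power)
        also have "Re B * R ^ 2 \<le> 0" using B by (simp add: mult_nonpos_nonneg)
        also have "Re (B * (of_real y * (2 * \<i> * of_real R - of_real y)))
            \<le> norm (B * (of_real y * (2 * \<i> * of_real R - of_real y)))"
          by (rule complex_Re_le_cmod)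
        also have "\<dots> = norm B * (y * norm (2 * \<i> * complex_of_real R - of_real y))"
          using y by (simp add: norm_mult)
        also have "\<dots> \<le> norm B * (y * (3 * R))"
        proof (intro mult_left_mono)
          have "norm (2 * \<i> * complex_of_real R - of_real y) \<le> norm (2 * \<i> * complex_of_real R) + norm (complex_of_real y)"
            by (rule norm_triangle_ineq4)
          also have "\<dots> \<le> 3 * R" using R y yR by (simp add: norm_mult)
          finally show "norm (2 * \<i> * complex_of_real R - of_real y) \<le> 3 * R" .
        qed (use y in auto)
        finally show ?thesis by (simp add: mult_ac)
      qed
      have e3: "Re (C * (of_real R + \<i> * of_real y)) \<le> norm C * y"
      proof -
        have "Re (C * (of_real R + \<i> * of_real y)) = Re C * R - Im C * y" by simp
        moreover have "Re C * R \<le> 0" using C R by (intro mult_nonpos_nonneg) auto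
        moreover have "- Im C * y \<le> norm C * y"
          using abs_Im_le_cmod[of C] y by (intro mult_right_mono) auto
        ultimately show ?thesis by simp
      qed
      have "norm (E (of_real R + \<i> * of_real y)) \<le> 2 * R * exp (- K R * y)"
        unfolding E_def norm_mult norm_power norm_exp_eq_Re
      proof (rule mult_mono[OF n])
        show "exp (Re (\<tau> * (\<i> * (of_real R + \<i> * of_real y) ^ 3) + B * (of_real R + \<i> * of_real y) ^ 2 
            + C * (of_real R + \<i> * of_real y))) \<le> exp (- K R * y)"
          using e1 e2 e3 unfolding K_def exp_le_cancel_iff plus_complex.sel
          by (simp add: algebra_simps)
      qed (use R in auto)
      then show "norm (\<i> * E (of_real R + \<i> * of_real y)) \<le> 2 * R * exp (- K R * y)"
        by (simp add: norm_mult)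
    qed (use Y in auto)
    also have "\<phi> Y - \<phi> 0 \<le> 2 * R / K R"
      using R K by (simp add: \<phi>_def)
    finally show ?thesis by (simp add: Y_def)
  qed
  have "((\<lambda>R. P (of_real R + \<i> * of_real (R / sqrt 3)) - P (of_real R)) \<longlongrightarrow> 0) at_top"
  proof (rule Lim_null_comparison)
    have "eventually (\<lambda>R. K R > 0) at_top"
      unfolding K_def using \<tau> by real_asymp
    then show "eventually (\<lambda>R. norm (P (of_real R + \<i> * of_real (R / sqrt 3)) - P (of_real R)) \<le> 2 * R / K R) at_top"
      using eventually_ge_at_top[of 1] by eventually_elim (rule vert)
    show "((\<lambda>R. 2 * R / K R) \<longlongrightarrow> 0) at_top"
      unfolding K_def using \<tau> by real_asymp
  qed
  from tendsto_diff[OF lim1 this]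
  have "((\<lambda>R. P (of_real R) - P 0) \<longlongrightarrow> L) at_top"
    unfolding corner by simp
  then have "((\<lambda>b. integral {0..b} (\<lambda>v. 1 * E (1 * of_real v))) \<longlongrightarrow> L) at_top"
    by (rule Lim_transform_eventually)
       (rule eventually_mono[OF eventually_ge_at_top[of "0::real"]], use ray[where w = 1] in simp)
  then show ?th1 by (simp add: L_def k_def)
qed

subsection \<open>The Airy function\<close>

lemma
  assumes "complex_set_integrable M A f"
  shows Re_set_integral: "Re (set_lebesgue_integral M A f) = (LINT x:A|M. Re (f x))"
    and Im_set_integral: "Im (set_lebesgue_integral M A f) = (LINT x:A|M. Im (f x))"
    and set_integrable_Re: "set_integrable M A (\<lambda>x. Re (f x))"
    and set_integrable_Im: "set_integrable M A (\<lambda>x. Im (f x))"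
  using assms integrable_Re[OF assms[unfolded set_integrable_def]] integrable_Im[OF assms[unfolded set_integrable_def]]
  unfolding set_lebesgue_integral_def set_integrable_def by (simp_all flip: integral_Re integral_Im)

text \<open>The contour rotation with \<tau> = 1/3 and linear coefficient i x replaces the
  conditionally convergent integral by an absolutely convergent one, for x of either sign. It also
  shows that the limit defining \<open>Airy_Ai\<close> exists, so that \<open>Lim\<close> returns
  its true value.\<close>

lemma Airy_Ai_rotated:
  shows "Airy_Ai x = 1 / pi * Re (LBINT r:{0<..}. cis (pi / 6) * exp (- of_real (r ^ 3 / 3) + \<i> * x * (cis (pi / 6) * r)))"
    and "complex_set_integrable lborel {0<..} (\<lambda>r. cis (pi / 6) * exp (- of_real (r ^ 3 / 3) + \<i> * x * (cis (pi / 6) * r)))"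
proof -
  define k where "k = cis (pi / 6)"
  have k3: "k ^ 3 = \<i>" by (simp add: k_def Complex.DeMoivre)
  note rot = rotate_cubic_phase[of 0 "1/3" 0 "\<i> * of_real x"]
  have eq: "k * ((k * of_real r) ^ 0 * exp (of_real (1 / 3) * (\<i> * (k * of_real r) ^ 3) + 0 * (k * of_real r) ^ 2 + \<i> * of_real x * (k * of_real r)))
      = k * exp (- of_real (r ^ 3 / 3) + \<i> * x * (k * r))" for r :: real
    by (simp add: power_mult_distrib k3)
  have eq2: "(complex_of_real v) ^ 0 * exp (of_real (1 / 3) * (\<i> * of_real v ^ 3) + 0 * of_real v ^ 2 + \<i> * of_real x * of_real v)
      = cis (v ^ 3 / 3 + x * v)" for v :: real
    by (simp add: cis_conv_exp algebra_simps)
  have lim: "((\<lambda>b. integral {0..b} (\<lambda>v. cis (v ^ 3 / 3 + x * v)))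
     \<longlongrightarrow> (LBINT r:{0<..}. k * exp (- of_real (r ^ 3 / 3) + \<i> * x * (k * r)))) at_top"
    using rot(1) unfolding eq2 k_def[symmetric] eq by simp
  show "complex_set_integrable lborel {0<..} (\<lambda>r. cis (pi / 6) * exp (- of_real (r ^ 3 / 3) + \<i> * x * (cis (pi / 6) * r)))"
    using rot(2) unfolding k_def[symmetric] eq by simp
  have "integral {0..b} (\<lambda>u. cos (u ^ 3 / 3 + x * u)) = Re (integral {0..b} (\<lambda>v. cis (v ^ 3 / 3 + x * v)))" for b
  proof -
    have "(\<lambda>v. cis (v ^ 3 / 3 + x * v)) integrable_on {0..b}"
      by (intro integrable_continuous_real) (auto intro!: continuous_intros)
    from has_integral_Re[OF integrable_integral[OF this]] show ?thesis
      by (auto dest: integral_unique)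
  qed
  then have "((\<lambda>b. integral {0..b} (\<lambda>u. cos (u ^ 3 / 3 + x * u)))
     \<longlongrightarrow> Re (LBINT r:{0<..}. k * exp (- of_real (r ^ 3 / 3) + \<i> * x * (k * r)))) at_top"
    using tendsto_Re[OF lim] by simp
  then show "Airy_Ai x = 1 / pi * Re (LBINT r:{0<..}. cis (pi / 6) * exp (- of_real (r ^ 3 / 3) + \<i> * x * (cis (pi / 6) * r)))"
    unfolding Airy_Ai_def k_def by (subst tendsto_Lim) auto
qed

text \<open>A second turn by pi/6 moves the ray to arg z = pi/3, where z^3 = -r^3 and exp(-\<tau>
  r^3) takes over the convergence. For a = 2 the other factor now grows, since z^2 has argument 2 pi
  / 3.\<close>

lemma stable_kernel_rotated:
  assumes a: "a = 1 \<or> a = 2" and "x > 0" "\<tau> > 0"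
  shows "stable_kernel (a - 1) a x \<tau> = 3 / pi * Im (LBINT r:{0<..}. cis (pi / 3) ^ a * 
      (of_real r ^ (a - 1) * exp (- of_real (\<tau> * r ^ 3) - x * (cis (pi / 3) * r) ^ a)))" (is ?th1)
    and "complex_set_integrable lborel {0<..} (\<lambda>r. cis (pi / 3) ^ a * 
      (of_real r ^ (a - 1) * exp (- of_real (\<tau> * r ^ 3) - x * (cis (pi / 3) * r) ^ a)))" (is ?th2)
proof -
  define k where "k = cis (pi / 6)"
  have k3: "k ^ 3 = \<i>" by (simp add: k_def Complex.DeMoivre)
  have kk: "k * k = cis (pi / 3)" by (simp add: k_def cis_mult)
  \<comment> \<open>Only one of \<open>B\<close>, \<open>C\<close> is nonzero; this way both orders
    fit the phase polynomial of \<open>rotate_cubic_phase\<close>.\<close>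
  define B where "B = (if a = 2 then - of_real x * k ^ 2 else 0)"
  define C where "C = (if a = 1 then - of_real x * k else 0)"
  have "k ^ 2 = cis (pi / 3)" by (simp add: power2_eq_square kk)
  then have BC: "Re B \<le> 0" "Re C \<le> 0"
    using \<open>x > 0\<close> unfolding B_def C_def by (auto simp: cos_60 cos_30 k_def)
  have poly: "B * z ^ 2 + C * z = - x * (k * z) ^ a" for z
    using a by (auto simp: B_def C_def power_mult_distrib)
  have "a - 1 \<le> 1" using a by auto
  note rot = rotate_cubic_phase[OF this \<open>\<tau> > 0\<close> BC]
  \<comment> \<open>One factor k^a belongs to the original ray, the other to the rotation.\<close>
  have ka: "k ^ a * k ^ a = cis (pi / 3) ^ a"
    by (simp add: power_mult_distrib[symmetric] kk)
  have ak: "k * (k * z) ^ (a - 1) = k ^ a * z ^ (a - 1)" for z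
    using a by (auto simp: power2_eq_square)
  have E: "k * ((k * of_real r) ^ (a - 1) * exp (of_real \<tau> * (\<i> * (k * of_real r) ^ 3) + B * (k * of_real r) ^ 2 + C * (k * of_real r)))
     = k ^ a * (of_real r ^ (a - 1) * exp (- of_real (\<tau> * r ^ 3) - x * (cis (pi / 3) * r) ^ a))" for r :: real
  proof -
    have "of_real \<tau> * (\<i> * (k * of_real r) ^ 3) + B * (k * of_real r) ^ 2 + C * (k * of_real r)
       = - of_real (\<tau> * r ^ 3) - x * (cis (pi / 3) * r) ^ a"
      unfolding add.assoc poly by (simp add: power_mult_distrib[of k _ 3] k3 kk[symmetric] mult.assoc)
    then show ?thesis by (simp only: ak mult.assoc[symmetric])
  qed
  have S: "stable_integrand (a - 1) a x \<tau> v = k ^ a * (of_real v ^ (a - 1) * exp (of_real \<tau> * (\<i> * of_real v ^ 3) + B * of_real v ^ 2 + C * of_real v))" for v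
  proof -
    have "of_real \<tau> * (\<i> * of_real v ^ 3) + B * of_real v ^ 2 + C * of_real v = of_real \<tau> * (\<i> * of_real v ^ 3) - x * (k * v) ^ a"
      unfolding add.assoc poly by simp
    then show ?thesis unfolding stable_integrand_def k_def[symmetric] by (simp only: ak mult.assoc[symmetric])
  qed
  have "complex_set_integrable lborel {0<..} (\<lambda>r. k ^ a * (of_real r ^ (a - 1) * exp (- of_real (\<tau> * r ^ 3) - x * (cis (pi / 3) * r) ^ a)))"
    using rot(2) unfolding k_def[symmetric] E .
  from set_integrable_mult_right[OF this, of "k ^ a"]
  show ?th2 by (simp only: ka mult.assoc[symmetric])
  have "((\<lambda>b. k ^ a * integral {0..b} (\<lambda>v. of_real v ^ (a - 1) * exp (of_real \<tau> * (\<i> * of_real v ^ 3) + B * of_real v ^ 2 + C * of_real v)))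
     \<longlongrightarrow> k ^ a * (LBINT r:{0<..}. k ^ a * (of_real r ^ (a - 1) * exp (- of_real (\<tau> * r ^ 3) - x * (cis (pi / 3) * r) ^ a)))) at_top"
    using tendsto_mult_left[OF rot(1)] unfolding k_def[symmetric] E .
  then have "((\<lambda>b. integral {0..b} (stable_integrand (a - 1) a x \<tau>))
     \<longlongrightarrow> (LBINT r:{0<..}. cis (pi / 3) ^ a * (of_real r ^ (a - 1) * exp (- of_real (\<tau> * r ^ 3) - x * (cis (pi / 3) * r) ^ a)))) at_top"
    unfolding S ka[symmetric] mult.assoc by simp
  moreover have "((\<lambda>b. integral {0..b} (stable_integrand (a - 1) a x \<tau>))
     \<longlongrightarrow> (LBINT v:{0<..}. stable_integrand (a - 1) a x \<tau> v)) at_top"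
    by (intro tendsto_integral_Icc_at_top integrable_stable_integrand a \<open>x > 0\<close> continuous_intros)
  ultimately have "(LBINT v:{0<..}. stable_integrand (a - 1) a x \<tau> v) =
     (LBINT r:{0<..}. cis (pi / 3) ^ a * (of_real r ^ (a - 1) * exp (- of_real (\<tau> * r ^ 3) - x * (cis (pi / 3) * r) ^ a)))"
    by (intro tendsto_unique) auto
  then show ?th1 unfolding stable_kernel_def by simp
qed

lemma set_integral_Ioi_scale:
  fixes f :: "real \<Rightarrow> 'a::{banach, second_countable_topology}"
  assumes "c > 0"
  shows "(LBINT r:{0<..}. f r) = c *\<^sub>R (LBINT r:{0<..}. f (c * r))"
proof -
  have "(LBINT r:{0<..}. f r) = \<bar>c\<bar> *\<^sub>R (LBINT r. indicat_real {0<..} (0 + c * r) *\<^sub>R f (0 + c * r))"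
    unfolding set_lebesgue_integral_def using assms by (intro lborel_integral_real_affine) auto
  also have "(\<lambda>r. indicat_real {0<..} (0 + c * r) *\<^sub>R f (0 + c * r)) = (\<lambda>r. indicat_real {0<..} r *\<^sub>R f (c * r))"
    using assms by (auto simp: fun_eq_iff indicator_def zero_less_mult_iff)
  finally show ?thesis using assms by (simp add: set_lebesgue_integral_def)
qed

text \<open>Take complex conjugates and use cnj (cis (pi/6)) = -i cis (pi/3). In this form the
  integral can be compared with \<open>stable_kernel_rotated\<close> directly.\<close>

lemma Airy_Ai_eq_Im_integral:
  shows "Airy_Ai y = 1 / pi * (LBINT r:{0<..}. Im (cis (pi / 3) * exp (- of_real (r ^ 3 / 3) - y * (cis (pi / 3) * r))))"
    and "set_integrable lborel {0<..} (\<lambda>r. Im (cis (pi / 3) * exp (- of_real (r ^ 3 / 3) - y * (cis (pi / 3) * r))))"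
proof -
  have eq: "Re (cis (pi / 6) * exp (- of_real (r ^ 3 / 3) + \<i> * y * (cis (pi / 6) * r)))
      = Im (cis (pi / 3) * exp (- of_real (r ^ 3 / 3) - y * (cis (pi / 3) * r)))" for r :: real
  proof -
    have "- of_real (r ^ 3 / 3) + \<i> * y * (cis (pi / 6) * r) = Complex (- (r ^ 3 / 3) - r * y / 2) (r * y * sqrt 3 / 2)"
      "- of_real (r ^ 3 / 3) - y * (cis (pi / 3) * r) = Complex (- (r ^ 3 / 3) - r * y / 2) (- (r * y * sqrt 3 / 2))"
      by (simp_all add: complex_eq_iff cos_30 sin_30 cos_60 sin_60 del: of_real_divide of_real_power)
    then show ?thesis
      by (simp only:) (simp add: Re_exp Im_exp cos_30 sin_30 cos_60 sin_60)
  qed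
  note I = Airy_Ai_rotated(2)[of y]
  show "Airy_Ai y = 1 / pi * (LBINT r:{0<..}. Im (cis (pi / 3) * exp (- of_real (r ^ 3 / 3) - y * (cis (pi / 3) * r))))"
    unfolding eq[symmetric] Airy_Ai_rotated(1)[of y] by (subst Re_set_integral[OF I]) simp
  show "set_integrable lborel {0<..} (\<lambda>r. Im (cis (pi / 3) * exp (- of_real (r ^ 3 / 3) - y * (cis (pi / 3) * r))))"
    using set_integrable_Re[OF I] unfolding eq .
qed

text \<open>The scaling r -> c r with c^3 = 3 \<tau> turns the cubic r^3 / 3 of the Airy integral
  into \<tau> r^3.\<close>

lemma stable_kernel_eq_Airy_Ai:
  assumes "x > 0" "\<tau> > 0"
  shows "stable_kernel 0 1 x \<tau> = 3 / root 3 (3 * \<tau>) * Airy_Ai (x / root 3 (3 * \<tau>))"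
proof -
  define c where "c = root 3 (3 * \<tau>)"
  have c: "c > 0" "c ^ 3 = 3 * \<tau>" using assms by (auto simp: c_def)
  let ?g = "\<lambda>r::real. Im (cis (pi / 3) * exp (- of_real (\<tau> * r ^ 3) - x * (cis (pi / 3) * r)))"
  have "Airy_Ai (x / c) = 1 / pi * (c *\<^sub>R (LBINT r:{0<..}. Im (cis (pi / 3) *
      exp (- of_real ((c * r) ^ 3 / 3) - of_real (x / c) * (cis (pi / 3) * of_real (c * r))))))"
    unfolding Airy_Ai_eq_Im_integral(1) by (subst set_integral_Ioi_scale[OF c(1)]) simp
  also have "(\<lambda>r. Im (cis (pi / 3) * exp (- of_real ((c * r) ^ 3 / 3) - of_real (x / c) * (cis (pi / 3) * of_real (c * r))))) = ?g"
  proof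
    fix r
    have "(c * r) ^ 3 / 3 = \<tau> * r ^ 3" using c by (simp add: power_mult_distrib)
    moreover have "of_real (x / c) * (cis (pi / 3) * of_real (c * r)) = x * (cis (pi / 3) * r)"
      using c by simp
    ultimately show "Im (cis (pi / 3) * exp (- of_real ((c * r) ^ 3 / 3) - of_real (x / c) * (cis (pi / 3) * of_real (c * r)))) = ?g r"
      by (simp only:)
  qed
  also have "stable_kernel 0 1 x \<tau> = 3 / pi * (LBINT r:{0<..}. ?g r)"
  proof -
    note rot = stable_kernel_rotated[OF disjI1[OF refl] assms,
        simplified power_one_right diff_self_eq_0 power_0 mult_1_left]
    show ?thesis unfolding rot(1) Im_set_integral[OF rot(2)] ..
  qed
  ultimately show ?thesis
    using c by (simp add: c_def[symmetric])
qed

lemma set_integral_Ioi_square: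
  fixes f :: "real \<Rightarrow> real"
  assumes \<beta>: "\<beta> > 0" and f: "continuous_on {0..} f" "set_integrable lborel {0<..} f"
    and int: "set_integrable lborel {0<..} (\<lambda>\<rho>. 2 * \<rho> / \<beta> * f (\<rho> ^ 2 / \<beta>))"
  shows "(LBINT r:{0<..}. f r) = (LBINT \<rho>:{0<..}. 2 * \<rho> / \<beta> * f (\<rho> ^ 2 / \<beta>))"
proof -
  have "continuous_on {0..} (\<lambda>\<rho>. 2 * \<rho> / \<beta> * f (\<rho> ^ 2 / \<beta>))"
    using \<beta> by (intro continuous_intros continuous_on_compose2[OF f(1)]) auto
  from tendsto_integral_Icc_at_top[OF int this]
  have "((\<lambda>b. integral {0..b} (\<lambda>\<rho>. 2 * \<rho> / \<beta> * f (\<rho> ^ 2 / \<beta>)))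
      \<longlongrightarrow> (LBINT \<rho>:{0<..}. 2 * \<rho> / \<beta> * f (\<rho> ^ 2 / \<beta>))) at_top" .
  moreover have "((\<lambda>b. integral {0..b} (\<lambda>\<rho>. 2 * \<rho> / \<beta> * f (\<rho> ^ 2 / \<beta>))) \<longlongrightarrow> (LBINT r:{0<..}. f r)) at_top"
  proof (rule Lim_transform_eventually)
    have "filterlim (\<lambda>b::real. b ^ 2 / \<beta>) at_top at_top"
      using \<beta> by real_asymp
    from filterlim_compose[OF tendsto_integral_Icc_at_top[OF f(2,1)] this]
    show "((\<lambda>b. integral {0..b ^ 2 / \<beta>} f) \<longlongrightarrow> (LBINT r:{0<..}. f r)) at_top" .
    show "\<forall>\<^sub>F b in at_top. integral {0..b ^ 2 / \<beta>} f = integral {0..b} (\<lambda>\<rho>. 2 * \<rho> / \<beta> * f (\<rho> ^ 2 / \<beta>))"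
      using eventually_ge_at_top[of "0::real"]
    proof eventually_elim
      case (elim b)
      have "((\<lambda>\<rho>. (2 * \<rho> / \<beta>) *\<^sub>R f (\<rho> ^ 2 / \<beta>)) has_integral (integral {0 ^ 2 / \<beta>..b ^ 2 / \<beta>} f)) {0..b}"
      proof (rule has_integral_substitution[where c = 0 and d = "b ^ 2 / \<beta>"])
        show "(\<lambda>\<rho>. \<rho> ^ 2 / \<beta>) ` {0..b} \<subseteq> {0..b ^ 2 / \<beta>}"
          using \<beta> by (auto intro!: divide_right_mono power_mono)
        show "continuous_on {0..b ^ 2 / \<beta>} f"
          using f(1) by (rule continuous_on_subset) auto
      qed (use elim \<beta> in \<open>auto intro!: derivative_eq_intros\<close>)
      from integral_unique[OF this] show ?case by simp
    qed
  qed
  ultimately show ?thesis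
    by (intro tendsto_unique) auto
qed

text \<open>The antiderivative is \<open>exp (-2A) G (\<surd>w - A/\<surd>w) + exp (2A) G (\<surd>w + A/\<surd>w)\<close> with \<open>G' y = exp (-y\<^sup>2)\<close>.\<close>

lemma integral_exp_minus_reciprocal:
  assumes A: "A > (0::real)"
  shows "set_integrable lborel {0<..} (\<lambda>w. exp (- w - A ^ 2 / w) / sqrt w)"
    and "(LBINT w:{0<..}. exp (- w - A ^ 2 / w) / sqrt w) = sqrt pi * exp (- 2 * A)"
proof -
  obtain F :: "real \<Rightarrow> real" where F: "\<And>y. (F has_real_derivative exp (- (y ^ 2))) (at y)"
    using einterval_antiderivative[of "-\<infinity>" "\<infinity>" "\<lambda>y::real. exp (- (y ^ 2))"]
    by (auto simp: has_real_derivative_iff_has_vector_derivative)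
  \<comment> \<open>Normalised to vanish at 0, the primitive of an even function is odd; the limit
    at minus infinity then follows from the one at infinity.\<close>
  define G where "G = (\<lambda>y. F y - F 0)"
  have G: "(G has_real_derivative exp (- (y ^ 2))) (at y)" for y
    unfolding G_def by (auto intro!: derivative_eq_intros F)
  have gauss: "set_integrable lborel {0<..} (\<lambda>y::real. exp (- (y ^ 2)))"
      "(LBINT y:{0<..}. exp (- (y ^ 2))) = sqrt pi / 2"
  proof -
    have "has_bochner_integral lborel (\<lambda>y::real. indicator {0<..} y *\<^sub>R exp (- (y ^ 2))) (sqrt pi / 2)"
    proof (rule has_bochner_integral_cong_AE[THEN iffD1, OF _ _ _ gaussian_moment_0])
      show "AE y in lborel. indicator {0..} y *\<^sub>R exp (- (y ^ 2)) = indicator {0<..} y *\<^sub>R exp (- ((y::real) ^ 2))"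
        using AE_lborel_singleton[of "0::real"] by eventually_elim (auto split: split_indicator)
    qed auto
    then show "set_integrable lborel {0<..} (\<lambda>y::real. exp (- (y ^ 2)))"
      "(LBINT y:{0<..}. exp (- (y ^ 2))) = sqrt pi / 2"
      unfolding set_integrable_def set_lebesgue_integral_def
      by (auto simp: has_bochner_integral_iff)
  qed
  have Gtop: "(G \<longlongrightarrow> sqrt pi / 2) at_top"
  proof (rule Lim_transform_eventually)
    show "((\<lambda>b. integral {0..b} (\<lambda>y. exp (- (y ^ 2)))) \<longlongrightarrow> sqrt pi / 2) at_top"
      unfolding gauss(2)[symmetric] by (intro tendsto_integral_Icc_at_top gauss continuous_intros)
    show "\<forall>\<^sub>F b in at_top. integral {0..b} (\<lambda>y. exp (- (y ^ 2))) = G b"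
      using eventually_ge_at_top[of "0::real"]
    proof eventually_elim
      case (elim b)
      have "((\<lambda>y. exp (- (y ^ 2))) has_integral (F b - F 0)) {0..b}"
        using elim F by (intro fundamental_theorem_of_calculus)
           (auto simp: has_real_derivative_iff_has_vector_derivative[symmetric] intro: DERIV_subset)
      then show ?case by (simp add: integral_unique G_def)
    qed
  qed
  have Gminus: "G (- y) = - G y" for y
  proof -
    have "((\<lambda>y. G y + G (- y)) has_real_derivative 0) (at y)" for y
      by (auto intro!: derivative_eq_intros G DERIV_chain2[OF G])
    from DERIV_isconst_all[OF allI[OF this], of y 0] show ?thesis by (simp add: G_def)
  qed
  have Gbot: "(G \<longlongrightarrow> - (sqrt pi / 2)) at_bot"
    using tendsto_minus[OF Gtop] by (simp add: filterlim_at_bot_mirror Gminus)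
  define \<Phi> where "\<Phi> = (\<lambda>w. exp (- 2 * A) * G (sqrt w - A / sqrt w) + exp (2 * A) * G (sqrt w + A / sqrt w))"
  have \<Phi>: "(\<Phi> has_real_derivative exp (- w - A ^ 2 / w) / sqrt w) (at w)" if w: "w > 0" for w
  proof -
    define s where "s = sqrt w"
    have s: "s > 0" "w = s ^ 2" using w by (auto simp: s_def)
    have e1: "exp (- 2 * A) * exp (- ((s - A / s) ^ 2)) = exp (- w - A ^ 2 / w)"
      using s unfolding exp_add[symmetric] by (simp add: power2_eq_square field_simps)
    have e2: "exp (2 * A) * exp (- ((s + A / s) ^ 2)) = exp (- w - A ^ 2 / w)"
      using s unfolding exp_add[symmetric] by (simp add: power2_eq_square field_simps)
    have d1: "((\<lambda>w. sqrt w - A / sqrt w) has_real_derivative (1 / (2 * s) + A / (2 * s ^ 3))) (at w)"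
      and d2: "((\<lambda>w. sqrt w + A / sqrt w) has_real_derivative (1 / (2 * s) - A / (2 * s ^ 3))) (at w)"
      using w s(1) unfolding s_def
      by (auto intro!: derivative_eq_intros simp: field_simps power3_eq_cube)
    have "(\<Phi> has_real_derivative exp (- 2 * A) * (exp (- ((s - A / s) ^ 2)) * (1 / (2 * s) + A / (2 * s ^ 3)))
       + exp (2 * A) * (exp (- ((s + A / s) ^ 2)) * (1 / (2 * s) - A / (2 * s ^ 3)))) (at w)"
      unfolding \<Phi>_def s_def
      by (intro DERIV_add DERIV_cmult DERIV_chain2[OF G] d1[unfolded s_def] d2[unfolded s_def])
    also have "exp (- 2 * A) * (exp (- ((s - A / s) ^ 2)) * (1 / (2 * s) + A / (2 * s ^ 3)))
       + exp (2 * A) * (exp (- ((s + A / s) ^ 2)) * (1 / (2 * s) - A / (2 * s ^ 3)))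
       = exp (- w - A ^ 2 / w) / s"
      unfolding mult.assoc[symmetric] e1 e2 distrib_left[symmetric] using s(1) by simp
    finally show ?thesis by (simp add: s_def)
  qed
  \<comment> \<open>At 0 the two arguments of \<open>G\<close> tend to opposite infinities, at
    infinity both tend to plus infinity. The exp(2 A) terms of the two limits cancel and sqrt pi *
    exp(-2 A) is left.\<close>
  have lim0: "(\<Phi> \<longlongrightarrow> exp (- 2 * A) * - (sqrt pi / 2) + exp (2 * A) * (sqrt pi / 2)) (at_right 0)"
    unfolding \<Phi>_def
  proof (intro tendsto_add tendsto_mult_left)
    have "filterlim (\<lambda>w. sqrt w - A / sqrt w) at_bot (at_right 0)" using A by real_asymp
    from filterlim_compose[OF Gbot this]
    show "((\<lambda>w. G (sqrt w - A / sqrt w)) \<longlongrightarrow> - (sqrt pi / 2)) (at_right 0)" .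
    have "filterlim (\<lambda>w. sqrt w + A / sqrt w) at_top (at_right 0)" using A by real_asymp
    from filterlim_compose[OF Gtop this]
    show "((\<lambda>w. G (sqrt w + A / sqrt w)) \<longlongrightarrow> sqrt pi / 2) (at_right 0)" .
  qed
  have lim1: "(\<Phi> \<longlongrightarrow> exp (- 2 * A) * (sqrt pi / 2) + exp (2 * A) * (sqrt pi / 2)) at_top"
    unfolding \<Phi>_def
  proof (intro tendsto_add tendsto_mult_left)
    have "filterlim (\<lambda>w. sqrt w - A / sqrt w) at_top at_top" by real_asymp
    from filterlim_compose[OF Gtop this]
    show "((\<lambda>w. G (sqrt w - A / sqrt w)) \<longlongrightarrow> sqrt pi / 2) at_top" .
    have "filterlim (\<lambda>w. sqrt w + A / sqrt w) at_top at_top" by real_asymp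
    from filterlim_compose[OF Gtop this]
    show "((\<lambda>w. G (sqrt w + A / sqrt w)) \<longlongrightarrow> sqrt pi / 2) at_top" .
  qed
  have "set_integrable lborel (einterval 0 \<infinity>) (\<lambda>w. exp (- w - A ^ 2 / w) / sqrt w)"
    "(LBINT w=0..\<infinity>. exp (- w - A ^ 2 / w) / sqrt w)
      = (exp (- 2 * A) * (sqrt pi / 2) + exp (2 * A) * (sqrt pi / 2))
        - (exp (- 2 * A) * - (sqrt pi / 2) + exp (2 * A) * (sqrt pi / 2))"
  proof -
    have a: "DERIV \<Phi> w :> exp (- w - A ^ 2 / w) / sqrt w" if "0 < ereal w" for w
      using \<Phi> that by (simp add: zero_ereal_def)
    have b: "isCont (\<lambda>w. exp (- w - A ^ 2 / w) / sqrt w) w" if "0 < ereal w" for w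
      using that by (auto intro!: continuous_intros simp: zero_ereal_def)
    have l0: "((\<Phi> \<circ> real_of_ereal) \<longlongrightarrow> exp (- 2 * A) * - (sqrt pi / 2) + exp (2 * A) * (sqrt pi / 2)) (at_right 0)"
      unfolding zero_ereal_def ereal_tendsto_simps by (rule lim0)
    have l1: "((\<Phi> \<circ> real_of_ereal) \<longlongrightarrow> exp (- 2 * A) * (sqrt pi / 2) + exp (2 * A) * (sqrt pi / 2)) (at_left \<infinity>)"
      unfolding ereal_tendsto_simps by (rule lim1)
    have nn: "AE w in lborel. 0 < ereal w \<longrightarrow> ereal w < \<infinity> \<longrightarrow> 0 \<le> exp (- w - A ^ 2 / w) / sqrt w"
      by (auto simp: zero_ereal_def)
    show "set_integrable lborel (einterval 0 \<infinity>) (\<lambda>w. exp (- w - A ^ 2 / w) / sqrt w)"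
      by (rule interval_integral_FTC_nonneg(1)[OF _ _ _ nn l0 l1]) (auto intro: a b)
    show "(LBINT w=0..\<infinity>. exp (- w - A ^ 2 / w) / sqrt w)
      = (exp (- 2 * A) * (sqrt pi / 2) + exp (2 * A) * (sqrt pi / 2))
        - (exp (- 2 * A) * - (sqrt pi / 2) + exp (2 * A) * (sqrt pi / 2))"
      by (rule interval_integral_FTC_nonneg(2)[OF _ _ _ nn l0 l1]) (auto intro: a b)
  qed
  moreover have "einterval 0 \<infinity> = {0<..}"
    by (auto simp: einterval_def zero_ereal_def)
  ultimately show "set_integrable lborel {0<..} (\<lambda>w. exp (- w - A ^ 2 / w) / sqrt w)"
    "(LBINT w:{0<..}. exp (- w - A ^ 2 / w) / sqrt w) = sqrt pi * exp (- 2 * A)"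
    by (simp_all add: interval_lebesgue_integral_0_infty)
qed

text \<open>For fixed w substitute r = \<rho>^2 / \<beta> in the Airy integral, where -x \<beta> is
  the Airy argument. Since \<beta>^3 = 4 w / (3 \<tau>^2), the cubic r^3 / 3 becomes A^2 / w with A
  = \<tau> \<rho>^3 / 2; this explains the constant under the root. The Jacobian contributes 1 /
  \<beta>, of order w^(-1/3), which together with w^(-1/6) makes the weight w^(-1/2). Integrating
  over w then leaves exp(-2 A) = exp(-\<tau> \<rho>^3), the factor in the rotated kernel of order
  2/3.\<close>

lemma Airy_Ai_weighted_integral:
  assumes x: "x > 0" and \<tau>: "\<tau> > 0"
  shows "set_integrable lborel {0<..} (\<lambda>w. exp (- w) * w powr (- 1 / 6) * Airy_Ai (- x * root 3 (2\<^sup>2 * w / (3 * \<tau>\<^sup>2))))"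
    and "root 3 (2\<^sup>2 / (3 * \<tau>\<^sup>2)) * (LBINT w:{0<..}. exp (- w) * w powr (- 1 / 6) * Airy_Ai (- x * root 3 (2\<^sup>2 * w / (3 * \<tau>\<^sup>2))))
      = 2 / 3 * sqrt pi * stable_kernel 1 2 x \<tau>"
proof -
  define p where "p = cis (pi / 3)"
  \<comment> \<open>The factor common to the Airy integral after substitution and to the rotated
    kernel; w does not enter it.\<close>
  define J where "J = (\<lambda>\<rho>::real. Im (p * exp (x * (p * \<rho> ^ 2))))"
  define A where "A = (\<lambda>\<rho>::real. \<rho> ^ 3 * \<tau> / 2)"
  define F where "F = (\<lambda>w \<rho>::real. exp (- w - A \<rho> ^ 2 / w) / sqrt w * (2 / pi * (\<rho> * J \<rho>)))"
  define \<kappa> where "\<kappa> = root 3 (2\<^sup>2 / (3 * \<tau>\<^sup>2))"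
  have \<kappa>: "\<kappa> > 0" "\<kappa> ^ 3 = 4 / (3 * \<tau> ^ 2)"
    using \<tau> by (auto simp: \<kappa>_def)
  have J_exp: "Im (p * exp (- of_real a + x * (p * \<rho> ^ 2))) = exp (- a) * J \<rho>" for a \<rho> :: real
  proof -
    have "exp (- of_real a + x * (p * \<rho> ^ 2)) = of_real (exp (- a)) * exp (x * (p * \<rho> ^ 2))"
      by (simp add: exp_of_real[symmetric] flip: exp_add)
    then have "p * exp (- of_real a + x * (p * \<rho> ^ 2)) = of_real (exp (- a)) * (p * exp (x * (p * \<rho> ^ 2)))"
      by simp
    moreover have "Im (of_real c * z) = c * Im z" for c z by simp
    ultimately show ?thesis unfolding J_def by (simp only:)
  qed
  have J_bound: "\<bar>J \<rho>\<bar> \<le> exp (x * \<rho> ^ 2 / 2)" for \<rho>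
  proof -
    have "\<bar>J \<rho>\<bar> \<le> norm (p * exp (x * (p * \<rho> ^ 2)))"
      unfolding J_def by (rule abs_Im_le_cmod)
    then show ?thesis by (simp add: norm_mult p_def cos_60 flip: of_real_power)
  qed
  have J_cont: "continuous_on S J" for S
    unfolding J_def by (intro continuous_intros)
  have \<open>2 = (1::nat) \<or> 2 = (2::nat)\<close> by simp
  note rot = stable_kernel_rotated[OF this x \<tau>]
  \<comment> \<open>Since p^2 = -cnj p, the number p^2 exp(-x p^2 r^2) is minus the conjugate of p
    exp(x p r^2), and both have the same imaginary part.\<close>
  have rot_eq: "Im (cis (pi / 3) ^ 2 * (of_real r ^ (2 - 1) * exp (- of_real (\<tau> * r ^ 3) - x * (cis (pi / 3) * r) ^ 2)))
     = exp (- (\<tau> * r ^ 3)) * (r * J r)" for r :: real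
  proof -
    define a b c where "a = - (\<tau> * r ^ 3) + x * r ^ 2 / 2" and "b = x * r ^ 2 * (sqrt 3 / 2)" and "c = x * r ^ 2 / 2"
    have e: "exp (- (\<tau> * r ^ 3)) * exp c = exp a"
      by (simp add: a_def c_def flip: exp_add)
    have "- of_real (\<tau> * r ^ 3) - x * (cis (pi / 3) * r) ^ 2 = Complex a (- b)"
      by (simp add: a_def b_def complex_eq_iff cos_60 sin_60 power2_eq_square algebra_simps del: of_real_power)
    moreover have "x * (p * r ^ 2) = Complex c b"
      by (simp add: b_def c_def complex_eq_iff p_def cos_60 sin_60 flip: of_real_power)
    moreover have "cis (pi / 3) ^ 2 = Complex (- 1 / 2) (sqrt 3 / 2)"
      by (simp add: complex_eq_iff power2_eq_square cos_60 sin_60)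
    ultimately show ?thesis
      unfolding J_def
      by (simp only:) (simp add: Im_exp Re_exp p_def cos_60 sin_60 algebra_simps flip: e)
  qed
  have int_J: "set_integrable lborel {0<..} (\<lambda>r. exp (- (\<tau> * r ^ 3)) * (r * J r))"
    using set_integrable_Im[OF rot(2)] unfolding rot_eq .
  have kernel: "stable_kernel 1 2 x \<tau> = 3 / pi * (LBINT r:{0<..}. exp (- (\<tau> * r ^ 3)) * (r * J r))"
    using rot(1) unfolding Im_set_integral[OF rot(2)] rot_eq by simp
  have inner: "(LBINT \<rho>:{0<..}. F w \<rho>) = \<kappa> * (exp (- w) * w powr (- 1 / 6) * Airy_Ai (- x * root 3 (2\<^sup>2 * w / (3 * \<tau>\<^sup>2))))"
    if w: "w > 0" for w
  proof -
    define \<beta> where "\<beta> = \<kappa> * root 3 w"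
    have \<beta>: "\<beta> > 0" "\<beta> ^ 3 = 4 * w / (3 * \<tau> ^ 2)"
      using w \<kappa> by (auto simp: \<beta>_def power_mult_distrib)
    have \<beta>': "root 3 (2\<^sup>2 * w / (3 * \<tau>\<^sup>2)) = \<beta>"
      unfolding \<beta>_def \<kappa>_def real_root_mult[symmetric] by simp
    let ?f = "\<lambda>r::real. Im (cis (pi / 3) * exp (- of_real (r ^ 3 / 3) - of_real (- x * \<beta>) * (cis (pi / 3) * r)))"
    have sub: "2 * \<rho> / \<beta> * ?f (\<rho> ^ 2 / \<beta>) = 2 / \<beta> * (exp (- (A \<rho> ^ 2 / w)) * (\<rho> * J \<rho>))" for \<rho>
    proof -
      have "(\<rho> ^ 2 / \<beta>) ^ 3 / 3 = A \<rho> ^ 2 / w"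
        using w \<tau> unfolding power_divide \<beta>(2) A_def by (simp add: field_simps flip: power_mult)
      moreover have "- of_real (- x * \<beta>) * (cis (pi / 3) * of_real (\<rho> ^ 2 / \<beta>)) = x * (p * \<rho> ^ 2)"
        using \<beta> by (simp add: p_def)
      ultimately have "?f (\<rho> ^ 2 / \<beta>) = exp (- (A \<rho> ^ 2 / w)) * J \<rho>"
        unfolding J_exp[symmetric] p_def[symmetric] by (simp add: p_def)
      then show ?thesis by simp
    qed
    have "set_integrable lborel {0<..} (\<lambda>\<rho>. 2 / \<beta> * (exp (- (A \<rho> ^ 2 / w)) * (\<rho> * J \<rho>)))"
    proof -
      \<comment> \<open>For fixed w the decay exp(-d \<rho>^6) beats the growth exp(x \<rho>^2 / 2)
        of \<open>J\<close>.\<close>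
      define d where "d = \<tau> ^ 2 / (4 * w)"
      have d: "d > 0" "A \<rho> ^ 2 / w = d * \<rho> ^ 6" for \<rho>
        using \<tau> w by (auto simp: d_def A_def power_mult_distrib power_divide simp flip: power_mult)
      have "((\<lambda>\<rho>. \<rho> * exp (- (d * \<rho> ^ 6)) * exp (x * \<rho> ^ 2 / 2) * exp \<rho>) \<longlongrightarrow> 0) at_top"
        using d(1) x by real_asymp
      then have "eventually (\<lambda>\<rho>. \<rho> * exp (- (d * \<rho> ^ 6)) * exp (x * \<rho> ^ 2 / 2) * exp \<rho> < 1) at_top"
        by (rule order_tendstoD) simp
      then have "eventually (\<lambda>\<rho>. \<rho> * exp (- (d * \<rho> ^ 6)) * exp (x * \<rho> ^ 2 / 2) * exp \<rho> \<le> 1) at_top"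
        by (rule eventually_mono) simp
      then obtain K where K: "\<And>\<rho>. \<rho> \<ge> 0 \<Longrightarrow> \<rho> * exp (- (d * \<rho> ^ 6)) * exp (x * \<rho> ^ 2 / 2) * exp \<rho> \<le> K"
        by (rule bounded_if_eventually_le_at_top[rotated]) (auto intro!: continuous_intros)
      have "set_integrable lborel {0<..} (\<lambda>\<rho>. exp (- (A \<rho> ^ 2 / w)) * (\<rho> * J \<rho>))"
      proof (rule set_integrable_Ioi_exp_bound[where b = 1 and C = K])
        show "continuous_on {0<..} (\<lambda>\<rho>. exp (- (A \<rho> ^ 2 / w)) * (\<rho> * J \<rho>))"
          unfolding A_def using w by (intro continuous_intros J_cont) auto
        fix \<rho> :: real assume \<rho>: "\<rho> > 0"
        have "norm (exp (- (A \<rho> ^ 2 / w)) * (\<rho> * J \<rho>)) \<le> exp (- (A \<rho> ^ 2 / w)) * (\<rho> * exp (x * \<rho> ^ 2 / 2))"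
          unfolding norm_mult using \<rho> J_bound[of \<rho>] by (intro mult_mono) auto
        also have "\<dots> = \<rho> * exp (- (d * \<rho> ^ 6)) * exp (x * \<rho> ^ 2 / 2) * exp \<rho> * exp (- \<rho>)"
          unfolding d(2) by (simp add: exp_minus field_simps)
        also have "\<dots> \<le> K * exp (- \<rho>)"
          using K[of \<rho>] \<rho> by (intro mult_right_mono) auto
        finally show "norm (exp (- (A \<rho> ^ 2 / w)) * (\<rho> * J \<rho>)) \<le> K * exp (- (1 * \<rho>))" by simp
      qed simp
      then show ?thesis by (rule set_integrable_mult_right)
    qed
    then have int: "set_integrable lborel {0<..} (\<lambda>\<rho>. 2 * \<rho> / \<beta> * ?f (\<rho> ^ 2 / \<beta>))"
      unfolding sub .
    have "continuous_on {0..} ?f" by (intro continuous_intros) auto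
    from set_integral_Ioi_square[OF \<beta>(1) this Airy_Ai_eq_Im_integral(2) int]
    have "(LBINT r:{0<..}. ?f r) = (LBINT \<rho>:{0<..}. 2 / \<beta> * (exp (- (A \<rho> ^ 2 / w)) * (\<rho> * J \<rho>)))"
      unfolding sub .
    then have Ai: "Airy_Ai (- x * \<beta>) = 1 / pi * (LBINT \<rho>:{0<..}. 2 / \<beta> * (exp (- (A \<rho> ^ 2 / w)) * (\<rho> * J \<rho>)))"
      unfolding Airy_Ai_eq_Im_integral(1) by simp
    have pw: "exp (- w) * w powr (- 1 / 6) * \<kappa> / \<beta> = exp (- w) / sqrt w"
    proof -
      have "root 3 w = w powr (1 / 3)" using w by (simp add: root_powr_inverse)
      moreover have "sqrt w = w powr (1 / 2)" using w by (simp add: powr_half_sqrt)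
      ultimately have "w powr (- 1 / 6) * sqrt w = root 3 w"
        using w by (simp flip: powr_add)
      then show ?thesis using w \<kappa> by (simp add: \<beta>_def field_simps)
    qed
    have Feq: "F w \<rho> = \<kappa> * (exp (- w) * w powr (- 1 / 6)) * (1 / pi * (2 / \<beta> * (exp (- (A \<rho> ^ 2 / w)) * (\<rho> * J \<rho>))))" for \<rho>
    proof -
      have "\<kappa> * (exp (- w) * w powr (- 1 / 6)) * (1 / pi * (2 / \<beta> * (exp (- (A \<rho> ^ 2 / w)) * (\<rho> * J \<rho>))))
          = (exp (- w) * w powr (- 1 / 6) * \<kappa> / \<beta>) * exp (- (A \<rho> ^ 2 / w)) * (2 / pi * (\<rho> * J \<rho>))"
        by (simp add: field_simps)
      also have "\<dots> = F w \<rho>"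
        unfolding pw F_def by (simp add: exp_diff exp_minus field_simps)
      finally show ?thesis ..
    qed
    show ?thesis unfolding \<beta>' Ai Feq by simp
  qed
  have meas: "(\<lambda>q. F (fst q) (snd q)) \<in> borel_measurable (lborel \<Otimes>\<^sub>M lborel)"
    unfolding F_def A_def J_def by measurable
  have Apos: "A \<rho> > 0" if "\<rho> \<in> {0<..}" for \<rho> using that \<tau> by (simp add: A_def)
  have int1: "set_integrable lborel {0<..} (\<lambda>w. F w \<rho>)" if "\<rho> \<in> {0<..}" for \<rho>
    unfolding F_def by (intro set_integrable_mult_left integral_exp_minus_reciprocal(1) Apos that)
  have outer: "(LBINT w:{0<..}. F w \<rho>) = sqrt pi * (2 / pi) * (exp (- (\<tau> * \<rho> ^ 3)) * (\<rho> * J \<rho>))" if "\<rho> \<in> {0<..}" for \<rho>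
    unfolding F_def set_integral_mult_left integral_exp_minus_reciprocal(2)[OF Apos[OF that]]
    by (simp add: A_def mult_ac)
  \<comment> \<open>The dependence on w is a positive weight, so the absolute value can be
    integrated over w exactly; the result is the absolute value of the rotated kernel's integrand,
    up to a constant.\<close>
  have int2: "set_integrable lborel {0<..} (\<lambda>\<rho>. LBINT w:{0<..}. norm (F w \<rho>))"
  proof -
    have "set_integrable lborel {0<..} (\<lambda>\<rho>. sqrt pi * (2 / pi) * \<bar>exp (- (\<tau> * \<rho> ^ 3)) * (\<rho> * J \<rho>)\<bar>)"
      by (intro set_integrable_mult_right set_integrable_abs int_J)
    moreover have "(LBINT w:{0<..}. norm (F w \<rho>)) = sqrt pi * (2 / pi) * \<bar>exp (- (\<tau> * \<rho> ^ 3)) * (\<rho> * J \<rho>)\<bar>" if "\<rho> \<in> {0<..}" for \<rho>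
    proof -
      have "(LBINT w:{0<..}. norm (F w \<rho>)) = (LBINT w:{0<..}. exp (- w - A \<rho> ^ 2 / w) / sqrt w * \<bar>2 / pi * (\<rho> * J \<rho>)\<bar>)"
        by (intro set_lebesgue_integral_cong) (auto simp: F_def abs_mult)
      then show ?thesis
        unfolding set_integral_mult_left integral_exp_minus_reciprocal(2)[OF Apos[OF that]]
        by (simp add: A_def abs_mult mult_ac)
    qed
    then have "set_integrable lborel {0<..} (\<lambda>\<rho>. LBINT w:{0<..}. norm (F w \<rho>))
        = set_integrable lborel {0<..} (\<lambda>\<rho>. sqrt pi * (2 / pi) * \<bar>exp (- (\<tau> * \<rho> ^ 3)) * (\<rho> * J \<rho>)\<bar>)"
      by (intro set_integrable_cong refl)
    ultimately show ?thesis by (simp only:)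
  qed
  note fub = set_Fubini[OF meas _ _ int1 int2]
  have "set_integrable lborel {0<..} (\<lambda>w. LBINT \<rho>:{0<..}. F w \<rho>)"
    by (rule fub(1)) auto
  moreover have "set_integrable lborel {0<..} (\<lambda>w. LBINT \<rho>:{0<..}. F w \<rho>) = set_integrable lborel {0<..}
      (\<lambda>w. \<kappa> * (exp (- w) * w powr (- 1 / 6) * Airy_Ai (- x * root 3 (2\<^sup>2 * w / (3 * \<tau>\<^sup>2)))))"
    by (intro set_integrable_cong refl inner) auto
  ultimately show "set_integrable lborel {0<..} (\<lambda>w. exp (- w) * w powr (- 1 / 6) * Airy_Ai (- x * root 3 (2\<^sup>2 * w / (3 * \<tau>\<^sup>2))))"
    using \<kappa> by simp
  have "(LBINT w:{0<..}. \<kappa> * (exp (- w) * w powr (- 1 / 6) * Airy_Ai (- x * root 3 (2\<^sup>2 * w / (3 * \<tau>\<^sup>2)))))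
      = (LBINT w:{0<..}. LBINT \<rho>:{0<..}. F w \<rho>)"
    by (intro set_lebesgue_integral_cong) (auto simp: inner)
  also have "\<dots> = (LBINT \<rho>:{0<..}. LBINT w:{0<..}. F w \<rho>)"
    by (rule fub(2)) auto
  also have "\<dots> = (LBINT \<rho>:{0<..}. sqrt pi * (2 / pi) * (exp (- (\<tau> * \<rho> ^ 3)) * (\<rho> * J \<rho>)))"
    by (intro set_lebesgue_integral_cong) (auto simp: outer)
  also have "\<dots> = 2 / 3 * sqrt pi * stable_kernel 1 2 x \<tau>"
    unfolding kernel by simp
  finally show "root 3 (2\<^sup>2 / (3 * \<tau>\<^sup>2)) * (LBINT w:{0<..}. exp (- w) * w powr (- 1 / 6) * Airy_Ai (- x * root 3 (2\<^sup>2 * w / (3 * \<tau>\<^sup>2))))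
      = 2 / 3 * sqrt pi * stable_kernel 1 2 x \<tau>"
    by (simp add: \<kappa>_def)
qed

subsection \<open>The convolution of the two kernels\<close>

lemma set_integrable_bounded_interval:
  fixes f :: "real \<Rightarrow> real"
  assumes [measurable]: "f \<in> borel_measurable borel" and "\<And>s. s \<in> {a<..<b} \<Longrightarrow> \<bar>f s\<bar> \<le> C"
  shows "set_integrable lborel {a<..<b} f"
proof (rule set_integrable_bound)
  show "set_integrable lborel {a<..<b} (\<lambda>_. C)"
    unfolding set_integrable_def by (cases "a \<le> b") (auto intro!: integrable_mult_left integrable_real_indicator)
  show "set_borel_measurable lborel {a<..<b} f"
    unfolding set_borel_measurable_def by measurable
  show "AE s in lborel. s \<in> {a<..<b} \<longrightarrow> norm (f s) \<le> norm C"
    using assms(2) by (auto intro: order_trans[OF _ abs_ge_self])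
qed

text \<open>Serves twice: for the inner integral of a convolution, and with h = 1 for the transform
  of the indicator of {s<..}, from which distribution functions are built.\<close>

lemma laplace_shift:
  fixes h :: "real \<Rightarrow> real"
  assumes h [measurable]: "h \<in> borel_measurable borel" "\<And>t. \<bar>h t\<bar> \<le> C" and "\<mu> > 0" "s \<ge> 0"
  shows "set_integrable lborel {0<..} (\<lambda>t. exp (- (\<mu> * t)) * (indicator {s<..} t * h (t - s)))" (is ?th1)
    and "(LBINT t:{0<..}. exp (- (\<mu> * t)) * (indicator {s<..} t * h (t - s)))
      = exp (- (\<mu> * s)) * (LBINT t:{0<..}. exp (- (\<mu> * t)) * h t)" (is ?th2)
proof -
  have C: "C \<ge> 0" using order_trans[OF abs_ge_zero h(2)] .
  show ?th1
  proof (rule set_integrable_bound)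
    show "set_integrable lborel {0<..} (\<lambda>t. C * exp (- (t * \<mu>)))"
      using \<open>\<mu> > 0\<close> by (intro set_integrable_mult_right integrable_I0i_exp_mscale)
    show "set_borel_measurable lborel {0<..} (\<lambda>t. exp (- (\<mu> * t)) * (indicator {s<..} t * h (t - s)))"
      unfolding set_borel_measurable_def by measurable
    show "AE t in lborel. t \<in> {0<..} \<longrightarrow> norm (exp (- (\<mu> * t)) * (indicator {s<..} t * h (t - s))) \<le> norm (C * exp (- (t * \<mu>)))"
      using h(2) C by (intro AE_I2) (auto simp: abs_mult mult.commute split: split_indicator)
  qed
  have "(LBINT t:{0<..}. exp (- (\<mu> * t)) * (indicator {s<..} t * h (t - s)))
     = \<bar>1\<bar> *\<^sub>R (LBINT t. indicat_real {0<..} (s + 1 * t) *\<^sub>R (exp (- (\<mu> * (s + 1 * t))) * (indicator {s<..} (s + 1 * t) * h ((s + 1 * t) - s))))"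
    unfolding set_lebesgue_integral_def by (rule lborel_integral_real_affine) simp
  also have "\<dots> = (LBINT t. exp (- (\<mu> * s)) * (indicat_real {0<..} t *\<^sub>R (exp (- (\<mu> * t)) * h t)))"
    using \<open>s \<ge> 0\<close>
    by (auto intro!: Bochner_Integration.integral_cong split: split_indicator simp: algebra_simps exp_add[symmetric] simp flip: exp_add)
  also have "\<dots> = exp (- (\<mu> * s)) * (LBINT t:{0<..}. exp (- (\<mu> * t)) * h t)"
    unfolding set_lebesgue_integral_def by simp
  finally show ?th2 .
qed

lemma laplace_convolution:
  fixes f h :: "real \<Rightarrow> real"
  assumes f [measurable]: "f \<in> borel_measurable borel" "\<And>t. \<bar>f t\<bar> \<le> C"
    and h [measurable]: "h \<in> borel_measurable borel" "\<And>t. \<bar>h t\<bar> \<le> D" and \<mu>: "\<mu> > 0"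
  shows "set_integrable lborel {0<..} (\<lambda>t. exp (- (\<mu> * t)) * (LBINT s:{0<..<t}. f s * h (t - s)))"
    and "(LBINT t:{0<..}. exp (- (\<mu> * t)) * (LBINT s:{0<..<t}. f s * h (t - s)))
      = (LBINT t:{0<..}. exp (- (\<mu> * t)) * f t) * (LBINT t:{0<..}. exp (- (\<mu> * t)) * h t)"
proof -
  \<comment> \<open>The indicator carries the constraint s < t, so both integrals run over fixed
    half-lines and can be exchanged.\<close>
  define F where "F = (\<lambda>t s. f s * (exp (- (\<mu> * t)) * (indicat_real {s<..} t * h (t - s))))"
  have inner: "(LBINT s:{0<..}. F t s) = exp (- (\<mu> * t)) * (LBINT s:{0<..<t}. f s * h (t - s))" for t
  proof -
    have "(LBINT s:{0<..}. F t s) = (LBINT s. exp (- (\<mu> * t)) * (indicat_real {0<..<t} s *\<^sub>R (f s * h (t - s))))"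
      unfolding set_lebesgue_integral_def F_def
      by (intro Bochner_Integration.integral_cong refl) (auto split: split_indicator)
    then show ?thesis unfolding set_lebesgue_integral_def by simp
  qed
  have meas: "(\<lambda>p. F (fst p) (snd p)) \<in> borel_measurable (lborel \<Otimes>\<^sub>M lborel)"
    unfolding F_def indicator_def greaterThan_iff by measurable
  have int1: "set_integrable lborel {0<..} (\<lambda>t. F t s)" if "s \<in> {0<..}" for s
    unfolding F_def using that by (intro set_integrable_mult_right laplace_shift[OF h \<mu>]) auto
  have outer: "(LBINT t:{0<..}. F t s) = (exp (- (\<mu> * s)) * f s) * (LBINT t:{0<..}. exp (- (\<mu> * t)) * h t)" if "s \<in> {0<..}" for s
    unfolding F_def set_integral_mult_right using that by (subst laplace_shift(2)[OF h \<mu>]) auto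
  have h': "(\<lambda>t. \<bar>h t\<bar>) \<in> borel_measurable borel" "\<And>t. \<bar>\<bar>h t\<bar>\<bar> \<le> D"
    using h(2) by auto
  have int_exp: "set_integrable lborel {0<..} (\<lambda>s. exp (- (\<mu> * s)) * g s)"
    if g: "g \<in> borel_measurable borel" "\<And>t. \<bar>g t\<bar> \<le> B" for g B
    using laplace_shift(1)[OF g \<mu>, of 0] by (rule set_integrable_cong[THEN iffD1, rotated -1]) auto
  have int2: "set_integrable lborel {0<..} (\<lambda>s. LBINT t:{0<..}. norm (F t s))"
  proof -
    have "(LBINT t:{0<..}. norm (F t s)) = (exp (- (\<mu> * s)) * \<bar>f s\<bar>) * (LBINT t:{0<..}. exp (- (\<mu> * t)) * \<bar>h t\<bar>)" if "s \<in> {0<..}" for s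
    proof -
      have "(\<lambda>t. norm (F t s)) = (\<lambda>t. \<bar>f s\<bar> * (exp (- (\<mu> * t)) * (indicat_real {s<..} t * \<bar>h (t - s)\<bar>)))"
        by (auto simp: F_def abs_mult)
      then show ?thesis
        using that by (simp add: laplace_shift(2)[OF h' \<mu>])
    qed
    then have "set_integrable lborel {0<..} (\<lambda>s. LBINT t:{0<..}. norm (F t s))
       = set_integrable lborel {0<..} (\<lambda>s. (exp (- (\<mu> * s)) * \<bar>f s\<bar>) * (LBINT t:{0<..}. exp (- (\<mu> * t)) * \<bar>h t\<bar>))"
      by (intro set_integrable_cong refl)
    moreover have "set_integrable lborel {0<..} (\<lambda>s. (exp (- (\<mu> * s)) * \<bar>f s\<bar>) * (LBINT t:{0<..}. exp (- (\<mu> * t)) * \<bar>h t\<bar>))"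
      using f(2) by (intro set_integrable_mult_left int_exp[where B = C]) auto
    ultimately show ?thesis by (simp only:)
  qed
  note fub = set_Fubini[OF meas _ _ int1 int2]
  have "set_integrable lborel {0<..} (\<lambda>t. LBINT s:{0<..}. F t s)"
    by (rule fub(1)) auto
  then show "set_integrable lborel {0<..} (\<lambda>t. exp (- (\<mu> * t)) * (LBINT s:{0<..<t}. f s * h (t - s)))"
    unfolding inner .
  have "(LBINT t:{0<..}. LBINT s:{0<..}. F t s) = (LBINT s:{0<..}. LBINT t:{0<..}. F t s)"
    by (rule fub(2)) auto
  also have "\<dots> = (LBINT s:{0<..}. (exp (- (\<mu> * s)) * f s) * (LBINT t:{0<..}. exp (- (\<mu> * t)) * h t))"
    using outer by (intro set_lebesgue_integral_cong) auto
  finally show "(LBINT t:{0<..}. exp (- (\<mu> * t)) * (LBINT s:{0<..<t}. f s * h (t - s)))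
      = (LBINT t:{0<..}. exp (- (\<mu> * t)) * f t) * (LBINT t:{0<..}. exp (- (\<mu> * t)) * h t)"
    unfolding inner by simp
qed

text \<open>The time \<open>c * x\<close> reflects self-similarity: c^3 H2(x) has the law of H2(c
  x), as (c^3 \<mu>)^(1/3) = c \<mu>^(1/3). The factor 2 lam enters cubed in
  \<open>sum_process\<close> for this reason.\<close>

definition conv_integrand :: "real \<Rightarrow> real \<Rightarrow> real \<Rightarrow> real \<Rightarrow> real" where
  "conv_integrand c x t s = stable_kernel 2 1 (c * x) s * stable_kernel 1 2 x (t - s)
     + c * (stable_kernel 0 1 (c * x) s * stable_kernel 2 2 x (t - s))"

definition conv_density :: "real \<Rightarrow> real \<Rightarrow> real \<Rightarrow> real" where
  "conv_density c x t = (LBINT s:{0<..<t}. conv_integrand c x t s)"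

lemma conv_integrand_bound:
  assumes "c > 0" "x0 > 0"
  obtains C where "C \<ge> 0" "\<And>x t s. x \<ge> x0 \<Longrightarrow> \<bar>conv_integrand c x t s\<bar> \<le> C"
proof -
  have pos: "c * x0 > 0" using assms by simp
  obtain C1 C2 C3 C4 where
    C1: "\<And>x T. x \<ge> c * x0 \<Longrightarrow> \<bar>stable_kernel 2 1 x T\<bar> \<le> C1" and
    C2: "\<And>x T. x \<ge> x0 \<Longrightarrow> \<bar>stable_kernel 1 2 x T\<bar> \<le> C2" and
    C3: "\<And>x T. x \<ge> c * x0 \<Longrightarrow> \<bar>stable_kernel 0 1 x T\<bar> \<le> C3" and
    C4: "\<And>x T. x \<ge> x0 \<Longrightarrow> \<bar>stable_kernel 2 2 x T\<bar> \<le> C4"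
    using stable_kernel_bound[OF _ pos, of 1 2] stable_kernel_bound[OF _ \<open>x0 > 0\<close>, of 2 1]
      stable_kernel_bound[OF _ pos, of 1 0] stable_kernel_bound[OF _ \<open>x0 > 0\<close>, of 2 2] by metis
  have bound: "\<bar>conv_integrand c x t s\<bar> \<le> C1 * C2 + c * (C3 * C4)" if "x \<ge> x0" for x t s
  proof -
    have cx: "c * x \<ge> c * x0" using that assms by simp
    have "\<bar>conv_integrand c x t s\<bar> \<le> \<bar>stable_kernel 2 1 (c * x) s\<bar> * \<bar>stable_kernel 1 2 x (t - s)\<bar>
       + c * (\<bar>stable_kernel 0 1 (c * x) s\<bar> * \<bar>stable_kernel 2 2 x (t - s)\<bar>)"
      unfolding conv_integrand_def using assms by (intro order_trans[OF abs_triangle_ineq]) (simp add: abs_mult)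
    also have "\<dots> \<le> C1 * C2 + c * (C3 * C4)"
      using C1[OF cx] C2[OF that] C3[OF cx] C4[OF that] assms
      by (intro add_mono mult_left_mono mult_mono) (auto intro: order_trans[OF abs_ge_zero])
    finally show ?thesis .
  qed
  show ?thesis
    by (rule that[OF _ bound]) (use bound[of x0] in \<open>auto intro: order_trans[OF abs_ge_zero]\<close>)
qed

lemma measurable_conv_integrand [measurable (raw)]:
  assumes [measurable]: "X \<in> borel_measurable N" "T \<in> borel_measurable N" "S \<in> borel_measurable N"
  shows "(\<lambda>z. conv_integrand c (X z) (T z) (S z)) \<in> borel_measurable N"
  unfolding conv_integrand_def by measurable

lemma measurable_conv_density [measurable (raw)]:
  assumes [measurable]: "X \<in> borel_measurable N" "T \<in> borel_measurable N"
  shows "(\<lambda>z. conv_density c (X z) (T z)) \<in> borel_measurable N"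
proof -
  have "conv_density c x t = (LBINT s. (if 0 < s \<and> s < t then conv_integrand c x t s else 0))" for x t
    unfolding conv_density_def set_lebesgue_integral_def
    by (intro Bochner_Integration.integral_cong) (auto split: split_indicator)
  then show ?thesis by simp
qed

lemma conv_integrand_integrable:
  assumes "c > 0" "x > 0"
  shows "set_integrable lborel {0<..<t} (conv_integrand c x t)"
proof -
  obtain C where "\<And>y t s. y \<ge> x \<Longrightarrow> \<bar>conv_integrand c y t s\<bar> \<le> C"
    using conv_integrand_bound[OF assms] by metis
  then show ?thesis by (intro set_integrable_bounded_interval) auto
qed

lemma conv_density_bound:
  assumes "c > 0" "x0 > 0"
  obtains C where "C \<ge> 0" "\<And>x t. x \<ge> x0 \<Longrightarrow> t \<ge> 0 \<Longrightarrow> \<bar>conv_density c x t\<bar> \<le> C * t"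
proof -
  obtain C where C: "C \<ge> 0" "\<And>x t s. x \<ge> x0 \<Longrightarrow> \<bar>conv_integrand c x t s\<bar> \<le> C"
    using conv_integrand_bound[OF assms] by metis
  show ?thesis
  proof (rule that[OF C(1)])
    fix x t :: real assume *: "x \<ge> x0" "t \<ge> 0"
    have "\<bar>conv_density c x t\<bar> \<le> (LBINT s:{0<..<t}. norm (conv_integrand c x t s))"
      using set_integral_norm_bound[OF conv_integrand_integrable[of c x t]] assms *
      unfolding conv_density_def by simp
    also have "\<dots> \<le> (LBINT s:{0<..<t}. C)"
      using C(2)[OF *(1)] assms *
      by (intro set_integral_mono set_integrable_norm conv_integrand_integrable
           set_integrable_bounded_interval[where C = C]) (auto simp: C(1))
    also have "\<dots> = C * t"
      using * unfolding set_lebesgue_integral_def by simp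
    finally show "\<bar>conv_density c x t\<bar> \<le> C * t" .
  qed
qed

lemma tendsto_conv_density:
  assumes c: "c > 0" and x: "x > 0" "X \<longlonglongrightarrow> x" and T: "T \<longlonglongrightarrow> t"
  shows "(\<lambda>n. conv_density c (X n) (T n)) \<longlonglongrightarrow> conv_density c x t"
proof -
  have "x / 2 > 0" using x by simp
  then obtain C where C: "C \<ge> 0" "\<And>y t s. y \<ge> x / 2 \<Longrightarrow> \<bar>conv_integrand c y t s\<bar> \<le> C"
    using conv_integrand_bound[OF c] by metis
  have "eventually (\<lambda>n. X n > x / 2 \<and> T n < t + 1) sequentially"
    using order_tendstoD(1)[OF x(2), of "x / 2"] order_tendstoD(2)[OF T, of "t + 1"] x(1)
    by (auto intro: eventually_conj)
  then obtain N where N: "\<And>n. n \<ge> N \<Longrightarrow> X n > x / 2 \<and> T n < t + 1"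
    unfolding eventually_sequentially by auto
  have "(\<lambda>n. LBINT s. indicat_real {0<..<T (n + N)} s *\<^sub>R conv_integrand c (X (n + N)) (T (n + N)) s)
     \<longlonglongrightarrow> (LBINT s. indicat_real {0<..<t} s *\<^sub>R conv_integrand c x t s)"
  proof (rule integral_dominated_convergence)
    show "integrable lborel (\<lambda>s. indicat_real {0<..<t + 1} s *\<^sub>R C)"
      using set_integrable_bounded_interval[of "\<lambda>_. C" 0 "t + 1" C] C(1) by (simp add: set_integrable_def)
    show "AE s in lborel. norm (indicat_real {0<..<T (n + N)} s *\<^sub>R conv_integrand c (X (n + N)) (T (n + N)) s)
         \<le> indicat_real {0<..<t + 1} s *\<^sub>R C" for n
      using C(2)[of "X (n + N)"] N[of "n + N"] C(1) by (intro AE_I2) (auto split: split_indicator)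
    show "AE s in lborel. (\<lambda>n. indicat_real {0<..<T (n + N)} s *\<^sub>R conv_integrand c (X (n + N)) (T (n + N)) s)
        \<longlonglongrightarrow> indicat_real {0<..<t} s *\<^sub>R conv_integrand c x t s"
      \<comment> \<open>The indicators of the moving intervals converge except possibly at the end
        point s = t, a null set.\<close>
      using AE_lborel_singleton[of t]
    proof eventually_elim
      case (elim s)
      have TN: "(\<lambda>n. T (n + N)) \<longlonglongrightarrow> t" and XN: "(\<lambda>n. X (n + N)) \<longlonglongrightarrow> x"
        using LIMSEQ_ignore_initial_segment[OF T] LIMSEQ_ignore_initial_segment[OF x(2)] by auto
      have "(\<lambda>n. conv_integrand c (X (n + N)) (T (n + N)) s) \<longlonglongrightarrow> conv_integrand c x t s"
        unfolding conv_integrand_def using c x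
        by (intro tendsto_intros tendsto_stable_kernel TN XN) auto
      moreover have "(\<lambda>n. indicat_real {0<..<T (n + N)} s) \<longlonglongrightarrow> indicat_real {0<..<t} s"
      proof (rule tendsto_eventually)
        consider "s < t" | "s > t" using elim by fastforce
        then show "\<forall>\<^sub>F n in sequentially. indicat_real {0<..<T (n + N)} s = indicat_real {0<..<t} s"
        proof cases
          case 1
          from order_tendstoD(1)[OF TN 1] show ?thesis
            by eventually_elim (use 1 in \<open>auto split: split_indicator\<close>)
        next
          case 2
          from order_tendstoD(2)[OF TN 2] show ?thesis
            by eventually_elim (use 2 in \<open>auto split: split_indicator\<close>)
        qed
      qed
      ultimately show ?case by (intro tendsto_intros)
    qed
  qed measurable
  then show ?thesis
    unfolding conv_density_def set_lebesgue_integral_def by (rule LIMSEQ_offset)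
qed

lemma laplace_conv_density:
  assumes c: "c > 0" and x: "x > 0" and \<mu>: "\<mu> > 0"
  shows "(LBINT t:{0<..}. exp (- (\<mu> * t)) * conv_density c x t)
    = (\<mu> powr (- 1 / 3) + c * \<mu> powr (- 2 / 3)) * exp (- (x * (\<mu> powr (2 / 3) + c * \<mu> powr (1 / 3))))"
proof -
  have cx: "c * x > 0" using c x by simp
  obtain C1 C2 C3 C4 where
    C: "\<And>T. \<bar>stable_kernel 2 1 (c * x) T\<bar> \<le> C1" "\<And>T. \<bar>stable_kernel 1 2 x T\<bar> \<le> C2"
      "\<And>T. \<bar>stable_kernel 0 1 (c * x) T\<bar> \<le> C3" "\<And>T. \<bar>stable_kernel 2 2 x T\<bar> \<le> C4"
    using stable_kernel_bound[OF _ cx, of 1 2] stable_kernel_bound[OF _ x, of 2 1]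
      stable_kernel_bound[OF _ cx, of 1 0] stable_kernel_bound[OF _ x, of 2 2] by (metis order_refl)
  have m: "stable_kernel m a y \<in> borel_measurable borel" for m a y by measurable
  note L1 = laplace_convolution[OF m C(1) m C(2) \<mu>]
  note L2 = laplace_convolution[OF m C(3) m C(4) \<mu>]
  have split: "conv_density c x t = (LBINT s:{0<..<t}. stable_kernel 2 1 (c * x) s * stable_kernel 1 2 x (t - s))
      + c * (LBINT s:{0<..<t}. stable_kernel 0 1 (c * x) s * stable_kernel 2 2 x (t - s))" for t
  proof -
    have b: "\<bar>stable_kernel 2 1 (c * x) s * stable_kernel 1 2 x (t - s)\<bar> \<le> C1 * C2"
      "\<bar>stable_kernel 0 1 (c * x) s * stable_kernel 2 2 x (t - s)\<bar> \<le> C3 * C4" for s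
      unfolding abs_mult by (intro mult_mono C order_trans[OF abs_ge_zero C(1)] order_trans[OF abs_ge_zero C(3)] abs_ge_zero)+
    have "set_integrable lborel {0<..<t} (\<lambda>s. stable_kernel 2 1 (c * x) s * stable_kernel 1 2 x (t - s))"
      by (rule set_integrable_bounded_interval[OF _ b(1)]) measurable
    moreover have "set_integrable lborel {0<..<t} (\<lambda>s. stable_kernel 0 1 (c * x) s * stable_kernel 2 2 x (t - s))"
      by (rule set_integrable_bounded_interval[OF _ b(2)]) measurable
    ultimately show ?thesis
      unfolding conv_density_def conv_integrand_def
      by (subst set_integral_add(2)[OF _ set_integrable_mult_right]) auto
  qed
  have "(LBINT t:{0<..}. exp (- (\<mu> * t)) * conv_density c x t)
     = (LBINT t:{0<..}. exp (- (\<mu> * t)) * (LBINT s:{0<..<t}. stable_kernel 2 1 (c * x) s * stable_kernel 1 2 x (t - s))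
        + c * (exp (- (\<mu> * t)) * (LBINT s:{0<..<t}. stable_kernel 0 1 (c * x) s * stable_kernel 2 2 x (t - s))))"
    unfolding split by (simp add: algebra_simps)
  also have "\<dots> = (LBINT t:{0<..}. exp (- (\<mu> * t)) * (LBINT s:{0<..<t}. stable_kernel 2 1 (c * x) s * stable_kernel 1 2 x (t - s)))
        + c * (LBINT t:{0<..}. exp (- (\<mu> * t)) * (LBINT s:{0<..<t}. stable_kernel 0 1 (c * x) s * stable_kernel 2 2 x (t - s)))"
    using L1(1) L2(1) by (subst set_integral_add) auto
  also have "\<dots> = exp (- (c * x * \<mu> powr (1 / 3))) * (\<mu> powr (- 1 / 3) * exp (- (x * \<mu> powr (2 / 3))))
        + c * (\<mu> powr (- 2 / 3) * exp (- (c * x * \<mu> powr (1 / 3))) * exp (- (x * \<mu> powr (2 / 3))))"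
    unfolding L1(2) L2(2) using \<mu> cx x by (simp add: stable_kernel_laplace)
  also have "\<dots> = (\<mu> powr (- 1 / 3) + c * \<mu> powr (- 2 / 3)) * exp (- (x * (\<mu> powr (2 / 3) + c * \<mu> powr (1 / 3))))"
    by (simp add: algebra_simps exp_add[symmetric] exp_diff exp_minus field_simps)
  finally show ?thesis .
qed

text \<open>Each of the two products contains one stable density; writing it as a x / (3 T) times
  the inverse density leaves the common product of two inverse densities. The coefficient is c (x /
  (3 s) + 2 x / (3 (t - s))), which is 2 c / 3 times the bracket of the formula. The 2 / 3 and the
  sqrt pi are those of \<open>Airy_Ai_weighted_integral\<close>.\<close>

lemma inverse_density_integrand:
  assumes lam: "lam > 0" and x: "x > 0" and s: "s \<in> {0<..<t}"
  shows "set_integrable lborel {0<..} (density_integrand lam t x s)"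
    and "2 * lam / sqrt pi * (LBINT w:{0<..}. density_integrand lam t x s w) = conv_integrand (2 * lam) x t s"
proof -
  define \<tau> where "\<tau> = t - s"
  have \<tau>: "\<tau> > 0" and s0: "s > 0" using s by (auto simp: \<tau>_def)
  define c where "c = 2 * lam"
  have c: "c > 0" "c * x > 0" using lam x by (auto simp: c_def)
  define q where "q = Airy_Ai (c * x / root 3 (3 * s)) * (3 / root 3 (3 * s)) * (x / (2 * s) + x / \<tau>)"
  let ?g = "\<lambda>w. exp (- w) * w powr (- 1 / 6) * Airy_Ai (- x * root 3 (2\<^sup>2 * w / (3 * \<tau>\<^sup>2)))"
  have eq: "density_integrand lam t x s = (\<lambda>w. q * (root 3 (2\<^sup>2 / (3 * \<tau>\<^sup>2)) * ?g w))"
    unfolding density_integrand_def q_def \<tau>_def c_def by (auto simp: mult_ac)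
  note Ai = Airy_Ai_weighted_integral[OF x \<tau>]
  show "set_integrable lborel {0<..} (density_integrand lam t x s)"
    unfolding eq by (intro set_integrable_mult_right Ai(1))
  have "(LBINT w:{0<..}. density_integrand lam t x s w) = q * (2 / 3 * sqrt pi * stable_kernel 1 2 x \<tau>)"
    unfolding eq set_integral_mult_right Ai(2) ..
  also have "q = stable_kernel 0 1 (c * x) s * (x / (2 * s) + x / \<tau>)"
    unfolding q_def stable_kernel_eq_Airy_Ai[OF c(2) s0] by simp
  finally have I: "(LBINT w:{0<..}. density_integrand lam t x s w)
      = stable_kernel 0 1 (c * x) s * (x / (2 * s) + x / \<tau>) * (2 / 3 * sqrt pi * stable_kernel 1 2 x \<tau>)" .
  have "2 * lam / sqrt pi * (LBINT w:{0<..}. density_integrand lam t x s w)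
      = 2 / 3 * c * stable_kernel 0 1 (c * x) s * (x / (2 * s) + x / \<tau>) * stable_kernel 1 2 x \<tau>"
    unfolding I c_def by (simp add: mult_ac)
  also have "\<dots> = conv_integrand c x t s"
  proof -
    have b1: "stable_kernel 2 1 (c * x) s = c * x / (3 * s) * stable_kernel 0 1 (c * x) s"
      using stable_kernel_by_parts[of 1, OF _ c(2) s0] by simp
    have b2: "stable_kernel 2 2 x \<tau> = 2 * x / (3 * \<tau>) * stable_kernel 1 2 x \<tau>"
      using stable_kernel_by_parts[of 2, OF _ x \<tau>] by simp
    show ?thesis
      unfolding conv_integrand_def \<tau>_def[symmetric] b1 b2 using s0 \<tau> by (simp add: field_simps)
  qed
  finally show "2 * lam / sqrt pi * (LBINT w:{0<..}. density_integrand lam t x s w) = conv_integrand (2 * lam) x t s"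
    by (simp add: c_def)
qed

lemma inverse_density_eq_conv_density:
  assumes lam: "lam > 0" and x: "x > 0"
  shows "set_integrable lborel {0<..<t} (\<lambda>s. LBINT w:{0<..}. density_integrand lam t x s w)"
    and "inverse_density lam t x = conv_density (2 * lam) x t"
proof -
  define k where "k = 2 * lam / sqrt pi"
  have k: "k \<noteq> 0" using lam by (simp add: k_def)
  note I = inverse_density_integrand(2)[OF lam x, folded k_def]
  have "set_integrable lborel {0<..<t} (\<lambda>s. k * (LBINT w:{0<..}. density_integrand lam t x s w))
    = set_integrable lborel {0<..<t} (conv_integrand (2 * lam) x t)"
    by (intro set_integrable_cong refl I)
  also have "\<dots>" using conv_integrand_integrable[of "2 * lam" x t] lam x by simp
  finally show "set_integrable lborel {0<..<t} (\<lambda>s. LBINT w:{0<..}. density_integrand lam t x s w)"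
    using k by simp
  have "inverse_density lam t x = (LBINT s:{0<..<t}. k * (LBINT w:{0<..}. density_integrand lam t x s w))"
    unfolding inverse_density_def k_def by simp
  also have "\<dots> = conv_density (2 * lam) x t"
    unfolding conv_density_def using I by (intro set_lebesgue_integral_cong) auto
  finally show "inverse_density lam t x = conv_density (2 * lam) x t" .
qed

subsection \<open>Uniqueness of Laplace transforms\<close>

text \<open>Lerch's argument: with y = exp(-t), the transforms at \<mu> = 1, 2, 3, ... are the
  moments of exp(-t) g(t) against powers of y. All vanish, and Weierstrass approximation on [0, 1]
  extends this to continuous functions of y. One factor exp(-t) is kept apart because g itself need
  not be integrable.\<close>

lemma laplace_eq_zero_imp_integral_continuous:
  fixes g :: "real \<Rightarrow> real" and \<phi> :: "real \<Rightarrow> real"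
  assumes int: "\<And>\<mu>. \<mu> > 0 \<Longrightarrow> set_integrable lborel {0<..} (\<lambda>t. exp (- (\<mu> * t)) * g t)"
    and zero: "\<And>\<mu>. \<mu> > 0 \<Longrightarrow> (LBINT t:{0<..}. exp (- (\<mu> * t)) * g t) = 0"
    and \<phi>: "continuous_on {0..1} \<phi>"
  shows "set_integrable lborel {0<..} (\<lambda>t. \<phi> (exp (- t)) * (exp (- t) * g t))"
    and "(LBINT t:{0<..}. \<phi> (exp (- t)) * (exp (- t) * g t)) = 0"
proof -
  define G where "G = (\<lambda>t. exp (- t) * g t)"
  have G: "set_integrable lborel {0<..} G"
    using int[of 1] by (simp add: G_def)
  have mono: "set_integrable lborel {0<..} (\<lambda>t. exp (- t) ^ i * G t) \<and> (LBINT t:{0<..}. exp (- t) ^ i * G t) = 0" for i :: nat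
  proof -
    have "(\<lambda>t. exp (- t) ^ i * G t) = (\<lambda>t. exp (- ((real i + 1) * t)) * g t)"
      by (auto simp: G_def algebra_simps exp_add[symmetric] simp flip: exp_of_nat_mult exp_add)
    then show ?thesis using int[of "real i + 1"] zero[of "real i + 1"] by simp
  qed
  have [measurable]: "(\<lambda>t. indicat_real {0<..} t *\<^sub>R G t) \<in> borel_measurable lborel"
    using G by (simp add: set_integrable_def)
  define B where "B = (LBINT t:{0<..}. \<bar>G t\<bar>)"
  have meas: "(\<lambda>t. indicat_real {0<..} t *\<^sub>R \<phi> (exp (- t))) \<in> borel_measurable lborel"
  proof -
    have "continuous_on {0<..} (\<lambda>t::real. \<phi> (exp (- t)))"
      by (rule continuous_on_compose2[OF \<phi>]) (auto intro!: continuous_intros)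
    from set_measurable_continuous_on[OF _ this] show ?thesis by (simp add: set_borel_measurable_def)
  qed
  have "compact (\<phi> ` {0..1})" by (intro compact_continuous_image \<phi>) auto
  then obtain K where K: "\<And>y. y \<in> {0..1} \<Longrightarrow> \<bar>\<phi> y\<bar> \<le> K"
    using compact_imp_bounded bounded_iff by (metis image_eqI real_norm_def)
  have int\<phi>: "set_integrable lborel {0<..} (\<lambda>t. \<phi> (exp (- t)) * G t)"
  proof (rule set_integrable_bound[OF set_integrable_mult_right[OF G, of K]])
    have "(\<lambda>t. (indicat_real {0<..} t *\<^sub>R \<phi> (exp (- t))) * (indicat_real {0<..} t *\<^sub>R G t)) \<in> borel_measurable lborel"
      using meas by measurable
    moreover have "(\<lambda>t. (indicat_real {0<..} t *\<^sub>R \<phi> (exp (- t))) * (indicat_real {0<..} t *\<^sub>R G t))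
       = (\<lambda>t. indicat_real {0<..} t *\<^sub>R (\<phi> (exp (- t)) * G t))"
      by (auto split: split_indicator)
    ultimately show "set_borel_measurable lborel {0<..} (\<lambda>t. \<phi> (exp (- t)) * G t)"
      by (simp add: set_borel_measurable_def)
    show "AE t in lborel. t \<in> {0<..} \<longrightarrow> norm (\<phi> (exp (- t)) * G t) \<le> norm (K * G t)"
    proof (intro AE_I2 impI)
      fix t :: real assume "t \<in> {0<..}"
      then have "\<bar>\<phi> (exp (- t))\<bar> \<le> K" by (intro K) auto
      then show "norm (\<phi> (exp (- t)) * G t) \<le> norm (K * G t)"
        by (simp add: abs_mult mult_right_mono)
    qed
  qed
  then show "set_integrable lborel {0<..} (\<lambda>t. \<phi> (exp (- t)) * (exp (- t) * g t))"
    by (simp add: G_def)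
  have approx: "\<bar>LBINT t:{0<..}. \<phi> (exp (- t)) * G t\<bar> \<le> e * B" if e: "e > 0" for e
  proof -
    obtain p where p: "real_polynomial_function p" "\<And>y. y \<in> {0..1} \<Longrightarrow> \<bar>\<phi> y - p y\<bar> < e"
      using Stone_Weierstrass_real_polynomial_function[OF compact_Icc \<phi> e] by metis
    then obtain a n where pa: "p = (\<lambda>y. \<Sum>i\<le>n. a i * y ^ i)"
      unfolding real_polynomial_function_iff_sum by auto
    have p_eq: "p (exp (- t)) * G t = (\<Sum>i\<le>n. a i * (exp (- t) ^ i * G t))" for t
      by (simp add: pa sum_distrib_right mult.assoc)
    have intp: "set_integrable lborel {0<..} (\<lambda>t. p (exp (- t)) * G t)"
      unfolding p_eq using mono unfolding set_integrable_def
      by (auto simp: sum_distrib_left mult.left_commute[of "indicator _ _"] intro!: Bochner_Integration.integrable_sum integrable_mult_right)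
    have "(LBINT t:{0<..}. p (exp (- t)) * G t) = (\<Sum>i\<le>n. a i * (LBINT t:{0<..}. exp (- t) ^ i * G t))"
      unfolding p_eq using mono unfolding set_integrable_def set_lebesgue_integral_def
      by (simp add: sum_distrib_left mult.left_commute[of "indicator _ _"])
    also have "\<dots> = 0" using mono by simp
    finally have "(LBINT t:{0<..}. \<phi> (exp (- t)) * G t) = (LBINT t:{0<..}. \<phi> (exp (- t)) * G t - p (exp (- t)) * G t)"
      using int\<phi> intp by simp
    also have "\<bar>\<dots>\<bar> \<le> (LBINT t:{0<..}. norm (\<phi> (exp (- t)) * G t - p (exp (- t)) * G t))"
      using set_integral_norm_bound[OF set_integral_diff(1)[OF int\<phi> intp]] by simp
    also have "\<dots> \<le> (LBINT t:{0<..}. e * \<bar>G t\<bar>)"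
    proof (rule set_integral_mono)
      show "set_integrable lborel {0<..} (\<lambda>t. norm (\<phi> (exp (- t)) * G t - p (exp (- t)) * G t))"
        by (intro set_integrable_norm set_integral_diff(1) int\<phi> intp)
      show "set_integrable lborel {0<..} (\<lambda>t. e * \<bar>G t\<bar>)"
        by (intro set_integrable_mult_right set_integrable_abs G)
      fix t :: real assume "t \<in> {0<..}"
      then have "\<bar>\<phi> (exp (- t)) - p (exp (- t))\<bar> \<le> e" using p(2)[of "exp (- t)"] by auto
      then show "norm (\<phi> (exp (- t)) * G t - p (exp (- t)) * G t) \<le> e * \<bar>G t\<bar>"
        unfolding left_diff_distrib[symmetric] by (simp add: abs_mult mult_right_mono)
    qed
    also have "\<dots> = e * B" by (simp add: B_def)
    finally show ?thesis .
  qed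
  have "\<bar>LBINT t:{0<..}. \<phi> (exp (- t)) * G t\<bar> \<le> 0 + e" if "e > 0" for e
  proof -
    have "B \<ge> 0" unfolding B_def set_lebesgue_integral_def by (intro integral_nonneg_AE) auto
    \<comment> \<open>\<open>B + 1\<close> avoids a division by zero when \<open>B\<close>
      vanishes.\<close>
    then have "e / (B + 1) * B \<le> e" using that by (simp add: field_simps)
    moreover have "e / (B + 1) > 0" using that \<open>B \<ge> 0\<close> by simp
    ultimately show ?thesis
      using approx[of "e / (B + 1)"] by linarith
  qed
  then have "\<bar>LBINT t:{0<..}. \<phi> (exp (- t)) * G t\<bar> \<le> 0" by (rule field_le_epsilon)
  then show "(LBINT t:{0<..}. \<phi> (exp (- t)) * (exp (- t) * g t)) = 0" by (simp add: G_def)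
qed

text \<open>One-sided continuity is what distribution functions t -> P(Z < t) offer. A nonzero value
  at t fixes the sign of g on an interval ending at t, and a bump function in exp(-u) supported
  there would have a strictly positive integral against it.\<close>

lemma laplace_eq_zero_imp_zero:
  fixes g :: "real \<Rightarrow> real"
  assumes int: "\<And>\<mu>. \<mu> > 0 \<Longrightarrow> set_integrable lborel {0<..} (\<lambda>t. exp (- (\<mu> * t)) * g t)"
    and zero: "\<And>\<mu>. \<mu> > 0 \<Longrightarrow> (LBINT t:{0<..}. exp (- (\<mu> * t)) * g t) = 0"
    and t: "t > 0" and left: "(g \<longlongrightarrow> g t) (at_left t)"
  shows "g t = 0"
proof (rule ccontr)
  assume "g t \<noteq> 0"
  define \<sigma> where "\<sigma> = sgn (g t)"
  have \<sigma>: "\<sigma> * g t > 0" "\<sigma> \<noteq> 0" using \<open>g t \<noteq> 0\<close> by (auto simp: \<sigma>_def sgn_if)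
  have "((\<lambda>u. \<sigma> * g u) \<longlongrightarrow> \<sigma> * g t) (at_left t)"
    by (intro tendsto_intros left)
  then have "eventually (\<lambda>u. \<sigma> * g u > 0) (at_left t)"
    using \<sigma>(1) by (rule order_tendstoD)
  then obtain b where b: "b < t" "\<And>u. b < u \<Longrightarrow> u < t \<Longrightarrow> \<sigma> * g u > 0"
    unfolding eventually_at_left_field by auto
  \<comment> \<open>Beyond the midpoint of b and t, so that r > b, and at least t/2, so that r >
    0.\<close>
  define r where "r = max (b / 2 + t / 2) (t / 2)"
  have r: "0 < r" "r < t" "b < r" using b t by (auto simp: r_def max_def field_simps)
  \<comment> \<open>The quadratic in y = exp(-u) is positive exactly between its roots exp(-t) and
    exp(-r), that is for r < u < t.\<close>
  define \<phi> where "\<phi> = (\<lambda>y. max 0 ((y - exp (- t)) * (exp (- r) - y)))"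
  have \<phi>: "continuous_on {0..1} \<phi>" unfolding \<phi>_def by (intro continuous_intros)
  have \<phi>_pos: "\<phi> (exp (- u)) > 0" if "r < u" "u < t" for u
    using that by (auto simp: \<phi>_def less_max_iff_disj)
  have \<phi>_zero: "\<phi> (exp (- u)) = 0" if "u \<le> r \<or> t \<le> u" for u
  proof -
    from that have "(exp (- u) - exp (- t)) * (exp (- r) - exp (- u)) \<le> 0"
    proof
      assume "u \<le> r"
      then show ?thesis using r by (intro mult_nonneg_nonpos) auto
    next
      assume "t \<le> u"
      then show ?thesis using r by (intro mult_nonpos_nonneg) auto
    qed
    then show ?thesis by (simp add: \<phi>_def max_def)
  qed
  let ?h = "\<lambda>u. indicat_real {0<..} u *\<^sub>R (\<sigma> * (\<phi> (exp (- u)) * (exp (- u) * g u)))"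
  have h_pos: "?h u > 0" if "r < u" "u < t" for u
    using that r b(2)[of u] \<phi>_pos[OF that] by (simp add: mult.left_commute[of \<sigma>] zero_less_mult_iff)
  have h_zero: "?h u = 0" if "u \<le> r \<or> t \<le> u" for u
    using \<phi>_zero[OF that] by simp
  have h_nonneg: "?h u \<ge> 0" for u
    using h_pos[of u] h_zero[of u] by (cases "u \<le> r \<or> t \<le> u") (auto simp: less_imp_le)
  have "(LBINT u. ?h u) = \<sigma> * (LBINT u:{0<..}. \<phi> (exp (- u)) * (exp (- u) * g u))"
    unfolding set_lebesgue_integral_def by (simp add: mult.left_commute[of "indicator _ _"])
  also have "\<dots> = 0"
    using laplace_eq_zero_imp_integral_continuous(2)[OF int zero \<phi>] by simp
  finally have I0: "(LBINT u. ?h u) = 0" .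
  have h_int: "integrable lborel ?h"
    using set_integrable_mult_right[OF laplace_eq_zero_imp_integral_continuous(1)[OF int zero \<phi>], of \<sigma>]
    by (simp add: set_integrable_def)
  have "AE u in lborel. ?h u = 0"
    using I0 h_int h_nonneg integral_nonneg_eq_0_iff_AE[OF h_int] by auto
  then have "AE u in lborel. u \<notin> {r<..<t}"
    by eventually_elim (use h_pos in force)
  then have "emeasure lborel {r<..<t} = 0"
    by (subst (asm) AE_iff_measurable[OF _ refl]) (auto simp: greaterThanLessThan_eq greaterThan_def lessThan_def Collect_conj_eq)
  then show False using r by simp
qed

section \<open>Integrals of the candidate density over intervals\<close>

text \<open>Integrating over y in [a, b] outside the transform leaves \<Psi> / \<mu> * exp(-y
  \<Psi>), which has an elementary primitive. The exchange is licensed by the linear bound C t,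
  available because a > 0.\<close>

lemma laplace_integral_conv_density:
  assumes c: "c > 0" and a: "0 < a" "a < b" and \<mu>: "\<mu> > 0"
  defines "\<Psi> \<equiv> \<mu> powr (2 / 3) + c * \<mu> powr (1 / 3)"
  shows "set_integrable lborel {0<..} (\<lambda>t. exp (- (\<mu> * t)) * (LBINT y:{a..b}. conv_density c y t))"
    and "(LBINT t:{0<..}. exp (- (\<mu> * t)) * (LBINT y:{a..b}. conv_density c y t))
      = (exp (- (a * \<Psi>)) - exp (- (b * \<Psi>))) / \<mu>"
proof -
  obtain C where C: "C \<ge> 0" "\<And>x t. x \<ge> a \<Longrightarrow> t \<ge> 0 \<Longrightarrow> \<bar>conv_density c x t\<bar> \<le> C * t"
    using conv_density_bound[OF c a(1)] by metis
  define F where "F = (\<lambda>t y. exp (- (\<mu> * t)) * conv_density c y t)"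
  have meas: "(\<lambda>p. F (fst p) (snd p)) \<in> borel_measurable (lborel \<Otimes>\<^sub>M lborel)"
    unfolding F_def by measurable
  have A: "set_integrable lborel {0<..} (\<lambda>t. exp (- (\<mu> * t)) * (C * t))"
  proof -
    have "((\<lambda>t. exp (- (\<mu> * t)) * (C * t) * exp (\<mu> / 2 * t)) \<longlongrightarrow> 0) at_top"
      using \<mu> by real_asymp
    then have "eventually (\<lambda>t. exp (- (\<mu> * t)) * (C * t) * exp (\<mu> / 2 * t) < 1) at_top"
      by (rule order_tendstoD) simp
    then have "eventually (\<lambda>t. exp (- (\<mu> * t)) * (C * t) * exp (\<mu> / 2 * t) \<le> 1) at_top"
      by (rule eventually_mono) simp
    then obtain K where K: "\<And>t. t \<ge> 0 \<Longrightarrow> exp (- (\<mu> * t)) * (C * t) * exp (\<mu> / 2 * t) \<le> K"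
      by (rule bounded_if_eventually_le_at_top[rotated]) (auto intro!: continuous_intros)
    show ?thesis
    proof (rule set_integrable_Ioi_exp_bound[where b = "\<mu> / 2" and C = K])
      fix t :: real assume "t > 0"
      then have "exp (- (\<mu> * t)) * (C * t) * exp (\<mu> / 2 * t) * exp (- (\<mu> / 2 * t)) \<le> K * exp (- (\<mu> / 2 * t))"
        by (intro mult_right_mono K) auto
      then have "exp (- (\<mu> * t)) * (C * t) * (exp (\<mu> / 2 * t) * exp (- (\<mu> / 2 * t))) \<le> K * exp (- (\<mu> / 2 * t))"
        by (simp only: mult.assoc)
      then show "norm (exp (- (\<mu> * t)) * (C * t)) \<le> K * exp (- (\<mu> / 2 * t))"
        using \<open>t > 0\<close> C(1) by (simp add: abs_mult flip: exp_add)
    qed (use \<mu> in \<open>auto intro!: continuous_intros\<close>)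
  qed
  have B: "set_integrable lborel {a..b} (\<lambda>y. 1::real)"
    by (rule borel_integrable_atLeastAtMost') auto
  have bound: "norm (F t y) \<le> exp (- (\<mu> * t)) * (C * t) * 1" if "t \<in> {0<..}" "y \<in> {a..b}" for t y
    using C(2)[of y t] that by (simp add: F_def abs_mult)
  note fub = set_Fubini_product_bound[OF meas _ _ A B bound]
  have inner: "(LBINT y:{a..b}. F t y) = exp (- (\<mu> * t)) * (LBINT y:{a..b}. conv_density c y t)" for t
    by (simp add: F_def)
  have "set_integrable lborel {0<..} (\<lambda>t. LBINT y:{a..b}. F t y)"
    by (rule fub(1)) auto
  then show "set_integrable lborel {0<..} (\<lambda>t. exp (- (\<mu> * t)) * (LBINT y:{a..b}. conv_density c y t))"
    unfolding inner .
  have \<Psi>: "\<Psi> > 0" using c \<mu> by (auto simp: \<Psi>_def intro!: add_pos_pos mult_pos_pos)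
  \<comment> \<open>The prefactor of the transform is \<Psi> / \<mu>, so that the y-integral
    produces a difference of exponentials without further factors.\<close>
  have \<Psi>\<mu>: "\<mu> powr (- 1 / 3) + c * \<mu> powr (- 2 / 3) = \<Psi> / \<mu>"
  proof -
    have "\<mu> powr (- 1 / 3) = \<mu> powr (2 / 3) / \<mu>" "\<mu> powr (- 2 / 3) = \<mu> powr (1 / 3) / \<mu>"
      using \<mu> powr_diff[of \<mu> "2 / 3" 1] powr_diff[of \<mu> "1 / 3" 1] by simp_all
    then show ?thesis by (simp add: \<Psi>_def add_divide_distrib)
  qed
  have "(LBINT t:{0<..}. exp (- (\<mu> * t)) * (LBINT y:{a..b}. conv_density c y t))
      = (LBINT y:{a..b}. LBINT t:{0<..}. F t y)"
    unfolding inner[symmetric] by (rule fub(2)) auto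
  also have "\<dots> = (LBINT y:{a..b}. \<Psi> / \<mu> * exp (- (y * \<Psi>)))"
  proof (rule set_lebesgue_integral_cong)
    have "(LBINT t:{0<..}. F t y) = \<Psi> / \<mu> * exp (- (y * \<Psi>))" if "y \<in> {a..b}" for y
      using laplace_conv_density[OF c _ \<mu>, of y] that a unfolding F_def \<Psi>\<mu> \<Psi>_def[symmetric] by simp
    then show "\<forall>y. y \<in> {a..b} \<longrightarrow> (LBINT t:{0<..}. F t y) = \<Psi> / \<mu> * exp (- (y * \<Psi>))" by blast
  qed auto
  also have "\<dots> = integral {a..b} (\<lambda>y. \<Psi> / \<mu> * exp (- (y * \<Psi>)))"
    by (intro set_borel_integral_eq_integral(2) borel_integrable_atLeastAtMost' continuous_intros)
  also have "\<dots> = - exp (- (b * \<Psi>)) / \<mu> - - exp (- (a * \<Psi>)) / \<mu>"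
    using a \<Psi> \<mu> by (intro integral_unique fundamental_theorem_of_calculus)
      (auto intro!: derivative_eq_intros simp: has_real_derivative_iff_has_vector_derivative[symmetric])
  finally show "(LBINT t:{0<..}. exp (- (\<mu> * t)) * (LBINT y:{a..b}. conv_density c y t))
      = (exp (- (a * \<Psi>)) - exp (- (b * \<Psi>))) / \<mu>"
    by (simp add: diff_divide_distrib)
qed

lemma tendsto_integral_conv_density:
  assumes c: "c > 0" and a: "0 < a" "a < b" and t: "t > 0"
  shows "((\<lambda>t. LBINT y:{a..b}. conv_density c y t) \<longlongrightarrow> (LBINT y:{a..b}. conv_density c y t)) (at_left t)"
proof (rule tendsto_at_left_sequentially[OF t])
  fix S :: "nat \<Rightarrow> real"
  assume S: "\<And>n. S n < t" "\<And>n. 0 < S n" "S \<longlonglongrightarrow> t"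
  obtain C where C: "C \<ge> 0" "\<And>x t. x \<ge> a \<Longrightarrow> t \<ge> 0 \<Longrightarrow> \<bar>conv_density c x t\<bar> \<le> C * t"
    using conv_density_bound[OF c a(1)] by metis
  show "(\<lambda>n. LBINT y:{a..b}. conv_density c y (S n)) \<longlonglongrightarrow> (LBINT y:{a..b}. conv_density c y t)"
    unfolding set_lebesgue_integral_def
  proof (rule integral_dominated_convergence)
    have "set_integrable lborel {a..b} (\<lambda>y. C * t)"
      by (rule borel_integrable_atLeastAtMost') auto
    then show "integrable lborel (\<lambda>y. indicat_real {a..b} y *\<^sub>R (C * t))"
      by (simp add: set_integrable_def)
    show "AE y in lborel. (\<lambda>n. indicat_real {a..b} y *\<^sub>R conv_density c y (S n))
        \<longlonglongrightarrow> indicat_real {a..b} y *\<^sub>R conv_density c y t"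
    proof (rule AE_I2)
      fix y
      show "(\<lambda>n. indicat_real {a..b} y *\<^sub>R conv_density c y (S n)) \<longlonglongrightarrow> indicat_real {a..b} y *\<^sub>R conv_density c y t"
      proof (cases "y \<in> {a..b}")
        case True
        then have "(\<lambda>n. conv_density c y (S n)) \<longlonglongrightarrow> conv_density c y t"
          using a by (intro tendsto_conv_density[OF c _ _ S(3)]) auto
        then show ?thesis by (intro tendsto_intros)
      qed simp
    qed
    show "AE y in lborel. norm (indicat_real {a..b} y *\<^sub>R conv_density c y (S n)) \<le> indicat_real {a..b} y *\<^sub>R (C * t)" for n
    proof (rule AE_I2)
      fix y
      have "\<bar>conv_density c y (S n)\<bar> \<le> C * t" if "y \<ge> a"
        using C(2)[OF that, of "S n"] S(1,2)[of n] C(1) mult_left_mono[of "S n" t C] by simp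
      then show "norm (indicat_real {a..b} y *\<^sub>R conv_density c y (S n)) \<le> indicat_real {a..b} y *\<^sub>R (C * t)"
        by (auto split: split_indicator)
    qed
  qed measurable
qed

lemma nonneg_if_integrals_nonneg:
  fixes f :: "real \<Rightarrow> real"
  assumes cont: "continuous_on {0<..} f"
    and nonneg: "\<And>a b. 0 < a \<Longrightarrow> a < b \<Longrightarrow> 0 \<le> (LBINT y:{a..b}. f y)" and x: "x > 0"
  shows "0 \<le> f x"
proof (rule ccontr)
  assume neg: "\<not> 0 \<le> f x"
  have "(f \<longlongrightarrow> f x) (at x)"
    using cont x by (simp add: continuous_on_eq_continuous_at continuous_within isCont_def)
  then have "eventually (\<lambda>y. f y < f x / 2) (at x)"
    using neg by (intro order_tendstoD) auto
  then obtain d where d: "d > 0" "\<And>y. y \<noteq> x \<Longrightarrow> dist y x < d \<Longrightarrow> f y < f x / 2"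
    unfolding eventually_at by auto
  define b where "b = x + d / 2"
  have b: "x < b" using d by (simp add: b_def)
  have I: "set_integrable lborel {x..b} f"
    using x by (intro borel_integrable_atLeastAtMost' continuous_on_subset[OF cont]) auto
  have "(LBINT y:{x..b}. f y) \<le> (LBINT y:{x..b}. f x / 2)"
  proof (rule set_integral_mono[OF I])
    fix y assume "y \<in> {x..b}"
    then show "f y \<le> f x / 2"
      using d(2)[of y] neg d(1) by (cases "y = x") (auto simp: dist_real_def b_def)
  qed (rule borel_integrable_atLeastAtMost', auto)
  also have "\<dots> = (b - x) * (f x / 2)"
    using b unfolding set_lebesgue_integral_def by simp
  also have "\<dots> < 0" using b neg by (intro mult_pos_neg) auto
  finally show False using nonneg[OF x b] by simp
qed

section \<open>Distribution functions: Laplace transform and left continuity\<close>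

context prob_space
begin

text \<open>By Fubini, from the integral of exp(-\<mu> t) over t > Z, which is exp(-\<mu> Z) /
  \<mu>.\<close>

lemma laplace_cdf:
  fixes Z :: "'a \<Rightarrow> real"
  assumes Z [measurable]: "random_variable borel Z" and nonneg: "\<And>\<omega>. \<omega> \<in> space M \<Longrightarrow> Z \<omega> \<ge> 0" and \<mu>: "\<mu> > 0"
  shows "set_integrable lborel {0<..} (\<lambda>t. exp (- (\<mu> * t)) * prob {\<omega> \<in> space M. Z \<omega> < t})"
    and "(LBINT t:{0<..}. exp (- (\<mu> * t)) * prob {\<omega> \<in> space M. Z \<omega> < t}) = expectation (\<lambda>\<omega>. exp (- \<mu> * Z \<omega>)) / \<mu>"
proof -
  interpret pair_sigma_finite M lborel ..
  define F where "F = (\<lambda>\<omega> t. indicat_real {0<..} t *\<^sub>R (exp (- (\<mu> * t)) * (if Z \<omega> < t then 1 else 0)))"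
  have one: "(\<lambda>_::real. 1::real) \<in> borel_measurable borel" "\<And>t::real. \<bar>1::real\<bar> \<le> 1" by auto
  have I: "integrable lborel (F \<omega>)" "(LBINT t. F \<omega> t) = exp (- \<mu> * Z \<omega>) / \<mu>" if "\<omega> \<in> space M" for \<omega>
  proof -
    have eq: "F \<omega> = (\<lambda>t. indicat_real {0<..} t *\<^sub>R (exp (- (\<mu> * t)) * (indicator {Z \<omega><..} t * 1)))"
      by (auto simp: F_def split: split_indicator)
    note L = laplace_shift[OF one \<mu> nonneg[OF that]]
    show "integrable lborel (F \<omega>)" using L(1) unfolding eq set_integrable_def .
    have "(LBINT t:{0<..}. exp (- (\<mu> * t)) * 1) = 1 / \<mu>"
      using LBINT_I0i_exp_mscale[OF \<mu>] by (simp add: interval_lebesgue_integral_0_infty mult.commute)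
    then show "(LBINT t. F \<omega> t) = exp (- \<mu> * Z \<omega>) / \<mu>"
      using L(2) unfolding eq set_lebesgue_integral_def by simp
  qed
  have E: "integrable M (\<lambda>\<omega>. exp (- \<mu> * Z \<omega>) / \<mu>)"
    using nonneg \<mu> by (intro integrable_const_bound[where B = "1 / \<mu>"]) (auto intro!: divide_right_mono)
  have Fnn: "norm (F \<omega> t) = F \<omega> t" for \<omega> t by (auto simp: F_def)
  have int: "integrable (M \<Otimes>\<^sub>M lborel) (\<lambda>p. F (fst p) (snd p))"
  proof (rule Fubini_integrable)
    show "(\<lambda>p. F (fst p) (snd p)) \<in> borel_measurable (M \<Otimes>\<^sub>M lborel)"
      unfolding F_def by measurable
    have "integrable M (\<lambda>\<omega>. LBINT t. F \<omega> t) = integrable M (\<lambda>\<omega>. exp (- \<mu> * Z \<omega>) / \<mu>)"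
      using I(2) by (intro Bochner_Integration.integrable_cong) auto
    then show "integrable M (\<lambda>\<omega>. LBINT t. norm (F (fst (\<omega>, t)) (snd (\<omega>, t))))"
      using E by (simp only: fst_conv snd_conv Fnn)
    show "AE \<omega> in M. integrable lborel (\<lambda>t. F (fst (\<omega>, t)) (snd (\<omega>, t)))"
      using I(1) by (intro AE_I2) auto
  qed
  have P: "(\<integral>\<omega>. F \<omega> t \<partial>M) = indicat_real {0<..} t *\<^sub>R (exp (- (\<mu> * t)) * prob {\<omega> \<in> space M. Z \<omega> < t})" for t
  proof -
    have "(\<integral>\<omega>. (if Z \<omega> < t then 1 else 0) \<partial>M) = (\<integral>\<omega>. indicat_real {\<omega> \<in> space M. Z \<omega> < t} \<omega> \<partial>M)"
      by (intro Bochner_Integration.integral_cong) (auto split: split_indicator)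
    also have "\<dots> = prob {\<omega> \<in> space M. Z \<omega> < t}" by simp
    finally show ?thesis by (simp add: F_def)
  qed
  have int': "integrable (M \<Otimes>\<^sub>M lborel) (case_prod F)"
    using int by (simp add: case_prod_unfold)
  show "set_integrable lborel {0<..} (\<lambda>t. exp (- (\<mu> * t)) * prob {\<omega> \<in> space M. Z \<omega> < t})"
    using integrable_snd[OF int'] unfolding P set_integrable_def .
  have "(LBINT t. \<integral>\<omega>. F \<omega> t \<partial>M) = (\<integral>\<omega>. (LBINT t. F \<omega> t) \<partial>M)"
    by (rule Fubini_integral[OF int'])
  also have "\<dots> = expectation (\<lambda>\<omega>. exp (- \<mu> * Z \<omega>) / \<mu>)"
    using I(2) by (intro Bochner_Integration.integral_cong) auto
  finally show "(LBINT t:{0<..}. exp (- (\<mu> * t)) * prob {\<omega> \<in> space M. Z \<omega> < t}) = expectation (\<lambda>\<omega>. exp (- \<mu> * Z \<omega>)) / \<mu>"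
    unfolding P set_lebesgue_integral_def by simp
qed

text \<open>The strict inequality is essential: {Z < t} is the increasing union of {Z < s} over s <
  t, so continuity from below applies.\<close>

lemma tendsto_prob_less_at_left:
  fixes Z :: "'a \<Rightarrow> real" and t :: real
  assumes Z [measurable]: "random_variable borel Z"
  shows "((\<lambda>t. prob {\<omega> \<in> space M. Z \<omega> < t}) \<longlongrightarrow> prob {\<omega> \<in> space M. Z \<omega> < t}) (at_left t)"
proof (rule tendsto_at_left_sequentially[of "t - 1"])
  fix S assume S: "\<And>n. S n < t" "incseq S" "S \<longlonglongrightarrow> t"
  have "(\<lambda>n. prob {\<omega> \<in> space M. Z \<omega> < S n}) \<longlonglongrightarrow> prob (\<Union>n. {\<omega> \<in> space M. Z \<omega> < S n})"
    using S(2) by (intro finite_Lim_measure_incseq) (auto simp: incseq_def intro: less_le_trans)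
  also have "(\<Union>n. {\<omega> \<in> space M. Z \<omega> < S n}) = {\<omega> \<in> space M. Z \<omega> < t}"
  proof -
    have "\<exists>n. y < S n" if "y < t" for y
      using order_tendstoD(1)[OF S(3) that] by (auto simp: eventually_sequentially)
    then show ?thesis using S(1) by (auto intro: less_trans)
  qed
  finally show "(\<lambda>n. prob {\<omega> \<in> space M. Z \<omega> < S n}) \<longlonglongrightarrow> prob {\<omega> \<in> space M. Z \<omega> < t}" .
qed simp

end

subsection \<open>The mixed stable subordinator and its inverse\<close>

locale mixed_stable_subordinator = prob_space M for M :: "'a measure" +
  fixes H1 H2 :: "real \<Rightarrow> 'a \<Rightarrow> real" and lam :: real
  assumes stable1: "stable_subordinator (2 / 3) H1" and stable2: "stable_subordinator (1 / 3) H2"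
    and indep: "indep_processes H1 H2" and lam: "lam > 0"
begin

abbreviation "c \<equiv> 2 * lam"
abbreviation "Z \<equiv> sum_process lam H1 H2"

lemma c_pos: "c > 0" using lam by simp

lemma
  assumes "\<omega> \<in> space M"
  shows mono_H1: "mono_on {0..} (\<lambda>t. H1 t \<omega>)" and mono_H2: "mono_on {0..} (\<lambda>t. H2 t \<omega>)"
    and zero_H1: "H1 0 \<omega> = 0" and zero_H2: "H2 0 \<omega> = 0"
    and right_H1: "t \<ge> 0 \<Longrightarrow> continuous (at_right t) (\<lambda>s. H1 s \<omega>)"
    and right_H2: "t \<ge> 0 \<Longrightarrow> continuous (at_right t) (\<lambda>s. H2 s \<omega>)"
  using assms stable1 stable2 unfolding stable_subordinator_def subordinator_def by auto

lemma measurable_H [measurable]: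
  "t \<ge> 0 \<Longrightarrow> random_variable borel (H1 t)" "t \<ge> 0 \<Longrightarrow> random_variable borel (H2 t)"
  using stable1 stable2 unfolding stable_subordinator_def subordinator_def by auto

lemma H_nonneg:
  assumes "\<omega> \<in> space M" "t \<ge> 0"
  shows "0 \<le> H1 t \<omega>" "0 \<le> H2 t \<omega>"
  using mono_onD[OF mono_H1[OF assms(1)], of 0 t] mono_onD[OF mono_H2[OF assms(1)], of 0 t] assms
  by (auto simp: zero_H1 zero_H2)

lemma measurable_Z [measurable]: "t \<ge> 0 \<Longrightarrow> random_variable borel (Z t)"
  unfolding sum_process_def by measurable

lemma Z_mono: "\<omega> \<in> space M \<Longrightarrow> 0 \<le> s \<Longrightarrow> s \<le> t \<Longrightarrow> Z s \<omega> \<le> Z t \<omega>"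
  using mono_onD[OF mono_H1, of \<omega> s t] mono_onD[OF mono_H2, of \<omega> s t] lam
  unfolding sum_process_def by (intro add_mono mult_left_mono) auto

lemma Z_zero: "\<omega> \<in> space M \<Longrightarrow> Z 0 \<omega> = 0"
  by (simp add: sum_process_def zero_H1 zero_H2)

lemma Z_nonneg: "\<omega> \<in> space M \<Longrightarrow> t \<ge> 0 \<Longrightarrow> Z t \<omega> \<ge> 0"
  using Z_mono[of \<omega> 0 t] by (simp add: Z_zero)

lemma Z_right: "\<omega> \<in> space M \<Longrightarrow> t \<ge> 0 \<Longrightarrow> ((\<lambda>s. Z s \<omega>) \<longlongrightarrow> Z t \<omega>) (at_right t)"
  using right_H1[of \<omega> t] right_H2[of \<omega> t] unfolding sum_process_def continuous_within
  by (intro tendsto_intros)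

text \<open>Independence of the paths is pushed forward along evaluation at time x, and the
  expectation factorises. The cube root in the second exponent turns c^3 into c.\<close>

lemma laplace_Z:
  assumes x: "x > 0" and \<mu>: "\<mu> > 0"
  shows "expectation (\<lambda>\<omega>. exp (- \<mu> * Z x \<omega>)) = exp (- (x * (\<mu> powr (2 / 3) + c * \<mu> powr (1 / 3))))"
proof -
  have x0: "x \<ge> 0" using x by simp
  let ?P = "\<Pi>\<^sub>M t\<in>{0..}. (borel :: real measure)"
  define f where "f = (\<lambda>m (h :: real \<Rightarrow> real). exp (- m * h x))"
  have [measurable]: "(\<lambda>h. h x) \<in> borel_measurable ?P"
    using x0 by (intro measurable_component_singleton) auto
  have f: "f m \<in> borel_measurable ?P" for m
    unfolding f_def by measurable
  have "indep_var borel (f \<mu> \<circ> (\<lambda>\<omega>. \<lambda>t\<in>{0..}. H1 t \<omega>)) borel (f (\<mu> * c ^ 3) \<circ> (\<lambda>\<omega>. \<lambda>t\<in>{0..}. H2 t \<omega>))"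
    using indep unfolding indep_processes_def by (rule indep_var_compose[OF _ f f])
  then have ind: "indep_var borel (\<lambda>\<omega>. exp (- \<mu> * H1 x \<omega>)) borel (\<lambda>\<omega>. exp (- (\<mu> * c ^ 3) * H2 x \<omega>))"
    using x0 by (simp add: f_def o_def)
  have int: "integrable M (\<lambda>\<omega>. exp (- \<mu> * H1 x \<omega>))" "integrable M (\<lambda>\<omega>. exp (- (\<mu> * c ^ 3) * H2 x \<omega>))"
    using H_nonneg x0 \<mu> lam by (auto intro!: integrable_const_bound[where B = 1] measurable_H)
  have "expectation (\<lambda>\<omega>. exp (- \<mu> * Z x \<omega>)) = expectation (\<lambda>\<omega>. exp (- \<mu> * H1 x \<omega>) * exp (- (\<mu> * c ^ 3) * H2 x \<omega>))"
    unfolding exp_add[symmetric] sum_process_def by (simp add: algebra_simps)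
  also have "\<dots> = expectation (\<lambda>\<omega>. exp (- \<mu> * H1 x \<omega>)) * expectation (\<lambda>\<omega>. exp (- (\<mu> * c ^ 3) * H2 x \<omega>))"
    by (rule indep_var_lebesgue_integral[OF ind int])
  also have "expectation (\<lambda>\<omega>. exp (- \<mu> * H1 x \<omega>)) = exp (- x * \<mu> powr (2 / 3))"
    using stable1 x \<mu> unfolding stable_subordinator_def by auto
  also have "expectation (\<lambda>\<omega>. exp (- (\<mu> * c ^ 3) * H2 x \<omega>)) = exp (- x * (\<mu> * c ^ 3) powr (1 / 3))"
    using stable2 x \<mu> c_pos unfolding stable_subordinator_def by (metis mult_pos_pos zero_less_power)
  also have "(\<mu> * c ^ 3) powr (1 / 3) = c * \<mu> powr (1 / 3)"
  proof -
    have "(u ^ 3) powr (1 / 3) = u" if "u > 0" for u :: real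
    proof -
      have "u ^ 3 = u powr real 3" using that by (rule powr_realpow[symmetric])
      then have "(u ^ 3) powr (1 / 3) = u powr (real 3 * (1 / 3))" by (simp only: powr_powr)
      then show ?thesis using that by simp
    qed
    from this[OF c_pos] show ?thesis
      using \<mu> c_pos by (subst powr_mult) (simp_all only: less_imp_le zero_le_power mult.commute)
  qed
  finally show ?thesis by (simp add: exp_add[symmetric] algebra_simps)
qed

lemma integral_conv_density_eq:
  assumes a: "0 < a" "a < b" and t: "t > 0"
  shows "(LBINT y:{a..b}. conv_density c y t) = prob {\<omega> \<in> space M. Z a \<omega> < t} - prob {\<omega> \<in> space M. Z b \<omega> < t}"
proof -
  define g where "g = (\<lambda>t. prob {\<omega> \<in> space M. Z a \<omega> < t} - prob {\<omega> \<in> space M. Z b \<omega> < t} - (LBINT y:{a..b}. conv_density c y t))"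
  have a0: "a \<ge> 0" "b \<ge> 0" and b: "b > 0" using a by auto
  have L: "set_integrable lborel {0<..} (\<lambda>t. exp (- (\<mu> * t)) * prob {\<omega> \<in> space M. Z x \<omega> < t})"
    "(LBINT t:{0<..}. exp (- (\<mu> * t)) * prob {\<omega> \<in> space M. Z x \<omega> < t})
      = exp (- (x * (\<mu> powr (2 / 3) + c * \<mu> powr (1 / 3)))) / \<mu>"
    if x: "x > 0" and \<mu>: "\<mu> > 0" for x \<mu>
  proof -
    have "x \<ge> 0" using x by simp
    then show "set_integrable lborel {0<..} (\<lambda>t. exp (- (\<mu> * t)) * prob {\<omega> \<in> space M. Z x \<omega> < t})"
      by (intro laplace_cdf(1) measurable_Z Z_nonneg \<mu>)
    have "(LBINT t:{0<..}. exp (- (\<mu> * t)) * prob {\<omega> \<in> space M. Z x \<omega> < t}) = expectation (\<lambda>\<omega>. exp (- \<mu> * Z x \<omega>)) / \<mu>"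
      using \<open>x \<ge> 0\<close> by (intro laplace_cdf(2) measurable_Z Z_nonneg \<mu>)
    then show "(LBINT t:{0<..}. exp (- (\<mu> * t)) * prob {\<omega> \<in> space M. Z x \<omega> < t})
      = exp (- (x * (\<mu> powr (2 / 3) + c * \<mu> powr (1 / 3)))) / \<mu>"
      unfolding laplace_Z[OF x \<mu>] .
  qed
  note La = L[OF a(1)] and Lb = L[OF b]
  note Lc = laplace_integral_conv_density[OF c_pos a]
  have "g t = 0"
  proof (rule laplace_eq_zero_imp_zero[OF _ _ t])
    fix \<mu> :: real assume \<mu>: "\<mu> > 0"
    have eq: "(\<lambda>t. exp (- (\<mu> * t)) * g t) = (\<lambda>t. exp (- (\<mu> * t)) * prob {\<omega> \<in> space M. Z a \<omega> < t}
        - exp (- (\<mu> * t)) * prob {\<omega> \<in> space M. Z b \<omega> < t}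
        - exp (- (\<mu> * t)) * (LBINT y:{a..b}. conv_density c y t))"
      unfolding g_def by (simp add: right_diff_distrib)
    show "set_integrable lborel {0<..} (\<lambda>t. exp (- (\<mu> * t)) * g t)"
      unfolding eq using \<mu> by (intro set_integral_diff La(1) Lb(1) Lc(1))
    have "(LBINT t:{0<..}. exp (- (\<mu> * t)) * g t)
       = (LBINT t:{0<..}. exp (- (\<mu> * t)) * prob {\<omega> \<in> space M. Z a \<omega> < t})
        - (LBINT t:{0<..}. exp (- (\<mu> * t)) * prob {\<omega> \<in> space M. Z b \<omega> < t})
        - (LBINT t:{0<..}. exp (- (\<mu> * t)) * (LBINT y:{a..b}. conv_density c y t))"
      unfolding eq using La(1)[OF \<mu>] Lb(1)[OF \<mu>] Lc(1)[OF \<mu>]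
      by (simp add: set_integral_diff)
    also have "\<dots> = 0"
      unfolding La(2)[OF \<mu>] Lb(2)[OF \<mu>] Lc(2)[OF \<mu>]
      by (simp add: diff_divide_distrib)
    finally show "(LBINT t:{0<..}. exp (- (\<mu> * t)) * g t) = 0" .
  next
    show "(g \<longlongrightarrow> g t) (at_left t)"
      unfolding g_def
      by (intro tendsto_diff tendsto_prob_less_at_left measurable_Z a0 tendsto_integral_conv_density c_pos a t)
  qed
  then show ?thesis by (simp add: g_def)
qed

text \<open>The sign is not visible in the oscillating integrals. It comes from the monotone paths,
  which make the integral over each [a, b] a nonnegative difference of probabilities; continuity in
  x localises this.\<close>

lemma conv_density_nonneg:
  assumes x: "x > 0" and t: "t > 0"
  shows "0 \<le> conv_density c x t"
proof (rule nonneg_if_integrals_nonneg[where f = "\<lambda>x. conv_density c x t", OF _ _ x])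
  show "continuous_on {0<..} (\<lambda>x. conv_density c x t)"
    unfolding continuous_on_sequentially o_def
    by (auto intro!: tendsto_conv_density c_pos)
  fix a b :: real assume ab: "0 < a" "a < b"
  have "prob {\<omega> \<in> space M. Z b \<omega> < t} \<le> prob {\<omega> \<in> space M. Z a \<omega> < t}"
  proof (rule finite_measure_mono)
    have le: "Z a \<omega> \<le> Z b \<omega>" if "\<omega> \<in> space M" for \<omega> using that ab by (intro Z_mono) auto
    then show "{\<omega> \<in> space M. Z b \<omega> < t} \<subseteq> {\<omega> \<in> space M. Z a \<omega> < t}"
      by (auto intro: le_less_trans[OF le])
    have [measurable]: "random_variable borel (Z a)" using ab by (intro measurable_Z) simp
    show "{\<omega> \<in> space M. Z a \<omega> < t} \<in> events" by measurable
  qed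
  then show "0 \<le> (LBINT y:{a..b}. conv_density c y t)"
    unfolding integral_conv_density_eq[OF ab t] by simp
qed

section \<open>First passage events and the law of the inverse\<close>

text \<open>Right continuity at 0 with Z 0 = 0. It excludes an atom of the inverse process at 0 and
  gives the density total mass up to the origin.\<close>

lemma tendsto_prob_Z_zero:
  assumes t: "t > 0"
  shows "(\<lambda>n. prob {\<omega> \<in> space M. Z (1 / real (Suc n)) \<omega> < t}) \<longlonglongrightarrow> 1"
proof -
  have "(\<lambda>n. prob {\<omega> \<in> space M. Z (1 / real (Suc n)) \<omega> < t})
     \<longlonglongrightarrow> prob (\<Union>n. {\<omega> \<in> space M. Z (1 / real (Suc n)) \<omega> < t})"
  proof (rule finite_Lim_measure_incseq)
    have [measurable]: "random_variable borel (Z (1 / real (Suc n)))" for n by (intro measurable_Z) simp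
    show "range (\<lambda>n. {\<omega> \<in> space M. Z (1 / real (Suc n)) \<omega> < t}) \<subseteq> events" by auto
    show "incseq (\<lambda>n. {\<omega> \<in> space M. Z (1 / real (Suc n)) \<omega> < t})"
    proof (rule incseq_SucI)
      fix n
      have "1 / real (Suc (Suc n)) \<le> 1 / real (Suc n)" by (intro frac_le) auto
      then have le: "Z (1 / real (Suc (Suc n))) \<omega> \<le> Z (1 / real (Suc n)) \<omega>" if "\<omega> \<in> space M" for \<omega>
        using that by (intro Z_mono) auto
      then show "{\<omega> \<in> space M. Z (1 / real (Suc n)) \<omega> < t} \<subseteq> {\<omega> \<in> space M. Z (1 / real (Suc (Suc n))) \<omega> < t}"
        by (auto simp del: of_nat_Suc intro: le_less_trans[OF le])
    qed
  qed
  also have "(\<Union>n. {\<omega> \<in> space M. Z (1 / real (Suc n)) \<omega> < t}) = space M"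
  proof -
    have "\<exists>n. Z (1 / real (Suc n)) \<omega> < t" if \<omega>: "\<omega> \<in> space M" for \<omega>
    proof -
      have "filterlim (\<lambda>n. 1 / real (Suc n)) (at_right 0) sequentially"
        by real_asymp
      from filterlim_compose[OF Z_right[OF \<omega> order_refl] this]
      have "(\<lambda>n. Z (1 / real (Suc n)) \<omega>) \<longlonglongrightarrow> 0" by (simp add: Z_zero[OF \<omega>])
      from order_tendstoD(2)[OF this t] show ?thesis by (auto simp: eventually_sequentially)
    qed
    then show ?thesis by auto
  qed
  finally show ?thesis by (simp add: prob_space)
qed

text \<open>Monotone paths allow integer times only, which makes the event measurable.\<close>

lemma reaches_iff:
  assumes \<omega>: "\<omega> \<in> space M"
  shows "(\<exists>s>0. Z s \<omega> \<ge> t) \<longleftrightarrow> (\<exists>n. Z (real (Suc n)) \<omega> \<ge> t)"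
proof
  assume "\<exists>s>0. Z s \<omega> \<ge> t"
  then obtain s where s: "s > 0" "Z s \<omega> \<ge> t" by auto
  obtain n :: nat where "s \<le> real n" using real_arch_simple by blast
  then have "Z s \<omega> \<le> Z (real (Suc n)) \<omega>" using s by (intro Z_mono \<omega>) auto
  with s show "\<exists>n. Z (real (Suc n)) \<omega> \<ge> t" by (auto intro: order_trans)
next
  assume "\<exists>n. Z (real (Suc n)) \<omega> \<ge> t"
  then obtain n where "Z (real (Suc n)) \<omega> \<ge> t" by auto
  then show "\<exists>s>0. Z s \<omega> \<ge> t" by (intro exI[of _ "real (Suc n)"]) auto
qed

text \<open>Exponential Markov inequality at \<mu> = 1, where the Laplace exponent equals 1 + c: the
  probability of staying below t up to time n + 1 is at most exp(t - (n + 1) (1 + c)) and tends to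
  0.\<close>

lemma AE_reaches:
  assumes t: "t > 0"
  shows "AE \<omega> in M. \<exists>s>0. Z s \<omega> \<ge> t"
proof -
  define N where "N = {\<omega> \<in> space M. \<forall>n. Z (real (Suc n)) \<omega> < t}"
  have N [measurable]: "N \<in> events" unfolding N_def by measurable
  have bound: "prob N \<le> exp t * exp (- (real (Suc n) * (1 + c)))" for n
  proof -
    have m: "random_variable borel (Z (real (Suc n)))" by (rule measurable_Z) simp
    have int: "integrable M (\<lambda>\<omega>. exp (- 1 * Z (real (Suc n)) \<omega>))"
      using m by (intro integrable_const_bound[where B = 1]) (auto intro!: Z_nonneg)
    have "prob N = expectation (indicat_real N)" by simp
    also have "\<dots> \<le> expectation (\<lambda>\<omega>. exp t * exp (- 1 * Z (real (Suc n)) \<omega>))"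
    proof (rule integral_mono)
      show "integrable M (indicat_real N)"
        by (rule integrable_const_bound[where B = 1]) (auto split: split_indicator)
      show "integrable M (\<lambda>\<omega>. exp t * exp (- 1 * Z (real (Suc n)) \<omega>))"
        by (intro integrable_mult_right int)
      show "indicat_real N \<omega> \<le> exp t * exp (- 1 * Z (real (Suc n)) \<omega>)" for \<omega>
      proof (cases "\<omega> \<in> N")
        case True
        then have "Z (real (Suc n)) \<omega> < t" unfolding N_def by blast
        then have "1 \<le> exp (t - Z (real (Suc n)) \<omega>)" by simp
        then show ?thesis using True by (simp add: exp_diff exp_minus field_simps)
      qed simp
    qed
    also have "\<dots> = exp t * exp (- (real (Suc n) * (1 + c)))"
      using laplace_Z[of "real (Suc n)" 1] by simp
    finally show ?thesis .
  qed
  have "(\<lambda>n. exp t * exp (- (real (Suc n) * (1 + c)))) \<longlonglongrightarrow> 0"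
    using lam by real_asymp
  then have "prob N \<le> 0"
    by (rule LIMSEQ_le_const) (use bound in blast)
  then have "prob N = 0" using measure_nonneg[of M N] by linarith
  then have "AE \<omega> in M. \<omega> \<notin> N" by (simp add: prob_eq_0)
  then show ?thesis
    using AE_space by eventually_elim (auto simp: reaches_iff N_def not_less simp del: of_nat_Suc)
qed

text \<open>Right continuity yields the direction from left to right: if Z a < t, the path stays
  below t on an interval to the right of a, so the infimum exceeds a. The assumption
  \<open>reach\<close> keeps \<open>Inf\<close> away from the empty set.\<close>

lemma inverse_process_le_iff:
  assumes \<omega>: "\<omega> \<in> space M" and reach: "\<exists>s>0. Z s \<omega> \<ge> t" and a: "a > 0"
  shows "inverse_process Z t \<omega> \<le> a \<longleftrightarrow> Z a \<omega> \<ge> t"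
proof
  let ?S = "{s. s > 0 \<and> Z s \<omega> \<ge> t}"
  have bdd: "bdd_below ?S" by (rule bdd_belowI[of _ 0]) auto
  show "inverse_process Z t \<omega> \<le> a" if "Z a \<omega> \<ge> t"
    unfolding inverse_process_def using that a by (intro cInf_lower bdd) auto
  show "Z a \<omega> \<ge> t" if le: "inverse_process Z t \<omega> \<le> a"
  proof (rule ccontr)
    assume "\<not> Z a \<omega> \<ge> t"
    then have lt: "Z a \<omega> < t" by simp
    have "eventually (\<lambda>s. Z s \<omega> < t) (at_right a)"
      using a by (intro order_tendstoD[OF Z_right[OF \<omega>]] lt) simp
    then obtain b where b: "b > a" "\<And>s. a < s \<Longrightarrow> s < b \<Longrightarrow> Z s \<omega> < t"
      unfolding eventually_at_right_field by auto
    have "b \<le> Inf ?S"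
    proof (rule cInf_greatest)
      show "?S \<noteq> {}" using reach by auto
      fix s assume s: "s \<in> ?S"
      show "b \<le> s"
      proof (rule ccontr)
        assume "\<not> b \<le> s"
        then have "s < b" by simp
        then have "s \<le> a" using b(2)[of s] s by (cases "a < s") auto
        then show False using Z_mono[OF \<omega>, of s a] s lt by auto
      qed
    qed
    with le b(1) show False by (simp add: inverse_process_def)
  qed
qed

lemma inverse_process_measurable [measurable]:
  assumes t: "t > 0"
  shows "random_variable borel (inverse_process Z t)"
proof (rule borel_measurableI_less)
  fix a :: real
  define N where "N = {\<omega> \<in> space M. \<forall>n. Z (real (Suc n)) \<omega> < t}"
  have N: "N \<in> events" unfolding N_def by measurable
  have reach: "\<omega> \<in> N \<longleftrightarrow> \<not> (\<exists>s>0. Z s \<omega> \<ge> t)" if "\<omega> \<in> space M" for \<omega>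
    using that unfolding reaches_iff[OF that] N_def by (auto simp: not_le simp del: of_nat_Suc)
  define Q where "Q = {q::rat. 0 < q \<and> of_rat q < a}"
  \<comment> \<open>Where the level is reached, monotonicity reduces the event to countably many
    rational times; on \<open>N\<close> the process equals the constant \<open>Inf {}\<close>,
    whatever its value.\<close>
  have "{\<omega> \<in> space M. inverse_process Z t \<omega> < a}
     = (\<Union>q\<in>Q. {\<omega> \<in> space M. Z (of_rat q) \<omega> \<ge> t}) \<union> (N \<inter> {\<omega> \<in> space M. Inf ({}::real set) < a})"
  proof (intro set_eqI iffI)
    fix \<omega> assume "\<omega> \<in> {\<omega> \<in> space M. inverse_process Z t \<omega> < a}"
    then have \<omega>: "\<omega> \<in> space M" and lt: "inverse_process Z t \<omega> < a" by auto
    show "\<omega> \<in> (\<Union>q\<in>Q. {\<omega> \<in> space M. Z (of_rat q) \<omega> \<ge> t}) \<union> (N \<inter> {\<omega> \<in> space M. Inf ({}::real set) < a})"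
    proof (cases "\<omega> \<in> N")
      case True
      then have "{s. s > 0 \<and> Z s \<omega> \<ge> t} = {}" using reach[OF \<omega>] by auto
      then have "inverse_process Z t \<omega> = Inf {}" by (simp only: inverse_process_def)
      then show ?thesis using True lt \<omega> by simp
    next
      case False
      then have "{s. s > 0 \<and> Z s \<omega> \<ge> t} \<noteq> {}" using reach[OF \<omega>] by auto
      from cInf_lessD[OF this, of a] lt obtain s where s: "0 < s" "t \<le> Z s \<omega>" "s < a"
        by (auto simp: inverse_process_def)
      obtain q where q: "s < of_rat q" "of_rat q < a" using of_rat_dense[OF s(3)] by auto
      have "0 < (of_rat q :: real)" using s(1) q(1) by linarith
      then have "q \<in> Q" using q by (simp add: Q_def)
      moreover have "t \<le> Z (of_rat q) \<omega>"
        using s q Z_mono[OF \<omega>, of s "of_rat q"] by auto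
      ultimately show ?thesis using \<omega> by auto
    qed
  next
    fix \<omega> assume "\<omega> \<in> (\<Union>q\<in>Q. {\<omega> \<in> space M. Z (of_rat q) \<omega> \<ge> t}) \<union> (N \<inter> {\<omega> \<in> space M. Inf ({}::real set) < a})"
    then consider q where "q \<in> Q" "\<omega> \<in> space M" "Z (of_rat q) \<omega> \<ge> t" | "\<omega> \<in> N" "\<omega> \<in> space M" "Inf ({}::real set) < a"
      by auto
    then show "\<omega> \<in> {\<omega> \<in> space M. inverse_process Z t \<omega> < a}"
    proof cases
      case 1
      then have q: "0 < (of_rat q :: real)" "of_rat q < a" by (auto simp: Q_def)
      then have "inverse_process Z t \<omega> \<le> of_rat q"
        using 1 inverse_process_le_iff[of \<omega> t "of_rat q"] by blast
      then show ?thesis using 1 q by auto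
    next
      case 2
      then have "{s. s > 0 \<and> Z s \<omega> \<ge> t} = {}" using reach by auto
      then have "inverse_process Z t \<omega> = Inf {}" by (simp only: inverse_process_def)
      then show ?thesis using 2 by simp
    qed
  qed
  also have "\<dots> \<in> events"
  proof (rule sets.Un)
    show "(\<Union>q\<in>Q. {\<omega> \<in> space M. Z (of_rat q) \<omega> \<ge> t}) \<in> events"
    proof (rule sets.countable_UN')
      show "(\<lambda>q. {\<omega> \<in> space M. Z (of_rat q) \<omega> \<ge> t}) ` Q \<subseteq> events"
      proof (intro image_subsetI)
        fix q assume "q \<in> Q"
        then have "random_variable borel (Z (of_rat q))"
          by (intro measurable_Z) (auto simp: Q_def)
        then show "{\<omega> \<in> space M. Z (of_rat q) \<omega> \<ge> t} \<in> events" by measurable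
      qed
    qed simp
    show "N \<inter> {\<omega> \<in> space M. Inf ({}::real set) < a} \<in> events"
      by (intro sets.Int N) simp
  qed
  finally show "{\<omega> \<in> space M. inverse_process Z t \<omega> < a} \<in> events" .
qed

lemma emeasure_inverse_process_le:
  assumes t: "t > 0"
  shows "emeasure M {\<omega> \<in> space M. inverse_process Z t \<omega> \<le> a}
    = ennreal (if a > 0 then 1 - prob {\<omega> \<in> space M. Z a \<omega> < t} else 0)"
proof -
  note [measurable] = inverse_process_measurable[OF t]
  have pos: "prob {\<omega> \<in> space M. inverse_process Z t \<omega> \<le> b} = 1 - prob {\<omega> \<in> space M. Z b \<omega> < t}" if b: "b > 0" for b
  proof -
    have m [measurable]: "random_variable borel (Z b)" using b by (intro measurable_Z) simp
    have "prob {\<omega> \<in> space M. inverse_process Z t \<omega> \<le> b} = prob (space M - {\<omega> \<in> space M. Z b \<omega> < t})"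
    proof (rule finite_measure_eq_AE)
      show "AE \<omega> in M. (\<omega> \<in> {\<omega> \<in> space M. inverse_process Z t \<omega> \<le> b}) = (\<omega> \<in> space M - {\<omega> \<in> space M. Z b \<omega> < t})"
        using AE_reaches[OF t] AE_space
        by eventually_elim (auto simp: inverse_process_le_iff b not_less)
    qed measurable
    also have "\<dots> = 1 - prob {\<omega> \<in> space M. Z b \<omega> < t}"
      by (rule prob_compl) measurable
    finally show ?thesis .
  qed
  \<comment> \<open>For a <= 0 the criterion at positive times does not apply directly; the event is
    enclosed in those for 1 / (n + 1), whose probabilities tend to 0.\<close>
  have "prob {\<omega> \<in> space M. inverse_process Z t \<omega> \<le> a} = 0" if a: "a \<le> 0"
  proof -
    have "prob {\<omega> \<in> space M. inverse_process Z t \<omega> \<le> a} \<le> 1 - prob {\<omega> \<in> space M. Z (1 / real (Suc n)) \<omega> < t}" for n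
    proof -
      have "0 \<le> 1 / real (Suc n)" by simp
      with a have "a \<le> 1 / real (Suc n)" by linarith
      then have "prob {\<omega> \<in> space M. inverse_process Z t \<omega> \<le> a} \<le> prob {\<omega> \<in> space M. inverse_process Z t \<omega> \<le> 1 / real (Suc n)}"
        by (intro finite_measure_mono) auto
      also have "\<dots> = 1 - prob {\<omega> \<in> space M. Z (1 / real (Suc n)) \<omega> < t}"
        by (rule pos) simp
      finally show ?thesis .
    qed
    moreover have "(\<lambda>n. 1 - prob {\<omega> \<in> space M. Z (1 / real (Suc n)) \<omega> < t}) \<longlonglongrightarrow> 1 - 1"
      by (intro tendsto_intros tendsto_prob_Z_zero t)
    ultimately have "prob {\<omega> \<in> space M. inverse_process Z t \<omega> \<le> a} \<le> 1 - 1"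
      by (intro LIMSEQ_le_const) auto
    then show ?thesis using measure_nonneg[of M "{\<omega> \<in> space M. inverse_process Z t \<omega> \<le> a}"] by linarith
  qed
  then show ?thesis
    using pos[of a] by (simp add: emeasure_eq_measure)
qed

lemma distributed_inverse_process:
  assumes t: "t > 0"
  shows "distributed M lborel (inverse_process Z t) (\<lambda>x. ennreal (if x > 0 then conv_density c x t else 0))"
proof (rule distributedI_borel_atMost)
  show "random_variable borel (inverse_process Z t)" by (rule inverse_process_measurable[OF t])
  show "(\<lambda>x. if x > 0 then conv_density c x t else 0) \<in> borel_measurable borel" by measurable
  show "AE x in lborel. 0 \<le> (if x > 0 then conv_density c x t else 0)"
    by (intro AE_I2) (auto intro: conv_density_nonneg t)
  fix a :: real
  show "emeasure M {\<omega> \<in> space M. inverse_process Z t \<omega> \<le> a}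
     = ennreal (if a > 0 then 1 - prob {\<omega> \<in> space M. Z a \<omega> < t} else 0)"
    by (rule emeasure_inverse_process_le[OF t])
  have "(\<integral>\<^sup>+x. ennreal (if x > 0 then conv_density c x t else 0) * indicator {..a} x \<partial>lborel)
     = ennreal (if a > 0 then 1 - prob {\<omega> \<in> space M. Z a \<omega> < t} else 0)"
  proof (cases "a > 0")
    case False
    then have "(\<integral>\<^sup>+x. ennreal (if x > 0 then conv_density c x t else 0) * indicator {..a} x \<partial>lborel) = (\<integral>\<^sup>+x. 0 \<partial>(lborel::real measure))"
      by (intro nn_integral_cong) (auto split: split_indicator)
    then show ?thesis using False by simp
  next
    case True
    \<comment> \<open>The integral identity is available only on intervals with positive left end
      point, so (0, a] is exhausted by [1 / (n + 1), a] and monotone convergence is used.\<close>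
    define f where "f = (\<lambda>n x. ennreal (conv_density c x t) * indicator {1 / real (Suc n)..a} x)"
    define p where "p = (\<lambda>x. prob {\<omega> \<in> space M. Z x \<omega> < t})"
    have "(\<lambda>n. \<integral>\<^sup>+x. f n x \<partial>lborel) \<longlonglongrightarrow> (\<integral>\<^sup>+x. ennreal (if x > 0 then conv_density c x t else 0) * indicator {..a} x \<partial>lborel)"
    proof (rule nn_integral_LIMSEQ)
      show "incseq f"
      proof (rule incseq_SucI, rule le_funI)
        fix n x
        have "1 / real (Suc (Suc n)) \<le> 1 / real (Suc n)" by (intro frac_le) auto
        then show "f n x \<le> f (Suc n) x"
          unfolding f_def by (auto split: split_indicator)
      qed
      show "\<And>n. f n \<in> borel_measurable lborel" unfolding f_def by measurable
      fix x
      have "(\<lambda>n. indicator {1 / real (Suc n)..a} x :: ennreal) \<longlonglongrightarrow> indicator {0<..a} x"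
      proof (cases "x > 0")
        case True
        have "(\<lambda>n. 1 / real (Suc n)) \<longlonglongrightarrow> 0" by real_asymp
        from order_tendstoD(2)[OF this True]
        have "\<forall>\<^sub>F n in sequentially. (indicator {1 / real (Suc n)..a} x :: ennreal) = indicator {0<..a} x"
          by eventually_elim (use True in \<open>auto simp: indicator_def\<close>)
        then show ?thesis by (rule tendsto_eventually)
      next
        case False
        have "(indicator {1 / real (Suc n)..a} x :: ennreal) = indicator {0<..a} x" for n
        proof -
          have "0 < 1 / real (Suc n)" by simp
          with False have "\<not> 1 / real (Suc n) \<le> x" by linarith
          then show ?thesis using False by (simp add: indicator_def)
        qed
        then show ?thesis by simp
      qed
      then have "(\<lambda>n. f n x) \<longlonglongrightarrow> ennreal (conv_density c x t) * indicator {0<..a} x"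
        unfolding f_def by (intro ennreal_tendsto_cmult) auto
      also have "ennreal (conv_density c x t) * indicator {0<..a} x
          = ennreal (if x > 0 then conv_density c x t else 0) * indicator {..a} x"
        by (auto split: split_indicator)
      finally show "(\<lambda>n. f n x) \<longlonglongrightarrow> ennreal (if x > 0 then conv_density c x t else 0) * indicator {..a} x" .
    qed
    moreover have "(\<lambda>n. \<integral>\<^sup>+x. f n x \<partial>lborel) \<longlonglongrightarrow> ennreal (1 - p a)"
    proof (rule Lim_transform_eventually)
      show "(\<lambda>n. ennreal (p (1 / real (Suc n)) - p a)) \<longlonglongrightarrow> ennreal (1 - p a)"
        unfolding p_def by (intro tendsto_ennrealI tendsto_diff tendsto_prob_Z_zero t tendsto_const)
      have "(\<lambda>n. 1 / real (Suc n)) \<longlonglongrightarrow> 0" by real_asymp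
      from order_tendstoD(2)[OF this True]
      show "\<forall>\<^sub>F n in sequentially. ennreal (p (1 / real (Suc n)) - p a) = (\<integral>\<^sup>+x. f n x \<partial>lborel)"
      proof eventually_elim
        case (elim n)
        define \<epsilon> where "\<epsilon> = 1 / real (Suc n)"
        have \<epsilon>: "0 < \<epsilon>" "\<epsilon> < a" using elim by (auto simp: \<epsilon>_def)
        have int: "set_integrable lborel {\<epsilon>..a} (\<lambda>x. conv_density c x t)"
        proof (rule borel_integrable_atLeastAtMost')
          show "continuous_on {\<epsilon>..a} (\<lambda>x. conv_density c x t)"
            unfolding continuous_on_sequentially o_def
            using \<epsilon> by (auto intro!: tendsto_conv_density c_pos)
        qed
        have "(\<integral>\<^sup>+x. f n x \<partial>lborel) = (\<integral>\<^sup>+x. ennreal (indicat_real {\<epsilon>..a} x *\<^sub>R conv_density c x t) \<partial>lborel)"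
          unfolding f_def \<epsilon>_def by (intro nn_integral_cong) (auto split: split_indicator)
        also have "\<dots> = ennreal (LBINT x:{\<epsilon>..a}. conv_density c x t)"
          unfolding set_lebesgue_integral_def using int \<epsilon> t
          by (intro nn_integral_eq_integral) (auto simp: set_integrable_def intro!: conv_density_nonneg AE_I2 split: split_indicator)
        finally show ?case
          unfolding integral_conv_density_eq[OF \<epsilon> t] unfolding p_def \<epsilon>_def by simp
      qed
    qed
    ultimately have "(\<integral>\<^sup>+x. ennreal (if x > 0 then conv_density c x t else 0) * indicator {..a} x \<partial>lborel) = ennreal (1 - p a)"
      by (rule LIMSEQ_unique)
    then show ?thesis using True by (simp add: p_def)
  qed
  moreover have "(\<integral>\<^sup>+x. ennreal (if x > 0 then conv_density c x t else 0) * indicator {..a} x \<partial>lborel)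
      = (\<integral>\<^sup>+x. ennreal ((if x > 0 then conv_density c x t else 0) * indicator {..a} x) \<partial>lborel)"
    by (intro nn_integral_cong) (auto split: split_indicator)
  ultimately show "(\<integral>\<^sup>+x. ennreal ((if x > 0 then conv_density c x t else 0) * indicator {..a} x) \<partial>lborel)
     = ennreal (if a > 0 then 1 - prob {\<omega> \<in> space M. Z a \<omega> < t} else 0)"
    by (simp only:)
qed

end

text \<open>The further conjuncts exclude default values: the Lebesgue integral of a non-integrable
  function is 0, and \<open>ennreal\<close> sends negative numbers to 0, so without them the density
  could agree with the formula for the wrong reason.\<close>

theorem mainTheorem9:
  fixes M :: "'a measure"
    and H1 H2 :: "real \<Rightarrow> 'a \<Rightarrow> real"
    and lam t :: real
  assumes "prob_space M"
    and "prob_space.stable_subordinator M (2 / 3) H1"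
    and "prob_space.stable_subordinator M (1 / 3) H2"
    and "prob_space.indep_processes M H1 H2"
    and "lam > 0" and "t > 0"
  shows "distributed M lborel (inverse_process (sum_process lam H1 H2) t)
           (\<lambda>x. ennreal (if x > 0 then inverse_density lam t x else 0))
       \<and> (\<forall>x>0. (\<forall>s\<in>{0<..<t}. set_integrable lborel {0<..} (density_integrand lam t x s))
             \<and> set_integrable lborel {0<..<t} (\<lambda>s. LBINT w:{0<..}. density_integrand lam t x s w)
             \<and> 0 \<le> inverse_density lam t x)"
proof -
  interpret prob_space M by fact
  interpret mixed_stable_subordinator M H1 H2 lam
    using assms by unfold_locales
  have "(\<lambda>x. ennreal (if x > 0 then inverse_density lam t x else 0))
      = (\<lambda>x. ennreal (if x > 0 then conv_density c x t else 0))"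
    using inverse_density_eq_conv_density(2)[OF \<open>lam > 0\<close>] by auto
  then show ?thesis
    using distributed_inverse_process[OF \<open>t > 0\<close>] inverse_density_integrand(1)[OF \<open>lam > 0\<close>]
      inverse_density_eq_conv_density[OF \<open>lam > 0\<close>] conv_density_nonneg[OF _ \<open>t > 0\<close>]
    by simp
qed

end
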